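(* Let $p\in(1,2)\cup(2,\infty)$, let $1/p+1/p^*=1$, let $\Omega\subset\mathbb{R}^n$ be a bounded domain with sufficiently smooth boundary, and let $f\in L^{p^*}(\Omega)$ not change sign, that is, either ${\rm Sgn}(f)=1$ or ${\rm Sgn}(f)=-1$ on $\overline{\Omega}$. Then for every $\epsilon>0$ there exists at least one minimizer $\bar u_\epsilon\in W^{1,p}_0(\Omega)$ of the functional $I^{(\epsilon)}$ over $W^{1,p}_0(\Omega)$, and these minimizers satisfy: (i) $\bar u_\epsilon\ge 0$ a.e. in $\Omega$ if ${\rm Sgn}(f)=1$; (ii) $\bar u_\epsilon\le 0$ a.e. in $\Omega$ if ${\rm Sgn}(f)=-1$; (iii) $\bar u_\epsilon\to\bar u$ in $W^{1,p}_0(\Omega)$ as $\epsilon\to0$, where $\bar u$ is the unique minimizer of $I$ over $W^{1,p}_0(\Omega)$ (positive if ${\rm Sgn}(f)=1$, negative if ${\rm Sgn}(f)=-1$).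
   Context: Set $\chi(p)=1$ for $p\in(1,2)$ and $\chi(p)=0$ for $p\in(2,\infty)$. For $u\in W^{1,p}_0(\Omega)$ and $\epsilon>0$ define $$I[u]=\frac1p\int_\Omega|\nabla u|^p\,dx-\int_\Omega fu\,dx,\qquad I^{(\epsilon)}[u]=\frac1p\int_\Omega\big(|\nabla u|^2+\chi(p)\epsilon^2\big)^{p/2}dx-\int_\Omega fu\,dx .$$ ${\rm Sgn}(f)=1$ means $f>0$ (a.e.), and ${\rm Sgn}(f)=-1$ means $f<0$ (a.e.). *)

theory Defs
  imports "HOL-Analysis.Analysis"
begin

fun Ck :: "nat \<Rightarrow> ('a::euclidean_space \<Rightarrow> real) \<Rightarrow> bool" where
  "Ck 0 \<phi> \<longleftrightarrow> continuous_on UNIV \<phi>"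
| "Ck (Suc k) \<phi> \<longleftrightarrow> (\<forall>x. \<phi> differentiable (at x)) \<and>
     (\<forall>b\<in>Basis. Ck k (\<lambda>x. frechet_derivative \<phi> (at x) b))"

(* Near each boundary point, \<Omega> is the set strictly above the graph of a C^k function over a
   hyperplane, in the direction of the unit normal e of that hyperplane. Only the values of \<gamma>
   on the orthogonal complement of e matter. *)
definition Ck_boundary :: "nat \<Rightarrow> 'a::euclidean_space set \<Rightarrow> bool" where
  "Ck_boundary k \<Omega> \<longleftrightarrow> (\<forall>x0 \<in> frontier \<Omega>. \<exists>r>0. \<exists>e \<gamma>. norm e = 1 \<and> Ck k \<gamma> \<and>
     \<Omega> \<inter> ball x0 r = {x \<in> ball x0 r. \<gamma> (x - (x \<bullet> e) *\<^sub>R e) < x \<bullet> e})"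

definition test_function :: "'a::euclidean_space set \<Rightarrow> ('a \<Rightarrow> real) \<Rightarrow> bool" where
  "test_function \<Omega> \<phi> \<longleftrightarrow> (\<forall>k. Ck k \<phi>) \<and>
     compact (closure {x. \<phi> x \<noteq> 0}) \<and> closure {x. \<phi> x \<noteq> 0} \<subseteq> \<Omega>"

(* Elements of the Lebesgue and Sobolev spaces below are representatives (total functions whose
   values outside \<Omega> are irrelevant); equality in these spaces is equality a.e. in \<Omega>. *)

definition Lp :: "real \<Rightarrow> 'a::euclidean_space set \<Rightarrow> ('a \<Rightarrow> 'b::euclidean_space) set" where
  "Lp p \<Omega> = {u \<in> borel_measurable (lebesgue_on \<Omega>).
     integrable (lebesgue_on \<Omega>) (\<lambda>x. norm (u x) powr p)}"

definition has_weak_gradient ::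
  "'a::euclidean_space set \<Rightarrow> ('a \<Rightarrow> real) \<Rightarrow> ('a \<Rightarrow> 'a) \<Rightarrow> bool" where
  "has_weak_gradient \<Omega> u g \<longleftrightarrow>
     (\<forall>K. compact K \<and> K \<subseteq> \<Omega> \<longrightarrow> u absolutely_integrable_on K \<and> g absolutely_integrable_on K) \<and>
     (\<forall>\<phi>. test_function \<Omega> \<phi> \<longrightarrow> (\<forall>b\<in>Basis.
        (LINT x|lebesgue_on \<Omega>. u x * frechet_derivative \<phi> (at x) b)
        = - (LINT x|lebesgue_on \<Omega>. (g x \<bullet> b) * \<phi> x)))"

(* A weak gradient is unique up to a null subset of \<Omega>, so everything below is independent of
   the representative chosen here. *)
definition weak_gradient :: "'a::euclidean_space set \<Rightarrow> ('a \<Rightarrow> real) \<Rightarrow> 'a \<Rightarrow> 'a" where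
  "weak_gradient \<Omega> u = (SOME g. has_weak_gradient \<Omega> u g)"

definition W1p :: "real \<Rightarrow> 'a::euclidean_space set \<Rightarrow> ('a \<Rightarrow> real) set" where
  "W1p p \<Omega> = {u \<in> Lp p \<Omega>. \<exists>g \<in> Lp p \<Omega>. has_weak_gradient \<Omega> u g}"

definition W1p_norm :: "real \<Rightarrow> 'a::euclidean_space set \<Rightarrow> ('a \<Rightarrow> real) \<Rightarrow> real" where
  "W1p_norm p \<Omega> u =
     ((LINT x|lebesgue_on \<Omega>. \<bar>u x\<bar> powr p)
      + (LINT x|lebesgue_on \<Omega>. norm (weak_gradient \<Omega> u x) powr p)) powr (1 / p)"

definition W1p0 :: "real \<Rightarrow> 'a::euclidean_space set \<Rightarrow> ('a \<Rightarrow> real) set" where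
  "W1p0 p \<Omega> = {u \<in> W1p p \<Omega>. \<exists>\<phi>. (\<forall>k::nat. test_function \<Omega> (\<phi> k)) \<and>
     (\<lambda>k. W1p_norm p \<Omega> (\<lambda>x. \<phi> k x - u x)) \<longlonglongrightarrow> 0}"

definition chi :: "real \<Rightarrow> real" where
  "chi p = (if 1 < p \<and> p < 2 then 1 else 0)"

definition energy ::
  "real \<Rightarrow> 'a::euclidean_space set \<Rightarrow> ('a \<Rightarrow> real) \<Rightarrow> ('a \<Rightarrow> real) \<Rightarrow> real" where
  "energy p \<Omega> f u =
     1 / p * (LINT x|lebesgue_on \<Omega>. norm (weak_gradient \<Omega> u x) powr p)
     - (LINT x|lebesgue_on \<Omega>. f x * u x)"

definition energy_eps ::
  "real \<Rightarrow> 'a::euclidean_space set \<Rightarrow> ('a \<Rightarrow> real) \<Rightarrow> real \<Rightarrow> ('a \<Rightarrow> real) \<Rightarrow> real" where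
  "energy_eps p \<Omega> f \<epsilon> u =
     1 / p * (LINT x|lebesgue_on \<Omega>.
       ((norm (weak_gradient \<Omega> u x))\<^sup>2 + chi p * \<epsilon>\<^sup>2) powr (p / 2))
     - (LINT x|lebesgue_on \<Omega>. f x * u x)"

definition minimizer_over :: "'b set \<Rightarrow> ('b \<Rightarrow> real) \<Rightarrow> 'b \<Rightarrow> bool" where
  "minimizer_over V J u \<longleftrightarrow> is_arg_min J (\<lambda>v. v \<in> V) u"

end

theory Submission
  imports Defs
begin

text \<open>The direct method, without weak compactness. Since \<open>(\<bar>g\<bar>\<^sup>2 + s\<^sup>2)\<^bsup>p/2\<^esup>\<close> is the \<open>p\<close>-th power of
  the norm of \<open>(g, s)\<close>, both functionals are instances of one functional with parameter
  \<open>s = \<chi>(p) \<epsilon>\<close>. By homogeneity and compactness of the unit sphere, strict convexity of \<open>\<bar>\<cdot>\<bar>\<^sup>p\<close> bounds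
  \<open>\<bar>a - b\<bar>\<^sup>p\<close> by the convexity deficit at the midpoint of \<open>a\<close> and \<open>b\<close>, up to a small multiple of
  \<open>\<bar>a\<bar>\<^sup>p + \<bar>b\<bar>\<^sup>p\<close>. With the Poincare inequality, minimizing sequences are therefore Cauchy in \<open>W\<^sup>1\<^sup>p\<close>;
  this yields existence and uniqueness, and also convergence, because the minimizers of the
  regularized functionals form a minimizing sequence of the limit functional as \<open>\<epsilon>\<close> tends to \<open>0\<close>.
  The sign of a minimizer \<open>u\<close> follows by comparison with \<open>\<bar>u\<bar>\<close>, and strict positivity by
  comparison with \<open>max u (t \<psi>)\<close> for bump functions \<open>\<psi>\<close> as \<open>t\<close> tends to \<open>0\<close>.\<close>

section \<open>Functions with continuous derivatives\<close>

text \<open>Since \<open>weak_gradient\<close> is a \<open>SOME\<close> choice, only its defining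
  property is known. The argument therefore runs on pairs of a function and its gradient, namely the
  \<open>Lp\<close> closure of the pairs that come from test functions. Uniqueness and measurability
  of weak gradients enter when statements about \<open>W1p0\<close> and the energies are translated
  into pairs. The regularized integrand is not homogeneous in the gradient alone. The constant extra
  coordinate restores the homogeneity needed for compactness on the sphere, and it cancels in
  differences. The small multiple in the convexity bound is unavoidable for p < 2, because near a =
  b different from 0 the midpoint deficit is only of order |a - b|^2. It does no harm, because
  almost minimizers have bounded energy by coercivity. So one bound serves both ranges of p. Lattice
  operations are not smooth; they are limits of compositions with smooth functions that vanish at 0,
  since these map test functions to test functions.\<close>

lemma Ck_continuous: "Ck k \<phi> \<Longrightarrow> continuous_on UNIV \<phi>"
  by (cases k) (auto intro!: continuous_at_imp_continuous_on differentiable_imp_continuous_within)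

lemma Ck_Suc_imp: "Ck (Suc k) \<phi> \<Longrightarrow> Ck k \<phi>"
proof (induction k arbitrary: \<phi>)
  case 0
  then show ?case using Ck_continuous[of "Suc 0" \<phi>] by simp
next
  case (Suc k)
  have "Ck k (\<lambda>x. frechet_derivative \<phi> (at x) b)" if "b \<in> Basis" for b
    using Suc.prems that by (intro Suc.IH) simp
  then show ?case using Suc.prems by simp
qed

text \<open>\<open>frechet_derivative\<close> is a choice, so a computed derivative must be turned
  into an equation before unfolding \<open>Ck\<close> can expose it to the induction.\<close>

lemma frechet_derivative_eqI:
  assumes "(f has_derivative f') (at x)"
  shows "frechet_derivative f (at x) = f'" "f differentiable (at x)"
  using frechet_derivative_at[OF assms] assms by (auto simp: differentiable_def)

lemma Ck_const: "Ck k (\<lambda>x. c)"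
  by (induction k arbitrary: c) auto

lemma Ck_inner: "Ck k (\<lambda>x. x \<bullet> c)"
proof (cases k)
  case (Suc m)
  have "((\<lambda>x. x \<bullet> c) has_derivative (\<lambda>y. y \<bullet> c)) (at x)" for x
    by (auto intro!: derivative_eq_intros)
  then have "frechet_derivative (\<lambda>x. x \<bullet> c) (at x) = (\<lambda>y. y \<bullet> c)" 
    "(\<lambda>x. x \<bullet> c) differentiable (at x)" for x
    by (rule frechet_derivative_eqI)+
  then show ?thesis by (simp add: Suc Ck_const)
qed (auto intro!: continuous_intros)

lemma Ck_add: "Ck k \<phi> \<Longrightarrow> Ck k \<psi> \<Longrightarrow> Ck k (\<lambda>x. \<phi> x + \<psi> x)"
proof (induction k arbitrary: \<phi> \<psi>)
  case (Suc k)
  have "((\<lambda>x. \<phi> x + \<psi> x) has_derivative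
      (\<lambda>y. frechet_derivative \<phi> (at x) y + frechet_derivative \<psi> (at x) y)) (at x)" for x
    using Suc.prems by (auto intro!: derivative_intros simp: frechet_derivative_works[symmetric])
  then have "frechet_derivative (\<lambda>x. \<phi> x + \<psi> x) (at x)
     = (\<lambda>y. frechet_derivative \<phi> (at x) y + frechet_derivative \<psi> (at x) y)"
     "(\<lambda>x. \<phi> x + \<psi> x) differentiable (at x)" for x
    by (rule frechet_derivative_eqI)+
  note * = this
  show ?case unfolding Ck.simps *(1)
    by (intro conjI allI ballI *(2) Suc.IH) (use Suc.prems in simp_all)
qed (auto intro!: continuous_intros)

lemma Ck_mult: "Ck k \<phi> \<Longrightarrow> Ck k \<psi> \<Longrightarrow> Ck k (\<lambda>x. \<phi> x * \<psi> x)"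
proof (induction k arbitrary: \<phi> \<psi>)
  case (Suc k)
  have "((\<lambda>x. \<phi> x * \<psi> x) has_derivative
      (\<lambda>y. \<phi> x * frechet_derivative \<psi> (at x) y + frechet_derivative \<phi> (at x) y * \<psi> x)) (at x)" for x
    using Suc.prems by (auto intro!: derivative_intros simp: frechet_derivative_works[symmetric])
  then have "frechet_derivative (\<lambda>x. \<phi> x * \<psi> x) (at x)
     = (\<lambda>y. \<phi> x * frechet_derivative \<psi> (at x) y + frechet_derivative \<phi> (at x) y * \<psi> x)"
     "(\<lambda>x. \<phi> x * \<psi> x) differentiable (at x)" for x
    by (rule frechet_derivative_eqI)+
  note * = this
  show ?case unfolding Ck.simps *(1)
    by (intro conjI allI ballI *(2) Ck_add Suc.IH Ck_Suc_imp[OF Suc.prems(1)] Ck_Suc_imp[OF Suc.prems(2)])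
      (use Suc.prems in simp_all)
qed (auto intro!: continuous_intros)

lemma Ck_prod: "(\<And>i. i \<in> I \<Longrightarrow> Ck k (\<phi> i)) \<Longrightarrow> Ck k (\<lambda>x. \<Prod>i\<in>I. \<phi> i x)"
  by (induction I rule: infinite_finite_induct) (auto intro!: Ck_mult Ck_const)

lemma Ck_power: "Ck k \<phi> \<Longrightarrow> Ck k (\<lambda>x. \<phi> x ^ n)"
  by (induction n) (auto intro!: Ck_mult Ck_const)

lemma Ck_diff: "Ck k \<phi> \<Longrightarrow> Ck k \<psi> \<Longrightarrow> Ck k (\<lambda>x. \<phi> x - \<psi> x)"
  using Ck_add[of k \<phi> "\<lambda>x. (-1) * \<psi> x"] Ck_mult[OF Ck_const, of k \<psi> "-1"] by simp

text \<open>The whole tower \<open>D\<close> of derivatives is given at once and \<open>n\<close>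
  stays arbitrary in the induction, because differentiating \<open>D n\<close> after \<phi> produces
  \<open>D (Suc n)\<close> after \<phi>.\<close>

lemma Ck_compose:
  assumes "\<And>n t. (D n has_real_derivative D (Suc n) t) (at t)"
  shows "Ck k \<phi> \<Longrightarrow> Ck k (\<lambda>x. D n (\<phi> x))"
proof (induction k arbitrary: n)
  case 0
  have "continuous_on UNIV (D n)"
    using DERIV_isCont[OF assms] by (simp add: continuous_at_imp_continuous_on)
  then show ?case using 0 continuous_on_compose2[of UNIV "D n" UNIV \<phi>] by simp
next
  case (Suc k)
  have "((\<lambda>x. D n (\<phi> x)) has_derivative
      (\<lambda>y. frechet_derivative \<phi> (at x) y * D (Suc n) (\<phi> x))) (at x)" for x
    using Suc.prems by (intro DERIV_compose_FDERIV[OF assms]) (simp add: frechet_derivative_works[symmetric])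
  then have "frechet_derivative (\<lambda>x. D n (\<phi> x)) (at x) =
      (\<lambda>y. frechet_derivative \<phi> (at x) y * D (Suc n) (\<phi> x))"
     "(\<lambda>x. D n (\<phi> x)) differentiable (at x)" for x
    by (rule frechet_derivative_eqI)+
  note * = this
  show ?case unfolding Ck.simps *(1)
    by (intro conjI allI ballI *(2) Ck_mult Suc.IH Ck_Suc_imp[OF Suc.prems]) (use Suc.prems in simp_all)
qed

section \<open>Smooth bump functions supported in boxes\<close>

fun bump_poly :: "nat \<Rightarrow> real poly" where
  "bump_poly 0 = 1"
| "bump_poly (Suc n) = [:0, 0, 1:] * (bump_poly n - pderiv (bump_poly n))"

text \<open>For t > 0 this is the n-th derivative of exp(-1/t). With y = 1/t one has dy/dt = -y^2,
  so differentiating P(y) exp(-y) gives y^2 (P(y) - P'(y)) exp(-y), the recursion of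
  \<open>bump_poly\<close>.\<close>

definition bump_deriv :: "nat \<Rightarrow> real \<Rightarrow> real" where
  "bump_deriv n t = (if t > 0 then poly (bump_poly n) (1 / t) * exp (- (1 / t)) else 0)"

lemma poly_times_exp_tendsto_0:
  fixes P :: "real poly"
  shows "((\<lambda>y. poly P y * exp (- y)) \<longlongrightarrow> 0) at_top"
proof -
  have "((\<lambda>y. \<Sum>i\<le>degree P. coeff P i * (y ^ i / exp y)) \<longlongrightarrow> (\<Sum>i\<le>degree P. coeff P i * 0)) at_top"
    by (intro tendsto_intros tendsto_power_div_exp_0)
  moreover have "(\<lambda>y. \<Sum>i\<le>degree P. coeff P i * (y ^ i / exp y)) = (\<lambda>y. poly P y * exp (- y))"
    by (simp add: poly_altdef exp_minus sum_distrib_right divide_inverse mult.assoc)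
  ultimately show ?thesis by simp
qed

text \<open>Only t = 0 is delicate. There the quotient from the left is 0, and from the right it
  tends to 0 because exp beats every polynomial.\<close>

lemma bump_deriv_has_derivative:
  "(bump_deriv n has_real_derivative bump_deriv (Suc n) t) (at t)"
proof -
  consider "t > 0" | "t < 0" | "t = 0" by linarith
  then show ?thesis
  proof cases
    case 1
    have "((\<lambda>t. poly (bump_poly n) (1 / t) * exp (- (1 / t))) has_real_derivative
        bump_deriv (Suc n) t) (at t)"
      using 1 by (auto intro!: derivative_eq_intros DERIV_chain2[OF poly_DERIV]
        simp: bump_deriv_def field_simps power2_eq_square)
    then show ?thesis
      by (rule has_field_derivative_transform_within_open[of _ _ _ "{0<..}"]) (use 1 in \<open>auto simp: bump_deriv_def\<close>)
  next
    case 2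
    have "((\<lambda>t. 0) has_real_derivative bump_deriv (Suc n) t) (at t)"
      using 2 by (simp add: bump_deriv_def)
    then show ?thesis
      by (rule has_field_derivative_transform_within_open[of _ _ _ "{..<0}"]) (use 2 in \<open>auto simp: bump_deriv_def\<close>)
  next
    case 3
    have "((\<lambda>h. bump_deriv n h / h) \<longlongrightarrow> 0) (at_right 0)"
    proof -
      \<comment> \<open>\<open>pCons 0\<close> multiplies the polynomial by its argument 1/h, which
        accounts for the division by h in the difference quotient.\<close>
      have "((\<lambda>h. poly (pCons 0 (bump_poly n)) (inverse h) * exp (- (inverse h))) \<longlongrightarrow> 0) (at_right 0)"
        by (rule filterlim_compose[OF poly_times_exp_tendsto_0 filterlim_inverse_at_top_right])
      then show ?thesis
        by (rule Lim_transform_eventually)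
          (auto simp: bump_deriv_def eventually_at_filter field_simps)
    qed
    moreover have "((\<lambda>h. bump_deriv n h / h) \<longlongrightarrow> 0) (at_left 0)"
      by (rule Lim_transform_eventually[of "\<lambda>_. 0"]) (auto simp: bump_deriv_def eventually_at_filter)
    ultimately have "((\<lambda>h. bump_deriv n h / h) \<longlongrightarrow> 0) (at 0)"
      by (simp add: filterlim_split_at)
    then show ?thesis
      by (simp add: 3 DERIV_def bump_deriv_def)
  qed
qed

text \<open>If the coordinates of \<open>a\<close> and \<open>b\<close> are in order, each quadratic
  is positive exactly on the open interval between them, so the product is positive exactly on the
  open box.\<close>

definition box_bump :: "'a::euclidean_space \<Rightarrow> 'a \<Rightarrow> 'a \<Rightarrow> real" where
  "box_bump a b x = (\<Prod>i\<in>Basis. bump_deriv 0 ((x \<bullet> i - a \<bullet> i) * (b \<bullet> i - x \<bullet> i)))"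

lemma Ck_box_bump: "Ck k (box_bump a b)"
  unfolding box_bump_def
  by (intro Ck_prod Ck_compose[where D=bump_deriv and n=0] bump_deriv_has_derivative
      Ck_mult Ck_diff Ck_inner Ck_const)

lemma bump_deriv_0_bounds: "0 \<le> bump_deriv 0 t" "bump_deriv 0 t \<le> 1"
  "0 < bump_deriv 0 t \<longleftrightarrow> 0 < t" "bump_deriv 0 t = 0 \<longleftrightarrow> t \<le> 0"
  by (auto simp: bump_deriv_def)

lemma box_bump_bounds: "0 \<le> box_bump a b x" "box_bump a b x \<le> 1"
  unfolding box_bump_def by (auto intro!: prod_nonneg prod_le_1 simp: bump_deriv_0_bounds)

lemma box_bump_pos: "x \<in> box a b \<Longrightarrow> 0 < box_bump a b x"
  unfolding box_bump_def by (auto intro!: prod_pos simp: bump_deriv_0_bounds mem_box)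

text \<open>Nonemptiness matters: with some coordinate of \<open>b\<close> below that of
  \<open>a\<close>, the quadratic would be positive between the two and its factor would not vanish
  there.\<close>

lemma box_bump_eq_0:
  assumes "x \<notin> box a b" "box a b \<noteq> {}"
  shows "box_bump a b x = 0"
proof -
  obtain i where i: "i \<in> Basis" "\<not> (a \<bullet> i < x \<bullet> i \<and> x \<bullet> i < b \<bullet> i)"
    using assms by (auto simp: mem_box)
  have "a \<bullet> i < b \<bullet> i" using assms(2) i(1) by (auto simp: box_ne_empty)
  then have "(x \<bullet> i - a \<bullet> i) * (b \<bullet> i - x \<bullet> i) \<le> 0"
    using i(2) by (auto simp: mult_le_0_iff)
  then show ?thesis
    unfolding box_bump_def using i(1) by (auto simp: bump_deriv_0_bounds intro!: prod_zero bexI[of _ i])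
qed

lemma test_function_supported:
  assumes "\<And>k. Ck k \<phi>" "compact K" "K \<subseteq> \<Omega>" "\<And>x. x \<notin> K \<Longrightarrow> \<phi> x = 0"
  shows "test_function \<Omega> \<phi>"
proof -
  have "closure {x. \<phi> x \<noteq> 0} \<subseteq> K"
    using assms by (intro closure_minimal compact_imp_closed) auto
  moreover from this have "closure {x. \<phi> x \<noteq> 0} = K \<inter> closure {x. \<phi> x \<noteq> 0}"
    by blast
  ultimately show ?thesis
    unfolding test_function_def using assms(1-3)
    by (metis closed_closure compact_Int_closed subset_trans)
qed

lemma test_function_box_bump:
  assumes "cbox a b \<subseteq> \<Omega>" "box a b \<noteq> {}"
  shows "test_function \<Omega> (box_bump a b)"
  by (rule test_function_supported[of _ "cbox a b"])
    (use assms box_subset_cbox[of a b] in \<open>auto intro!: Ck_box_bump box_bump_eq_0\<close>)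

section \<open>Gradients as vectors\<close>

definition grad :: "('a::euclidean_space \<Rightarrow> real) \<Rightarrow> 'a \<Rightarrow> 'a" where
  "grad \<phi> x = (\<Sum>b\<in>Basis. frechet_derivative \<phi> (at x) b *\<^sub>R b)"

lemma grad_inner: "b \<in> Basis \<Longrightarrow> grad \<phi> x \<bullet> b = frechet_derivative \<phi> (at x) b"
  by (simp add: grad_def inner_sum_left inner_Basis if_distrib cong: if_cong)

lemma has_derivative_grad:
  assumes "\<phi> differentiable (at x)"
  shows "(\<phi> has_derivative (\<lambda>y. grad \<phi> x \<bullet> y)) (at x)"
proof -
  define L where "L = frechet_derivative \<phi> (at x)"
  have lin: "linear L"
    unfolding L_def using assms by (rule linear_frechet_derivative)
  have "L y = grad \<phi> x \<bullet> y" for y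
  proof -
    have "L y = L (\<Sum>b\<in>Basis. (y \<bullet> b) *\<^sub>R b)"
      by (simp add: euclidean_representation)
    also have "\<dots> = (\<Sum>b\<in>Basis. (y \<bullet> b) * L b)"
      by (simp add: linear_sum[OF lin] linear_scale[OF lin])
    also have "\<dots> = grad \<phi> x \<bullet> y"
      by (simp add: grad_def L_def inner_sum_left inner_commute[of y] mult.commute)
    finally show ?thesis .
  qed
  then have "frechet_derivative \<phi> (at x) = (\<lambda>y. grad \<phi> x \<bullet> y)"
    by (auto simp: L_def)
  then show ?thesis using assms frechet_derivative_works[of \<phi> "at x"] by simp
qed

lemma grad_eqI:
  assumes "(\<phi> has_derivative (\<lambda>y. g \<bullet> y)) (at x)"
  shows "grad \<phi> x = g"
  by (rule euclidean_eqI) (simp add: grad_inner frechet_derivative_eqI(1)[OF assms])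

lemma continuous_grad: "Ck 1 \<phi> \<Longrightarrow> continuous_on UNIV (grad \<phi>)"
  unfolding grad_def by (intro continuous_intros) simp

section \<open>Integration by parts and the fundamental lemma\<close>

lemma integral_lborel_translation:
  fixes f :: "'a::euclidean_space \<Rightarrow> real"
  assumes [measurable]: "f \<in> borel_measurable borel"
  shows "(LINT x|lborel. f (x + c)) = (LINT x|lborel. f x)"
proof -
  have "(LINT x|lborel. f x) = (LINT x|distr lborel borel ((+) c). f x)"
    by (simp add: lborel_distr_plus)
  also have "\<dots> = (LINT x|lborel. f (c + x))"
    by (subst integral_distr) auto
  finally show ?thesis by (simp add: add.commute)
qed

lemma integrable_lborel_compact_support:
  fixes f :: "'a::euclidean_space \<Rightarrow> real"
  assumes "continuous_on UNIV f" "compact K" "\<And>x. x \<notin> K \<Longrightarrow> f x = 0"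
  shows "integrable lborel f"
proof -
  have "integrable lborel (\<lambda>x. indicator K x *\<^sub>R f x)"
    using assms(1,2) by (intro borel_integrable_compact) (auto intro: continuous_on_subset)
  moreover have "(\<lambda>x. indicator K x *\<^sub>R f x) = f"
    using assms(3) by (force simp: indicator_def)
  ultimately show ?thesis by simp
qed

text \<open>By translation invariance every difference quotient of \<open>h\<close> in direction
  \<open>b\<close> has integral 0. The quotients converge to the partial derivative with an
  integrable bound, so its integral is 0 as well.\<close>

lemma integral_partial_derivative_eq_0:
  fixes h :: "'a::euclidean_space \<Rightarrow> real"
  assumes der: "\<And>x. (h has_derivative (\<lambda>y. G x \<bullet> y)) (at x)"
    and cont: "continuous_on UNIV G"
    and K: "bounded K" "\<And>x. x \<notin> K \<Longrightarrow> h x = 0"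
  shows "(LINT x|lborel. G x \<bullet> b) = 0"
proof -
  have contchi: "continuous_on UNIV h"
    using der by (meson continuous_at_imp_continuous_on has_derivative_continuous)
  have [measurable]: "h \<in> borel_measurable borel" "G \<in> borel_measurable borel"
    using contchi cont by (auto intro: borel_measurable_continuous_onI)
  obtain R where R: "\<And>x. x \<in> K \<Longrightarrow> norm x \<le> R"
    using K(1) unfolding bounded_iff by auto
  have R0: "h x = 0" if "norm x > R" for x
    using R[of x] K(2)[of x] that by fastforce
  have "compact ((\<lambda>x. G x \<bullet> b) ` cball 0 (R + 2 * norm b))"
    by (intro compact_continuous_image continuous_intros continuous_on_subset[OF cont]) auto
  then obtain B where "\<forall>x\<in>cball 0 (R + 2 * norm b). \<bar>G x \<bullet> b\<bar> \<le> B"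
    by (auto dest!: compact_imp_bounded simp: bounded_iff)
  then have B: "\<bar>G x \<bullet> b\<bar> \<le> B" if "norm x \<le> R + 2 * norm b" for x
    using that by simp
  have hder: "((\<lambda>t. h (x + t *\<^sub>R b)) has_real_derivative G (x + t *\<^sub>R b) \<bullet> b) (at t)" for x t
  proof -
    have "((\<lambda>t. h (x + t *\<^sub>R b)) has_derivative (\<lambda>s. G (x + t *\<^sub>R b) \<bullet> (s *\<^sub>R b))) (at t)"
      by (rule has_derivative_compose[OF _ der]) (auto intro!: derivative_eq_intros)
    then show ?thesis
      by (simp add: has_field_derivative_def mult_commute_abs)
  qed
  define d where "d n x = real (Suc n) * (h (x + inverse (real (Suc n)) *\<^sub>R b) - h x)" for n x
  have dlim: "(\<lambda>n. d n x) \<longlonglongrightarrow> G x \<bullet> b" for x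
  proof -
    have "((\<lambda>t. (h (x + t *\<^sub>R b) - h x) / t) \<longlongrightarrow> G x \<bullet> b) (at 0)"
      using hder[of x 0] by (simp add: DERIV_def)
    then have "((\<lambda>t. (h (x + t *\<^sub>R b) - h x) / t) \<circ> (\<lambda>n. inverse (real (Suc n)))) \<longlonglongrightarrow> G x \<bullet> b"
      using LIMSEQ_inverse_real_of_nat unfolding tendsto_at_iff_sequentially by fastforce
    then show ?thesis by (simp add: d_def o_def divide_inverse mult.commute)
  qed
  \<comment> \<open>The step length is at most 1. Beyond radius \<open>R + norm b\<close> both
    values of \<open>h\<close> vanish; within it, the mean value theorem yields a value of
    \<open>G\<close> at a point of norm at most \<open>R + 2 * norm b\<close>, where
    \<open>B\<close> applies.\<close>
  have dbound: "\<bar>d n x\<bar> \<le> B * indicator (cball 0 (R + norm b)) x" for n x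
  proof (cases "norm x \<le> R + norm b")
    case True
    obtain z where z: "0 < z" "z < inverse (real (Suc n))"
      "h (x + inverse (real (Suc n)) *\<^sub>R b) - h (x + 0 *\<^sub>R b)
        = (inverse (real (Suc n)) - 0) * (G (x + z *\<^sub>R b) \<bullet> b)"
      using MVT2[of 0 "inverse (real (Suc n))" "\<lambda>t. h (x + t *\<^sub>R b)", OF _ hder] by auto
    then have "d n x = G (x + z *\<^sub>R b) \<bullet> b"
      by (simp add: d_def)
    moreover have "inverse (real (Suc n)) \<le> 1" by (simp add: inverse_eq_divide)
    then have "z \<le> 1" using z(2) by linarith
    then have "norm (z *\<^sub>R b) \<le> norm b"
      using z(1) by (simp add: mult_left_le_one_le)
    then have "norm (x + z *\<^sub>R b) \<le> R + 2 * norm b"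
      using True norm_triangle_ineq[of x "z *\<^sub>R b"] by linarith
    ultimately show ?thesis using B True by simp
  next
    case False
    have "inverse (real (Suc n)) \<le> 1" by (simp add: inverse_eq_divide)
    then have "norm (inverse (real (Suc n)) *\<^sub>R b) \<le> norm b"
      using mult_left_le_one_le[of "norm b" "inverse (real (Suc n))"] by simp
    then have "norm (x + inverse (real (Suc n)) *\<^sub>R b) > R"
      using False norm_diff_ineq[of x "inverse (real (Suc n)) *\<^sub>R b"] by linarith
    moreover have "norm x > R" using False by (smt (verit) norm_ge_zero)
    ultimately show ?thesis using R0 False by (simp add: d_def)
  qed
  have int: "integrable lborel (\<lambda>x. B * indicator (cball 0 (R + norm b)) x :: real)"
    by (intro integrable_mult_right integrable_real_indicator) (use emeasure_bounded_finite[of "cball 0 (R + norm b)"] in \<open>simp_all add: top.not_eq_extremum[symmetric] infinity_ennreal_def\<close>)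
  have "(\<lambda>n. LINT x|lborel. d n x) \<longlonglongrightarrow> (LINT x|lborel. G x \<bullet> b)"
    using int
    by (rule integral_dominated_convergence[rotated 2]) (use dlim dbound in \<open>auto simp: d_def\<close>)
  moreover have "(LINT x|lborel. d n x) = 0" for n
  proof -
    have "integrable lborel h"
      using R0 by (intro integrable_lborel_compact_support[OF contchi, of "cball 0 R"]) auto
    moreover have "integrable lborel (\<lambda>x. h (x + inverse (real (Suc n)) *\<^sub>R b))"
      using calculation integrable_distr_eq[of "(+) (inverse (real (Suc n)) *\<^sub>R b)" lborel borel h]
      by (simp add: lborel_distr_plus add.commute)
    ultimately show ?thesis
      unfolding d_def by (simp add: integral_lborel_translation)
  qed
  ultimately show ?thesis by (simp add: LIMSEQ_const_iff)
qed

text \<open>The complement of the closed support is open and \<phi> vanishes on it, so the gradient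
  vanishes there too.\<close>

lemma test_function_support:
  assumes "test_function \<Omega> \<phi>"
  obtains K where "compact K" "K \<subseteq> \<Omega>"
    "\<And>x. x \<notin> K \<Longrightarrow> \<phi> x = 0" "\<And>x. x \<notin> K \<Longrightarrow> grad \<phi> x = 0"
proof -
  obtain K where K: "K = closure {x. \<phi> x \<noteq> 0}" by simp
  have out: "\<phi> x = 0" if "x \<notin> K" for x
    using that closure_subset[of "{x. \<phi> x \<noteq> 0}"] unfolding K by auto
  have cl: "compact K" "K \<subseteq> \<Omega>" using assms by (auto simp: test_function_def K)
  have "grad \<phi> x = 0" if "x \<notin> K" for x
  proof (rule grad_eqI)
    have "((\<lambda>_. 0) has_derivative (\<lambda>_. 0)) (at x)" by simp
    then have "(\<phi> has_derivative (\<lambda>_. 0)) (at x)"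
      by (rule has_derivative_transform_within_open[of _ _ _ _ "- K"])
        (use cl compact_imp_closed that out in auto)
    then show "(\<phi> has_derivative (\<lambda>y. 0 \<bullet> y)) (at x)" by simp
  qed
  then show thesis using that cl out by blast
qed

lemma test_functionD:
  assumes "test_function \<Omega> \<phi>"
  shows "Ck k \<phi>" "\<phi> differentiable (at x)" "continuous_on UNIV \<phi>" "continuous_on UNIV (grad \<phi>)"
    "(\<phi> has_derivative (\<lambda>y. grad \<phi> x \<bullet> y)) (at x)"
proof -
  show *: "Ck k \<phi>" for k using assms by (simp add: test_function_def)
  from *[of "Suc 0"] show "\<phi> differentiable (at x)" by simp
  then show "(\<phi> has_derivative (\<lambda>y. grad \<phi> x \<bullet> y)) (at x)" by (rule has_derivative_grad)
  show "continuous_on UNIV \<phi>" using * by (rule Ck_continuous)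
  show "continuous_on UNIV (grad \<phi>)" using *[of 1] by (rule continuous_grad)
qed

lemma integral_lebesgue_on_eq_lborel:
  fixes f :: "'a::euclidean_space \<Rightarrow> real"
  assumes "open \<Omega>" "f \<in> borel_measurable borel" "\<And>x. x \<notin> \<Omega> \<Longrightarrow> f x = 0"
  shows "(LINT x|lebesgue_on \<Omega>. f x) = (LINT x|lborel. f x)"
proof -
  have "(LINT x|lebesgue_on \<Omega>. f x) = (LINT x|lebesgue. indicator \<Omega> x *\<^sub>R f x)"
    using assms by (subst integral_restrict_space) auto
  also have "\<dots> = (LINT x|lebesgue. f x)"
    by (rule Bochner_Integration.integral_cong) (use assms in \<open>auto simp: indicator_def\<close>)
  also have "\<dots> = (LINT x|lborel. f x)"
    by (rule integral_completion) (use assms in auto)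
  finally show ?thesis .
qed

text \<open>The product of \<phi> and \<psi> has compact support, so its partial derivative
  integrates to 0, and the product rule splits that integral. This identity later passes to limits
  of test functions.\<close>

lemma test_function_integral_by_parts:
  fixes \<phi> \<psi> :: "'a::euclidean_space \<Rightarrow> real"
  assumes "open \<Omega>" "test_function \<Omega> \<phi>" "test_function \<Omega> \<psi>" "b \<in> Basis"
  shows "(LINT x|lebesgue_on \<Omega>. \<phi> x * frechet_derivative \<psi> (at x) b)
    = - (LINT x|lebesgue_on \<Omega>. (grad \<phi> x \<bullet> b) * \<psi> x)"
proof -
  obtain K where K: "compact K" "K \<subseteq> \<Omega>"
    and out: "\<And>x. x \<notin> K \<Longrightarrow> \<psi> x = 0" "\<And>x. x \<notin> K \<Longrightarrow> grad \<psi> x = 0"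
    using test_function_support[OF assms(3)] by metis
  have c: "continuous_on UNIV \<phi>" "continuous_on UNIV \<psi>" "continuous_on UNIV (grad \<phi>)" "continuous_on UNIV (grad \<psi>)"
    using test_functionD[OF assms(2)] test_functionD[OF assms(3)] by simp_all
  have "(LINT x|lborel. (\<phi> x *\<^sub>R grad \<psi> x + \<psi> x *\<^sub>R grad \<phi> x) \<bullet> b) = 0"
  proof (rule integral_partial_derivative_eq_0[where h="\<lambda>x. \<phi> x * \<psi> x" and K="K"])
    show "((\<lambda>x. \<phi> x * \<psi> x) has_derivative (\<lambda>y. (\<phi> x *\<^sub>R grad \<psi> x + \<psi> x *\<^sub>R grad \<phi> x) \<bullet> y)) (at x)" for x
      by (rule has_derivative_eq_rhs[OF has_derivative_mult[OF test_functionD(5)[OF assms(2)] test_functionD(5)[OF assms(3)]]])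
        (auto simp: inner_add_left)
    show "continuous_on UNIV (\<lambda>x. \<phi> x *\<^sub>R grad \<psi> x + \<psi> x *\<^sub>R grad \<phi> x)"
      by (intro continuous_intros c)
    show "bounded K" using K compact_imp_bounded by blast
    show "\<phi> x * \<psi> x = 0" if "x \<notin> K" for x using out that by simp
  qed
  moreover have "integrable lborel (\<lambda>x. \<phi> x * (grad \<psi> x \<bullet> b))" "integrable lborel (\<lambda>x. (grad \<phi> x \<bullet> b) * \<psi> x)"
    using out
    by (auto intro!: integrable_lborel_compact_support[OF _ K(1)] continuous_intros c)
  ultimately have "(LINT x|lborel. \<phi> x * (grad \<psi> x \<bullet> b)) + (LINT x|lborel. (grad \<phi> x \<bullet> b) * \<psi> x) = 0"
    by (subst Bochner_Integration.integral_add[symmetric]) (auto simp: inner_add_left mult.commute)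
  moreover have "(LINT x|lebesgue_on \<Omega>. \<phi> x * (grad \<psi> x \<bullet> b)) = (LINT x|lborel. \<phi> x * (grad \<psi> x \<bullet> b))"
     "(LINT x|lebesgue_on \<Omega>. (grad \<phi> x \<bullet> b) * \<psi> x) = (LINT x|lborel. (grad \<phi> x \<bullet> b) * \<psi> x)"
    using out K(2)[THEN subsetD]
    by (intro integral_lebesgue_on_eq_lborel assms(1) borel_measurable_continuous_onI
        continuous_intros c; metis inner_zero_left mult_zero_left mult_zero_right)+
  ultimately show ?thesis using assms(4) by (simp add: grad_inner)
qed

text \<open>Countably many closed boxes exhaust the open set. Their boundaries are null and
  degenerate boxes are null altogether, so nonempty open boxes suffice.\<close>

lemma AE_lebesgue_on_boxI:
  fixes \<Omega> :: "'a::euclidean_space set"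
  assumes \<Omega>: "open \<Omega>"
    and P: "\<And>a b. cbox a b \<subseteq> \<Omega> \<Longrightarrow> box a b \<noteq> {} \<Longrightarrow> AE x in lebesgue_on \<Omega>. x \<in> box a b \<longrightarrow> P x"
  shows "AE x in lebesgue_on \<Omega>. P x"
proof -
  obtain \<D> :: "'a set set" where \<D>: "countable \<D>" "\<D> \<subseteq> Pow \<Omega>" "\<And>X. X \<in> \<D> \<Longrightarrow> \<exists>a b. X = cbox a b" "\<Union>\<D> = \<Omega>"
    using open_countable_Union_open_cbox[OF \<Omega>] by metis
  have "AE x in lebesgue_on \<Omega>. x \<in> X \<longrightarrow> P x" if X: "X \<in> \<D>" for X
  proof -
    obtain a b where ab: "X = cbox a b" "cbox a b \<subseteq> \<Omega>" using \<D> X by blast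
    have "cbox a b - box a b \<in> null_sets lebesgue"
      using negligible_frontier_interval negligible_iff_null_sets by blast
    then have "AE x in lebesgue. x \<notin> cbox a b - box a b" by (rule AE_not_in)
    then have *: "AE x in lebesgue_on \<Omega>. x \<notin> cbox a b - box a b"
      using \<Omega> by (subst AE_restrict_space_iff) auto
    show ?thesis
    proof (cases "box a b = {}")
      case True
      show ?thesis using * by eventually_elim (simp add: True ab)
    next
      case False
      show ?thesis using * P[OF ab(2) False] by eventually_elim (auto simp: ab)
    qed
  qed
  then have "AE x in lebesgue_on \<Omega>. \<forall>X\<in>\<D>. x \<in> X \<longrightarrow> P x"
    by (subst AE_ball_countable[OF \<D>(1)]) blast
  moreover have "AE x in lebesgue_on \<Omega>. x \<in> \<Omega>"
    using AE_space[of "lebesgue_on \<Omega>"] by simp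
  ultimately show ?thesis by eventually_elim (use \<D>(4) in blast)
qed

lemma borel_measurable_lebesgue_continuous:
  "continuous_on UNIV f \<Longrightarrow> f \<in> borel_measurable lebesgue"
  by (intro measurable_completion) (simp add: borel_measurable_continuous_onI)

text \<open>The indicator of the open box is a pointwise limit of test functions with values in
  [0, 1], and |h| on the closed box dominates the products.\<close>

lemma integral_box_eq_0:
  fixes h :: "'a::euclidean_space \<Rightarrow> real"
  assumes \<Omega>: "open \<Omega>" and cd: "cbox c d \<subseteq> \<Omega>"
    and h: "h absolutely_integrable_on (cbox c d)"
    and test: "\<And>\<phi>. test_function \<Omega> \<phi> \<Longrightarrow> (LINT x|lebesgue_on \<Omega>. h x * \<phi> x) = 0"
  shows "integral (cbox c d) h = 0"
proof (cases "box c d = {}")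
  case True
  then have "measure lborel (cbox c d) = 0" by (simp add: content_eq_0_interior)
  then show ?thesis by (rule integral_null)
next
  case False
  \<comment> \<open>On the open box the bump lies in (0, 1], so the power tends to 0 and the value
    to 1; off it the bump is 0 and so is every \<phi> \<open>n\<close>. Being polynomial in the
    bump, \<phi> \<open>n\<close> is smooth.\<close>
  define \<phi> where "\<phi> n x = 1 - (1 - box_bump c d x) ^ n" for n x
  have outside: "box_bump c d x = 0" if "x \<notin> cbox c d" for x
    using that box_subset_cbox box_bump_eq_0[OF _ False] by blast
  have test\<phi>: "test_function \<Omega> (\<phi> n)" for n
  proof (rule test_function_supported)
    show "Ck k (\<phi> n)" for k
      unfolding \<phi>_def[abs_def] by (intro Ck_diff Ck_const Ck_power Ck_box_bump)
    show "\<phi> n x = 0" if "x \<notin> cbox c d" for x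
      using outside[OF that] by (simp add: \<phi>_def)
  qed (use cd in auto)
  have lim: "(\<lambda>n. \<phi> n x) \<longlonglongrightarrow> indicator (box c d) x" for x
  proof (cases "x \<in> box c d")
    case True
    have "(\<lambda>n. 1 - (1 - box_bump c d x) ^ n) \<longlonglongrightarrow> 1 - 0"
      using box_bump_pos[OF True] box_bump_bounds(2)[of c d x]
      by (intro tendsto_diff tendsto_const LIMSEQ_realpow_zero) auto
    then show ?thesis using True by (simp add: \<phi>_def)
  qed (use box_bump_eq_0[OF _ False] in \<open>simp add: \<phi>_def\<close>)
  have bound: "0 \<le> \<phi> n x" "\<phi> n x \<le> indicator (cbox c d) x" for n x
  proof -
    show "0 \<le> \<phi> n x" 
      using box_bump_bounds[of c d x] by (simp add: \<phi>_def power_le_one)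
    show "\<phi> n x \<le> indicator (cbox c d) x"
      using outside[of x] box_bump_bounds[of c d x]
      by (cases "x \<in> cbox c d") (auto simp: \<phi>_def)
  qed
  define H where "H x = indicator (cbox c d) x * h x" for x
  have H: "integrable lebesgue H"
    using h by (simp add: set_integrable_def H_def[abs_def])
  then have [measurable]: "H \<in> borel_measurable lebesgue" by (rule borel_measurable_integrable)
  have [measurable]: "\<phi> n \<in> borel_measurable lebesgue" for n
    using test_functionD(3)[OF test\<phi>] by (rule borel_measurable_lebesgue_continuous)
  have "(\<lambda>n. LINT x|lebesgue. H x * \<phi> n x) \<longlonglongrightarrow> (LINT x|lebesgue. H x * indicator (box c d) x)"
  proof (rule integral_dominated_convergence[where w="\<lambda>x. \<bar>H x\<bar>"])
    show "(\<lambda>x. H x * indicator (box c d) x) \<in> borel_measurable lebesgue"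
      by (intro borel_measurable_times borel_measurable_indicator) auto
    show "AE x in lebesgue. norm (H x * \<phi> n x) \<le> \<bar>H x\<bar>" for n
    proof (intro AE_I2)
      fix x show "norm (H x * \<phi> n x) \<le> \<bar>H x\<bar>"
        using bound[of n x] by (cases "x \<in> cbox c d") (simp_all add: H_def abs_mult mult_left_le)
    qed
  qed (use H lim in \<open>auto intro!: tendsto_mult_left\<close>)
  moreover have "(LINT x|lebesgue. H x * \<phi> n x) = 0" for n
  proof -
    have "(LINT x|lebesgue_on \<Omega>. h x * \<phi> n x) = (LINT x|lebesgue. indicator \<Omega> x *\<^sub>R (h x * \<phi> n x))"
      using \<Omega> by (subst integral_restrict_space) auto
    also have "\<dots> = (LINT x|lebesgue. H x * \<phi> n x)"
    proof (rule Bochner_Integration.integral_cong)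
      fix x show "indicator \<Omega> x *\<^sub>R (h x * \<phi> n x) = H x * \<phi> n x"
        using bound[of n x] cd by (cases "x \<in> cbox c d") (auto simp: H_def)
    qed simp
    finally show ?thesis using test[OF test\<phi>] by simp
  qed
  ultimately have "(LINT x|lebesgue. H x * indicator (box c d) x) = 0"
    by (simp add: LIMSEQ_const_iff)
  also have "(\<lambda>x. H x * indicator (box c d) x) = (\<lambda>x. indicator (box c d) x *\<^sub>R h x)"
    using box_subset_cbox[of c d] by (fastforce simp: H_def indicator_def)
  finally have "(LINT x:box c d|lebesgue. h x) = 0"
    by (simp add: set_lebesgue_integral_def)
  moreover have "h absolutely_integrable_on (box c d)"
    by (rule set_integrable_subset[OF h]) (auto simp: box_subset_cbox)
  ultimately have "integral (box c d) h = 0"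
    by (simp add: set_lebesgue_integral_eq_integral)
  then show ?thesis by (simp add: integral_open_interval)
qed

text \<open>The integral of \<open>h\<close> over every closed box inside the domain vanishes. By
  Lebesgue differentiation along cubes with corner x, almost every value of \<open>h\<close> is a
  limit of such averages.\<close>

proposition fundamental_lemma:
  fixes h :: "'a::euclidean_space \<Rightarrow> real"
  assumes \<Omega>: "open \<Omega>"
    and h: "\<And>K. compact K \<Longrightarrow> K \<subseteq> \<Omega> \<Longrightarrow> h absolutely_integrable_on K"
    and test: "\<And>\<phi>. test_function \<Omega> \<phi> \<Longrightarrow> (LINT x|lebesgue_on \<Omega>. h x * \<phi> x) = 0"
  shows "AE x in lebesgue_on \<Omega>. h x = 0"
proof (rule AE_lebesgue_on_boxI[OF \<Omega>])
  fix a b assume ab: "cbox a b \<subseteq> \<Omega>" "box a b \<noteq> {}"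
  \<comment> \<open>Extension by 0 gives a function integrable on every box, as the differentiation
    theorem requires.\<close>
  define H where "H x = (if x \<in> cbox a b then h x else 0)" for x
  have "H absolutely_integrable_on UNIV"
    using h[OF compact_cbox ab(1)] unfolding H_def[abs_def] by (simp only: absolutely_integrable_restrict_UNIV)
  then have "H integrable_on cbox c d" for c d
    using integrable_on_subcbox[OF set_lebesgue_integral_eq_integral(1) subset_UNIV] by blast
  then obtain N where N: "negligible N"
    "\<And>x e. x \<notin> N \<Longrightarrow> 0 < e \<Longrightarrow> \<exists>d>0. \<forall>t. 0 < t \<and> t < d \<longrightarrow>
       norm (integral (cbox x (x + t *\<^sub>R One)) H /\<^sub>R t ^ DIM('a) - H x) < e"
    using integrable_ccontinuous_explicit[of H] by metis
  have zero: "h x = 0" if x: "x \<in> box a b" "x \<notin> N" for x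
  proof (rule ccontr)
    assume "h x \<noteq> 0"
    then obtain d where d: "d > 0" "\<And>t. 0 < t \<Longrightarrow> t < d \<Longrightarrow>
       norm (integral (cbox x (x + t *\<^sub>R One)) H /\<^sub>R t ^ DIM('a) - H x) < \<bar>h x\<bar>"
      using N(2)[OF x(2), of "\<bar>h x\<bar>"] by auto
    obtain r where r: "r > 0" "ball x r \<subseteq> box a b"
      using x(1) open_box open_contains_ball by blast
    \<comment> \<open>The cube with corner x and side t must stay in the ball of radius r. The
      distance from x is at most the sum of the coordinate differences, hence at most t times the
      dimension; the halves make the inequalities strict.\<close>
    define t where "t = min (d / 2) (r / (2 * DIM('a)))"
    have t: "0 < t" "t < d" "t * DIM('a) < r"
      using d(1) r(1) by (auto simp: t_def min_def field_simps)
    have sub: "cbox x (x + t *\<^sub>R One) \<subseteq> cbox a b"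
    proof
      fix y assume y: "y \<in> cbox x (x + t *\<^sub>R One)"
      have "norm (y - x) \<le> (\<Sum>i\<in>Basis. \<bar>(y - x) \<bullet> i\<bar>)"
        by (rule norm_le_l1)
      also have "\<dots> \<le> (\<Sum>i\<in>(Basis::'a set). t)"
      proof (rule sum_mono)
        fix i :: 'a assume "i \<in> Basis"
        then show "\<bar>(y - x) \<bullet> i\<bar> \<le> t"
          using y t(1) by (fastforce simp: mem_box inner_diff_left inner_add_left)
      qed
      also have "\<dots> < r" using t(3) by (simp add: mult.commute)
      finally have "y \<in> ball x r" by (simp add: dist_norm norm_minus_commute)
      then show "y \<in> cbox a b" using r(2) box_subset_cbox by blast
    qed
    have "integral (cbox x (x + t *\<^sub>R One)) H = integral (cbox x (x + t *\<^sub>R One)) h"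
      by (rule Henstock_Kurzweil_Integration.integral_cong) (use sub in \<open>auto simp: H_def\<close>)
    also have "\<dots> = 0"
      using sub ab(1) by (intro integral_box_eq_0[OF \<Omega> _ h test]) auto
    finally have "norm (H x) < \<bar>h x\<bar>" using d(2)[OF t(1,2)] by simp
    then show False using x(1) box_subset_cbox[of a b] by (auto simp: H_def split: if_splits)
  qed
  have "AE x in lebesgue. x \<notin> N"
    using N(1) negligible_iff_null_sets AE_not_in by blast
  then have "AE x in lebesgue_on \<Omega>. x \<notin> N"
    using \<Omega> by (subst AE_restrict_space_iff) auto
  then show "AE x in lebesgue_on \<Omega>. x \<in> box a b \<longrightarrow> h x = 0"
    by eventually_elim (use zero in auto)
qed

text \<open>Each coordinate of the difference integrates to 0 against every test function, so the
  fundamental lemma applies coordinate by coordinate. This is what makes the gradient chosen by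
  \<open>SOME\<close> usable.\<close>

lemma weak_gradient_unique:
  fixes u :: "'a::euclidean_space \<Rightarrow> real"
  assumes \<Omega>: "open \<Omega>" and g: "has_weak_gradient \<Omega> u g" and g': "has_weak_gradient \<Omega> u g'"
  shows "AE x in lebesgue_on \<Omega>. g x = g' x"
proof -
  have int: "g absolutely_integrable_on K" "g' absolutely_integrable_on K" if "compact K" "K \<subseteq> \<Omega>" for K
    using g g' that by (auto simp: has_weak_gradient_def)
  have "AE x in lebesgue_on \<Omega>. (g x - g' x) \<bullet> b = 0" if b: "b \<in> Basis" for b
  proof (rule fundamental_lemma[OF \<Omega>])
    have b': "(\<lambda>x. w x \<bullet> b) absolutely_integrable_on K" if "w absolutely_integrable_on K" for w :: "'a \<Rightarrow> 'a" and K
      using absolutely_integrable_linear[OF that bounded_linear_inner_left] by (simp add: o_def)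
    show "(\<lambda>x. (g x - g' x) \<bullet> b) absolutely_integrable_on K" if "compact K" "K \<subseteq> \<Omega>" for K
      using int[OF that] by (intro b' set_integral_diff)
    fix \<phi> assume \<phi>: "test_function \<Omega> \<phi>"
    obtain K where K: "compact K" "K \<subseteq> \<Omega>" "\<And>x. x \<notin> K \<Longrightarrow> \<phi> x = 0"
      using test_function_support[OF \<phi>] by metis
    have [measurable]: "\<phi> \<in> borel_measurable lebesgue"
      using test_functionD(3)[OF \<phi>] by (rule borel_measurable_lebesgue_continuous)
    have "bounded (\<phi> ` K)"
      using K(1) test_functionD(3)[OF \<phi>] by (meson compact_continuous_image compact_imp_bounded continuous_on_subset subset_UNIV)
    note bnd = this
    have mult: "(\<lambda>x. \<phi> x * w x) absolutely_integrable_on K" if "w absolutely_integrable_on K" for w :: "'a \<Rightarrow> real"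
      by (rule absolutely_integrable_bounded_measurable_product[OF bilinear_times _ _ _ that])
        (use K(1) bnd in \<open>auto intro: measurable_restrict_space1 lmeasurable_compact fmeasurableD\<close>)
    have int\<phi>: "integrable (lebesgue_on \<Omega>) (\<lambda>x. (w x \<bullet> b) * \<phi> x)" if "w absolutely_integrable_on K" for w :: "'a \<Rightarrow> 'a"
    proof -
      have "integrable lebesgue (\<lambda>x. indicator K x *\<^sub>R (\<phi> x * (w x \<bullet> b)))"
        using mult[OF b'[OF that]] by (simp add: set_integrable_def)
      also have "(\<lambda>x. indicator K x *\<^sub>R (\<phi> x * (w x \<bullet> b))) = (\<lambda>x. indicator \<Omega> x *\<^sub>R ((w x \<bullet> b) * \<phi> x))"
      proof
        fix x show "indicator K x *\<^sub>R (\<phi> x * (w x \<bullet> b)) = indicator \<Omega> x *\<^sub>R ((w x \<bullet> b) * \<phi> x)"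
          using K(2,3) by (cases "x \<in> K") auto
      qed
      finally show ?thesis using \<Omega> by (subst integrable_restrict_space) auto
    qed
    have e: "(LINT x|lebesgue_on \<Omega>. u x * frechet_derivative \<phi> (at x) b)
        = - (LINT x|lebesgue_on \<Omega>. (w x \<bullet> b) * \<phi> x)" if "has_weak_gradient \<Omega> u w" for w
      using that \<phi> b unfolding has_weak_gradient_def by blast
    have "(LINT x|lebesgue_on \<Omega>. (g x \<bullet> b) * \<phi> x) = (LINT x|lebesgue_on \<Omega>. (g' x \<bullet> b) * \<phi> x)"
      using e[OF g] e[OF g'] by linarith
    then show "(LINT x|lebesgue_on \<Omega>. ((g x - g' x) \<bullet> b) * \<phi> x) = 0"
      using int\<phi>[OF int(1)[OF K(1,2)]] int\<phi>[OF int(2)[OF K(1,2)]]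
      by (simp add: inner_diff_left left_diff_distrib)
  qed
  then have "AE x in lebesgue_on \<Omega>. \<forall>b\<in>Basis. (g x - g' x) \<bullet> b = 0"
    by (simp add: AE_finite_all)
  then show ?thesis
    by eventually_elim (auto intro: euclidean_eqI simp: inner_diff_left)
qed

section \<open>The spaces \<open>Lp\<close>\<close>

text \<open>This is the p-th power of the norm. It detects convergence to 0 just as well, and a
  triangle inequality with factor \<open>2 powr p\<close> takes the place of Minkowski's
  inequality.\<close>

abbreviation Lp_integral :: "real \<Rightarrow> 'a::euclidean_space set \<Rightarrow> ('a \<Rightarrow> 'b::euclidean_space) \<Rightarrow> real" where
  "Lp_integral p \<Omega> w \<equiv> (LINT x|lebesgue_on \<Omega>. norm (w x) powr p)"

lemma norm_add_powr_le:
  fixes a b :: "'b::real_normed_vector"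
  assumes "0 \<le> p"
  shows "norm (a + b) powr p \<le> 2 powr p * (norm a powr p + norm b powr p)"
proof -
  have "norm (a + b) \<le> 2 * max (norm a) (norm b)"
    using norm_triangle_ineq[of a b] by linarith
  then have "norm (a + b) powr p \<le> (2 * max (norm a) (norm b)) powr p"
    using assms by (intro powr_mono2) auto
  also have "\<dots> = 2 powr p * max (norm a) (norm b) powr p"
    by (simp add: powr_mult)
  also have "\<dots> \<le> 2 powr p * (norm a powr p + norm b powr p)"
    by (intro mult_left_mono) (auto simp: max_def)
  finally show ?thesis .
qed

text \<open>On the unit sphere the set where \<open>P\<close> is at least \<delta> is compact and
  \<open>Q\<close> is positive there. So \<open>Q\<close> has a positive minimum and
  \<open>P\<close> a maximum on it, and their quotient serves as C. Homogeneity carries the bound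
  from the sphere to all nonzero vectors.\<close>

lemma homogeneous_bound:
  fixes P Q :: "'e::euclidean_space \<Rightarrow> real"
  assumes cont: "continuous_on UNIV P" "continuous_on UNIV Q"
    and homP: "\<And>c z. c > 0 \<Longrightarrow> P (c *\<^sub>R z) = c powr p * P z"
    and homQ: "\<And>c z. c > 0 \<Longrightarrow> Q (c *\<^sub>R z) = c powr p * Q z"
    and Q: "\<And>z. 0 \<le> Q z" "\<And>z. Q z = 0 \<Longrightarrow> P z \<le> 0"
    and "0 < p" "0 < \<delta>"
  obtains C where "0 \<le> C" "\<And>z. P z \<le> \<delta> * norm z powr p + C * Q z"
proof -
  have "\<exists>C\<ge>0. \<forall>z. norm z = 1 \<longrightarrow> P z \<le> \<delta> + C * Q z"
  proof -
    define S where "S = {z. norm z = 1 \<and> \<delta> \<le> P z}"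
    have "S = sphere 0 1 \<inter> {z. \<delta> \<le> P z}" by (auto simp: S_def)
    moreover have "closed {z. \<delta> \<le> P z}"
      using cont(1) by (intro closed_Collect_le) auto
    ultimately have S: "compact S" by (simp add: compact_Int_closed)
    show ?thesis
    proof (cases "S = {}")
      case True
      then show ?thesis by (intro exI[of _ 0]) (force simp: S_def)
    next
      case False
      obtain z0 where z0: "z0 \<in> S" "\<And>z. z \<in> S \<Longrightarrow> Q z0 \<le> Q z"
        using continuous_attains_inf[OF S False] cont(2) by (meson continuous_on_subset subset_UNIV)
      obtain z1 where z1: "z1 \<in> S" "\<And>z. z \<in> S \<Longrightarrow> P z \<le> P z1"
        using continuous_attains_sup[OF S False] cont(1) by (meson continuous_on_subset subset_UNIV)
      have pos: "0 < Q z0"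
        using z0(1) Q(1)[of z0] Q(2)[of z0] \<open>0 < \<delta>\<close> by (fastforce simp: S_def)
      have P1: "0 \<le> P z1" using z1(1) \<open>0 < \<delta>\<close> by (auto simp: S_def)
      have "P z \<le> \<delta> + P z1 / Q z0 * Q z" if "norm z = 1" for z
      proof (cases "z \<in> S")
        case True
        have "P z \<le> P z1 / Q z0 * Q z0" using z1(2)[OF True] pos by simp
        also have "\<dots> \<le> P z1 / Q z0 * Q z"
          using z0(2)[OF True] P1 pos by (intro mult_left_mono) auto
        finally show ?thesis using \<open>0 < \<delta>\<close> by linarith
      next
        case False
        then have "P z \<le> \<delta>" using that by (auto simp: S_def)
        moreover have "0 \<le> P z1 / Q z0 * Q z" using P1 pos Q(1) by simp
        ultimately show ?thesis by linarith
      qed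
      then show ?thesis using P1 pos by (intro exI[of _ "P z1 / Q z0"]) auto
    qed
  qed
  then obtain C where C: "0 \<le> C" "\<And>z. norm z = 1 \<Longrightarrow> P z \<le> \<delta> + C * Q z" by blast
  have "P z \<le> \<delta> * norm z powr p + C * Q z" for z
  proof (cases "z = 0")
    case True
    \<comment> \<open>The origin is not reached by scaling the sphere. Homogeneity forces
      \<open>Q 0 = 0\<close>, and the hypothesis on the zeros of \<open>Q\<close> then gives
      \<open>P 0\<close> at most 0.\<close>
    have "Q 0 = 2 powr p * Q 0" using homQ[of 2 0] by simp
    moreover have "2 powr p > (1::real)" using \<open>0 < p\<close> by simp
    ultimately have "Q 0 = 0" using \<open>0 < p\<close> by auto
    then show ?thesis using Q(2)[of 0] True by simp
  next
    case False
    define y where "y = z /\<^sub>R norm z"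
    have y: "norm y = 1" "z = norm z *\<^sub>R y" using False by (auto simp: y_def)
    have "P z = norm z powr p * P y" "Q z = norm z powr p * Q y"
      using homP[of "norm z" y] homQ[of "norm z" y] False y(2) by auto
    then show ?thesis
      using mult_left_mono[OF C(2)[OF y(1)], of "norm z powr p"] by (simp add: algebra_simps)
  qed
  with C(1) show thesis using that by blast
qed

text \<open>The left side, as a function of the pair, is homogeneous and vanishes on the diagonal,
  which is the zero set of \<open>norm (a - b) powr p\<close>.\<close>

lemma norm_powr_diff_bound:
  assumes "0 < p" "0 < \<delta>"
  obtains C where "0 \<le> C" "\<And>a b :: 'b::euclidean_space.
    \<bar>norm a powr p - norm b powr p\<bar> \<le> \<delta> * norm b powr p + C * norm (a - b) powr p"
proof -
  \<comment> \<open>K bounds the power of the norm of the pair by the powers of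
    \<open>norm b\<close> and \<open>norm (a - b)\<close>. Running the homogeneous bound with
    \<delta>/K leaves \<delta> in front of both, and the second of these is absorbed into the
    constant.\<close>
  define K where "K = 2 powr p * (2 powr p + 1)"
  have K: "0 < K" by (auto intro!: mult_pos_pos add_pos_pos simp: K_def)
  obtain C where C: "0 \<le> C" "\<And>z :: 'b \<times> 'b. \<bar>norm (fst z) powr p - norm (snd z) powr p\<bar>
     \<le> (\<delta> / K) * norm z powr p + C * norm (fst z - snd z) powr p"
  proof (rule homogeneous_bound[of "\<lambda>z :: 'b \<times> 'b. \<bar>norm (fst z) powr p - norm (snd z) powr p\<bar>"
        "\<lambda>z :: 'b \<times> 'b. norm (fst z - snd z) powr p" p "\<delta> / K"])
    show "continuous_on UNIV (\<lambda>z :: 'b \<times> 'b. \<bar>norm (fst z) powr p - norm (snd z) powr p\<bar>)"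
      "continuous_on UNIV (\<lambda>z :: 'b \<times> 'b. norm (fst z - snd z) powr p)"
      using assms by (auto intro!: continuous_intros continuous_on_powr')
    show "norm (fst (c *\<^sub>R z) - snd (c *\<^sub>R z)) powr p = c powr p * norm (fst z - snd z) powr p"
      if "0 < c" for c :: real and z :: "'b \<times> 'b"
      using that by (simp add: powr_mult flip: scaleR_diff_right)
    show "\<bar>norm (fst (c *\<^sub>R z)) powr p - norm (snd (c *\<^sub>R z)) powr p\<bar>
        = c powr p * \<bar>norm (fst z) powr p - norm (snd z) powr p\<bar>"
      if "0 < c" for c :: real and z :: "'b \<times> 'b"
    proof -
      have "norm (fst (c *\<^sub>R z)) powr p - norm (snd (c *\<^sub>R z)) powr p
        = c powr p * (norm (fst z) powr p - norm (snd z) powr p)"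
        using that by (simp add: powr_mult right_diff_distrib)
      then show ?thesis by (simp add: abs_mult)
    qed
  qed (use assms K in auto)
  have "\<bar>norm a powr p - norm b powr p\<bar> \<le> \<delta> * norm b powr p + (\<delta> + C) * norm (a - b) powr p" for a b :: 'b
  proof -
    have "norm (a, b) powr p \<le> 2 powr p * (norm a powr p + norm b powr p)"
      using norm_add_powr_le[of p "(a, 0)" "(0, b)"] assms by simp
    also have "\<dots> \<le> 2 powr p * (2 powr p * (norm (a - b) powr p + norm b powr p) + norm b powr p)"
      using norm_add_powr_le[of p "a - b" b] assms by simp
    also have "\<dots> \<le> (2 powr p * (2 powr p + 1)) * (norm b powr p + norm (a - b) powr p)"
      by (simp add: algebra_simps)
    finally have K': "norm (a, b) powr p \<le> K * (norm b powr p + norm (a - b) powr p)"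
      unfolding K_def .
    have "(\<delta> / K) * norm (a, b) powr p
       \<le> (\<delta> / K) * (K * (norm b powr p + norm (a - b) powr p))"
      using assms K K' by (intro mult_left_mono) auto
    also have "\<dots> = \<delta> * (norm b powr p + norm (a - b) powr p)"
      using K by simp
    finally show ?thesis using C(2)[of "(a, b)"] by (simp add: algebra_simps)
  qed
  then show thesis using that[of "\<delta> + C"] C(1) assms by auto
qed

section \<open>Vector space structure, convergence and completeness of \<open>Lp\<close>\<close>

lemma Lp_measurable: "w \<in> Lp p \<Omega> \<Longrightarrow> w \<in> borel_measurable (lebesgue_on \<Omega>)"
  and Lp_integrable: "w \<in> Lp p \<Omega> \<Longrightarrow> integrable (lebesgue_on \<Omega>) (\<lambda>x. norm (w x) powr p)"
  by (auto simp: Lp_def)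

lemma Lp_dominated:
  fixes w :: "'a::euclidean_space \<Rightarrow> 'b::euclidean_space"
  assumes "w \<in> borel_measurable (lebesgue_on \<Omega>)" "integrable (lebesgue_on \<Omega>) h"
    "AE x in lebesgue_on \<Omega>. norm (w x) powr p \<le> h x"
  shows "w \<in> Lp p \<Omega>"
proof -
  have "integrable (lebesgue_on \<Omega>) (\<lambda>x. norm (w x) powr p)"
    by (rule Bochner_Integration.integrable_bound[OF assms(2)])
      (use assms(1,3) in auto)
  then show ?thesis using assms(1) by (simp add: Lp_def)
qed

lemma Lp_bound:
  fixes w :: "'a::euclidean_space \<Rightarrow> 'b::euclidean_space" and v :: "'a \<Rightarrow> 'c::euclidean_space"
  assumes "w \<in> borel_measurable (lebesgue_on \<Omega>)" "v \<in> Lp p \<Omega>" "0 \<le> p" "0 \<le> c"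
    and le: "\<And>x. norm (w x) \<le> c * norm (v x)"
  shows "w \<in> Lp p \<Omega>"
proof (rule Lp_dominated[OF assms(1)])
  show "integrable (lebesgue_on \<Omega>) (\<lambda>x. c powr p * norm (v x) powr p)"
    using Lp_integrable[OF assms(2)] by simp
  show "AE x in lebesgue_on \<Omega>. norm (w x) powr p \<le> c powr p * norm (v x) powr p"
  proof (rule AE_I2)
    fix x show "norm (w x) powr p \<le> c powr p * norm (v x) powr p"
      using powr_mono2[OF assms(3) _ le[of x]] assms(4) by (simp add: powr_mult)
  qed
qed

lemma Lp_add:
  assumes "0 \<le> p" "w \<in> Lp p \<Omega>" "v \<in> Lp p \<Omega>"
  shows "(\<lambda>x. w x + v x) \<in> Lp p \<Omega>"
proof (rule Lp_dominated)
  show "(\<lambda>x. w x + v x) \<in> borel_measurable (lebesgue_on \<Omega>)"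
    using assms Lp_measurable by (intro borel_measurable_add) auto
  show "integrable (lebesgue_on \<Omega>) (\<lambda>x. 2 powr p * (norm (w x) powr p + norm (v x) powr p))"
    using assms Lp_integrable by (intro integrable_mult_right Bochner_Integration.integrable_add) auto
qed (use norm_add_powr_le assms in auto)

lemma Lp_scaleR: "0 \<le> p \<Longrightarrow> w \<in> Lp p \<Omega> \<Longrightarrow> (\<lambda>x. c *\<^sub>R w x) \<in> Lp p \<Omega>"
  by (rule Lp_bound[of _ _ w p "\<bar>c\<bar>"]) (auto simp: Lp_def)

lemma Lp_diff:
  assumes "0 \<le> p" "w \<in> Lp p \<Omega>" "v \<in> Lp p \<Omega>"
  shows "(\<lambda>x. w x - v x) \<in> Lp p \<Omega>"
  using Lp_add[OF assms(1,2) Lp_scaleR[OF assms(1,3), of "-1"]] by simp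

lemma Lp_integral_nonneg: "0 \<le> Lp_integral p \<Omega> w"
  by simp

lemma Lp_integral_add_le:
  assumes "0 \<le> p" "w \<in> Lp p \<Omega>" "v \<in> Lp p \<Omega>"
  shows "Lp_integral p \<Omega> (\<lambda>x. w x + v x) \<le> 2 powr p * (Lp_integral p \<Omega> w + Lp_integral p \<Omega> v)"
proof -
  have "Lp_integral p \<Omega> (\<lambda>x. w x + v x)
      \<le> (LINT x|lebesgue_on \<Omega>. 2 powr p * (norm (w x) powr p + norm (v x) powr p))"
    using assms Lp_integrable
    by (intro integral_mono Lp_integrable[OF Lp_add] norm_add_powr_le integrable_mult_right
        Bochner_Integration.integrable_add) auto
  also have "\<dots> = 2 powr p * (Lp_integral p \<Omega> w + Lp_integral p \<Omega> v)"
    using Lp_integrable[OF assms(2)] Lp_integrable[OF assms(3)] by simp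
  finally show ?thesis .
qed

lemma Lp_integral_scaleR: "Lp_integral p \<Omega> (\<lambda>x. c *\<^sub>R w x) = \<bar>c\<bar> powr p * Lp_integral p \<Omega> w"
  by (simp add: powr_mult)

text \<open>The p-th powers of the differences converge to 0 in L1, hence almost everywhere along a
  subsequence; raising to the power 1/p removes the exponent.\<close>

lemma Lp_AE_subseq:
  fixes W :: "nat \<Rightarrow> 'a::euclidean_space \<Rightarrow> 'b::euclidean_space"
  assumes p: "0 < p" and W: "\<And>k. W k \<in> Lp p \<Omega>" "w \<in> Lp p \<Omega>"
    and lim: "(\<lambda>k. Lp_integral p \<Omega> (\<lambda>x. W k x - w x)) \<longlonglongrightarrow> 0"
  obtains r where "strict_mono r" "AE x in lebesgue_on \<Omega>. (\<lambda>k. W (r k) x) \<longlonglongrightarrow> w x"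
proof -
  have "\<exists>r::nat\<Rightarrow>nat. strict_mono r \<and>
      (AE x in lebesgue_on \<Omega>. (\<lambda>k. norm (W (r k) x - w x) powr p) \<longlonglongrightarrow> 0)"
    using lim p W by (intro tendsto_L1_AE_subseq) (auto intro!: Lp_integrable Lp_diff)
  then obtain r where r: "strict_mono (r::nat\<Rightarrow>nat)"
      "AE x in lebesgue_on \<Omega>. (\<lambda>k. norm (W (r k) x - w x) powr p) \<longlonglongrightarrow> 0" by blast
  from r(2) have "AE x in lebesgue_on \<Omega>. (\<lambda>k. W (r k) x) \<longlonglongrightarrow> w x"
  proof eventually_elim
    case (elim x)
    have "(\<lambda>k. (norm (W (r k) x - w x) powr p) powr (1 / p)) \<longlonglongrightarrow> 0"
      by (rule tendsto_zero_powrI[OF elim tendsto_const]) (use p in auto)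
    then have "(\<lambda>k. norm (W (r k) x - w x)) \<longlonglongrightarrow> 0"
      using p by (simp add: powr_powr)
    then show ?case by (simp add: tendsto_norm_zero_iff LIM_zero_iff)
  qed
  with r(1) show thesis using that by blast
qed

lemma Lp_dominated_convergence:
  fixes W :: "nat \<Rightarrow> 'a::euclidean_space \<Rightarrow> 'b::euclidean_space"
  assumes p: "0 < p" and W: "\<And>k. W k \<in> borel_measurable (lebesgue_on \<Omega>)" "w \<in> borel_measurable (lebesgue_on \<Omega>)"
    and h: "integrable (lebesgue_on \<Omega>) h" "\<And>k. AE x in lebesgue_on \<Omega>. norm (W k x - w x) powr p \<le> h x"
    and lim: "AE x in lebesgue_on \<Omega>. (\<lambda>k. W k x) \<longlonglongrightarrow> w x"
  shows "(\<lambda>k. Lp_integral p \<Omega> (\<lambda>x. W k x - w x)) \<longlonglongrightarrow> 0"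
proof -
  have "(\<lambda>k. Lp_integral p \<Omega> (\<lambda>x. W k x - w x)) \<longlonglongrightarrow> (LINT x|lebesgue_on \<Omega>. 0)"
  proof (rule integral_dominated_convergence[where w=h])
    show "AE x in lebesgue_on \<Omega>. (\<lambda>k. norm (W k x - w x) powr p) \<longlonglongrightarrow> 0"
      using lim
    proof eventually_elim
      case (elim x)
      then have "(\<lambda>k. norm (W k x - w x)) \<longlonglongrightarrow> 0"
        by (simp add: tendsto_norm_zero_iff LIM_zero_iff)
      then show ?case
        by (rule tendsto_zero_powrI[OF _ tendsto_const]) (use p in auto)
    qed
  qed (use W h in auto)
  then show ?thesis by simp
qed

text \<open>The bound is asked only from \<open>N\<close> on, since the liminf ignores the beginning
  and a Cauchy condition supplies no more than that.\<close>

lemma Lp_Fatou: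
  fixes V :: "nat \<Rightarrow> 'a::euclidean_space \<Rightarrow> 'b::euclidean_space"
  assumes p: "0 < p" and V: "\<And>k. V k \<in> Lp p \<Omega>" "v \<in> borel_measurable (lebesgue_on \<Omega>)"
    and lim: "AE x in lebesgue_on \<Omega>. (\<lambda>k. V k x) \<longlonglongrightarrow> v x"
    and bound: "\<And>k. k \<ge> N \<Longrightarrow> Lp_integral p \<Omega> (V k) \<le> e"
  shows "v \<in> Lp p \<Omega>" "Lp_integral p \<Omega> v \<le> e"
proof -
  let ?M = "lebesgue_on \<Omega>"
  have [measurable]: "V k \<in> borel_measurable ?M" for k using V(1) Lp_measurable by blast
  have e: "0 \<le> e" using bound[of N] Lp_integral_nonneg order_trans by blast
  have "(\<integral>\<^sup>+x. ennreal (norm (v x) powr p) \<partial>?M) = (\<integral>\<^sup>+x. liminf (\<lambda>k. ennreal (norm (V k x) powr p)) \<partial>?M)"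
  proof (rule nn_integral_cong_AE)
    show "AE x in ?M. ennreal (norm (v x) powr p) = liminf (\<lambda>k. ennreal (norm (V k x) powr p))"
      using lim
    proof eventually_elim
      case (elim x)
      have "(\<lambda>k. norm (V k x) powr p) \<longlonglongrightarrow> norm (v x) powr p"
        using elim p by (intro tendsto_powr' tendsto_norm tendsto_const) auto
      then have "(\<lambda>k. ennreal (norm (V k x) powr p)) \<longlonglongrightarrow> ennreal (norm (v x) powr p)"
        by (rule tendsto_ennrealI)
      then show ?case by (intro lim_imp_Liminf[symmetric]) simp
    qed
  qed
  also have "\<dots> \<le> liminf (\<lambda>k. \<integral>\<^sup>+x. ennreal (norm (V k x) powr p) \<partial>?M)"
    by (rule nn_integral_liminf) measurable
  also have "\<dots> \<le> ennreal e"
  proof (rule Liminf_le)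
    show "\<forall>\<^sub>F k in sequentially. (\<integral>\<^sup>+x. ennreal (norm (V k x) powr p) \<partial>?M) \<le> ennreal e"
      unfolding eventually_sequentially
      using bound by (intro exI[of _ N]) (auto simp: nn_integral_eq_integral[OF Lp_integrable[OF V(1)]] ennreal_leI)
  qed simp
  finally have le: "(\<integral>\<^sup>+x. ennreal (norm (v x) powr p) \<partial>?M) \<le> ennreal e" .
  then have int: "integrable ?M (\<lambda>x. norm (v x) powr p)"
    using V(2) by (intro integrableI_nonneg) (auto intro: le_less_trans)
  then show "v \<in> Lp p \<Omega>" using V(2) by (simp add: Lp_def)
  show "Lp_integral p \<Omega> v \<le> e"
    using le nn_integral_eq_integral[OF int] e by simp
qed

lemma Lp_integral_tendsto:
  fixes W :: "nat \<Rightarrow> 'a::euclidean_space \<Rightarrow> 'b::euclidean_space"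
  assumes p: "0 < p" and W: "\<And>k. W k \<in> Lp p \<Omega>" "w \<in> Lp p \<Omega>"
    and lim: "(\<lambda>k. Lp_integral p \<Omega> (\<lambda>x. W k x - w x)) \<longlonglongrightarrow> 0"
  shows "(\<lambda>k. Lp_integral p \<Omega> (W k)) \<longlonglongrightarrow> Lp_integral p \<Omega> w"
proof (rule LIMSEQ_I)
  fix e :: real assume e: "0 < e"
  let ?I = "Lp_integral p \<Omega> w"
  \<comment> \<open>This makes \<delta> times the limit integral less than e/2; adding 1 avoids
    division by 0 when that integral vanishes.\<close>
  define \<delta> where "\<delta> = e / (2 * (?I + 1))"
  have I: "0 \<le> ?I" by (rule Lp_integral_nonneg)
  have "0 < 2 * (?I + 1)" by (intro mult_pos_pos add_nonneg_pos[OF I]) simp_all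
  then have \<delta>: "0 < \<delta>" unfolding \<delta>_def by (intro divide_pos_pos e)
  obtain C where C: "0 \<le> C" "\<And>a b :: 'b. \<bar>norm a powr p - norm b powr p\<bar> \<le> \<delta> * norm b powr p + C * norm (a - b) powr p"
    using norm_powr_diff_bound[OF p \<delta>] by metis
  have diff: "\<bar>Lp_integral p \<Omega> (W k) - ?I\<bar> \<le> \<delta> * ?I + C * Lp_integral p \<Omega> (\<lambda>x. W k x - w x)" for k
  proof -
    have int: "integrable (lebesgue_on \<Omega>) (\<lambda>x. norm (W k x) powr p)" "integrable (lebesgue_on \<Omega>) (\<lambda>x. norm (w x) powr p)"
      "integrable (lebesgue_on \<Omega>) (\<lambda>x. norm (W k x - w x) powr p)"
      using p W by (auto intro!: Lp_integrable Lp_diff)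
    have "\<bar>Lp_integral p \<Omega> (W k) - ?I\<bar> = \<bar>LINT x|lebesgue_on \<Omega>. norm (W k x) powr p - norm (w x) powr p\<bar>"
      using int by simp
    also have "\<dots> \<le> (LINT x|lebesgue_on \<Omega>. \<bar>norm (W k x) powr p - norm (w x) powr p\<bar>)"
      by (rule integral_abs_bound)
    also have "\<dots> \<le> (LINT x|lebesgue_on \<Omega>. \<delta> * norm (w x) powr p + C * norm (W k x - w x) powr p)"
      by (intro integral_mono integrable_abs Bochner_Integration.integrable_add Bochner_Integration.integrable_diff
        integrable_mult_right int C(2))
    also have "\<dots> = \<delta> * ?I + C * Lp_integral p \<Omega> (\<lambda>x. W k x - w x)"
      using int by simp
    finally show ?thesis .
  qed
  have lt: "\<delta> * ?I + C * 0 < e"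
  proof -
    have "\<delta> * ?I < \<delta> * (?I + 1)" using \<delta> by simp
    also have "\<dots> = e / 2" 
    proof -
      have "e / (2 * c) * c = e / 2" if "0 < 2 * c" for c using that by simp
      then show ?thesis using \<open>0 < 2 * (?I + 1)\<close> unfolding \<delta>_def by blast
    qed
    also have "\<dots> < e" using e by simp
    finally show ?thesis by simp
  qed
  have "(\<lambda>k. \<delta> * ?I + C * Lp_integral p \<Omega> (\<lambda>x. W k x - w x)) \<longlonglongrightarrow> \<delta> * ?I + C * 0"
    by (intro tendsto_intros lim)
  from order_tendstoD(2)[OF this lt]
  have "\<forall>\<^sub>F k in sequentially. \<delta> * ?I + C * Lp_integral p \<Omega> (\<lambda>x. W k x - w x) < e" .
  then have "\<forall>\<^sub>F k in sequentially. \<bar>Lp_integral p \<Omega> (W k) - ?I\<bar> < e"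
    by (rule eventually_mono) (rule le_less_trans[OF diff])
  then show "\<exists>no. \<forall>k\<ge>no. norm (Lp_integral p \<Omega> (W k) - ?I) < e"
    unfolding eventually_sequentially real_norm_def .
qed

text \<open>Riesz-Fischer for p-th powers. The increments of a fast subsequence are multiplied by
  geometric weights such that the weighted powers still have a summable integral. Where their sum is
  finite, the increments decay geometrically and the subsequence converges.\<close>

proposition Lp_complete:
  fixes W :: "nat \<Rightarrow> 'a::euclidean_space \<Rightarrow> 'b::euclidean_space"
  assumes p: "0 < p" and W: "\<And>k. W k \<in> Lp p \<Omega>"
    and Cauchy: "\<And>e. 0 < e \<Longrightarrow> \<exists>N. \<forall>j\<ge>N. \<forall>k\<ge>N. Lp_integral p \<Omega> (\<lambda>x. W j x - W k x) \<le> e"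
  obtains w where "w \<in> Lp p \<Omega>" "(\<lambda>k. Lp_integral p \<Omega> (\<lambda>x. W k x - w x)) \<longlonglongrightarrow> 0"
proof -
  let ?M = "lebesgue_on \<Omega>"
  have [measurable]: "W k \<in> borel_measurable ?M" for k using W Lp_measurable by blast
  \<comment> \<open>Against the weight 2^(pk), an integral bounded by q^k leaves exactly
    (1/2)^k.\<close>
  define q where "q = (1 / 2 :: real) powr (p + 1)"
  have q: "0 < q" by (simp add: q_def)
  have "\<exists>N. \<forall>k. \<forall>i\<ge>N k. \<forall>j\<ge>N k. Lp_integral p \<Omega> (\<lambda>x. W i x - W j x) \<le> q ^ k"
    using Cauchy q by (intro choice) auto
  then obtain N where N: "\<And>k i j. N k \<le> i \<Longrightarrow> N k \<le> j \<Longrightarrow> Lp_integral p \<Omega> (\<lambda>x. W i x - W j x) \<le> q ^ k" by blast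
  \<comment> \<open>\<open>r\<close> is strictly increasing and \<open>r k\<close> is at least
    \<open>N k\<close>, so consecutive members of the subsequence differ by at most q^k.\<close>
  define r where "r = rec_nat (N 0) (\<lambda>k m. max (Suc m) (N (Suc k)))"
  have r: "strict_mono r" "N k \<le> r k" for k
  proof -
    show "strict_mono r" by (rule strict_mono_Suc_iff[THEN iffD2]) (auto simp: r_def less_max_iff_disj)
    show "N k \<le> r k" by (cases k) (auto simp: r_def)
  qed
  define d where "d k x = norm (W (r (Suc k)) x - W (r k) x)" for k x
  have [measurable]: "d k \<in> borel_measurable ?M" for k unfolding d_def by measurable
  have dint: "integrable ?M (\<lambda>x. d k x powr p)" for k
    using Lp_integrable[OF Lp_diff[OF less_imp_le[OF p] W W]] unfolding d_def .
  have d: "(LINT x|?M. d k x powr p) \<le> q ^ k" for k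
    unfolding d_def using r(2)[of k] strict_mono_less_eq[OF r(1), of k "Suc k"] by (intro N) auto
  have meas: "(\<lambda>x. ennreal (2 powr (p * k) * d k x powr p)) \<in> borel_measurable ?M" for k :: nat
    by measurable
  have "(\<integral>\<^sup>+x. (\<Sum>k. ennreal (2 powr (p * k) * d k x powr p)) \<partial>?M) \<noteq> \<infinity>"
  proof -
    have "(\<integral>\<^sup>+x. (\<Sum>k. ennreal (2 powr (p * k) * d k x powr p)) \<partial>?M)
        = (\<Sum>k. \<integral>\<^sup>+x. ennreal (2 powr (p * k) * d k x powr p) \<partial>?M)"
      by (rule nn_integral_suminf[OF meas])
    also have "\<dots> \<le> (\<Sum>k. ennreal ((1 / 2) ^ k))"
    proof (rule suminf_le)
      fix k
      have "(\<integral>\<^sup>+x. ennreal (2 powr (p * k) * d k x powr p) \<partial>?M) = ennreal (LINT x|?M. 2 powr (p * k) * d k x powr p)"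
        using dint by (intro nn_integral_eq_integral integrable_mult_right) auto
      also have "\<dots> = ennreal (2 powr (p * k) * (LINT x|?M. d k x powr p))" by simp
      also have "\<dots> \<le> ennreal (2 powr (p * k) * q ^ k)"
        using d[of k] by (intro ennreal_leI mult_left_mono) auto
      also have "2 powr (p * k) * q ^ k = (1 / 2) ^ k"
      proof -
        have "q ^ k = (1/2) powr ((p + 1) * k)" by (simp add: q_def powr_realpow[symmetric] powr_powr)
        also have "\<dots> = (1/2) powr (p * k) * (1/2) ^ k"
          by (simp add: distrib_right powr_add powr_realpow)
        finally have "2 powr (p * k) * q ^ k = (2 powr (p * k) * (1/2) powr (p * k)) * (1/2) ^ k" by simp
        also have "2 powr (p * k) * (1/2) powr (p * k) = 1"
          by (simp flip: powr_mult)
        finally show ?thesis by simp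
      qed
      finally show "(\<integral>\<^sup>+x. ennreal (2 powr (p * k) * d k x powr p) \<partial>?M) \<le> ennreal ((1 / 2) ^ k)" .
    qed auto
    also have "\<dots> = ennreal (\<Sum>k. (1 / 2) ^ k)"
      by (rule suminf_ennreal2) (auto intro: summable_geometric)
    also have "\<dots> < \<infinity>" by simp
    finally show ?thesis by simp
  qed
  then have "AE x in ?M. (\<Sum>k. ennreal (2 powr (p * k) * d k x powr p)) \<noteq> \<infinity>"
    by (rule nn_integral_PInf_AE[OF borel_measurable_suminf_order[OF meas]])
  then have conv: "AE x in ?M. convergent (\<lambda>k. W (r k) x)"
  proof eventually_elim
    case (elim x)
    define T where "T = (\<Sum>k. ennreal (2 powr (p * k) * d k x powr p))"
    have "T \<noteq> \<infinity>" using elim unfolding T_def .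
    then obtain S where "0 \<le> S" "T = ennreal S"
      by (cases T) auto
    then have S: "0 \<le> S" "(\<Sum>k. ennreal (2 powr (p * k) * d k x powr p)) = ennreal S"
      unfolding T_def .
    define F where "F k = ennreal (2 powr (p * real k) * d k x powr p)" for k
    have F: "(\<Sum>k. F k) = ennreal S" using S(2) unfolding F_def .
    \<comment> \<open>A single term of the weighted series is at most its sum \<open>S\<close>;
      taking p-th roots turns the weight into 2^k.\<close>
    have dle: "d k x \<le> S powr (1 / p) * (1 / 2) ^ k" for k
    proof -
      have "sum F {k} \<le> (\<Sum>k. F k)" by (rule sum_le_suminf) auto
      then have "ennreal (2 powr (p * real k) * d k x powr p) \<le> ennreal S"
        unfolding F by (simp only: F_def sum.insert_remove sum.empty finite.emptyI Diff_empty empty_Diff add_0_right)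
      then have "2 powr (p * k) * d k x powr p \<le> S" using S(1) by (simp only: ennreal_le_iff)
      then have "(2 powr (p * k) * d k x powr p) powr (1 / p) \<le> S powr (1 / p)"
        using p by (intro powr_mono2) auto
      also have "(2 powr (p * k) * d k x powr p) powr (1 / p) = 2 ^ k * d k x"
        using p by (simp add: powr_mult powr_powr powr_realpow d_def)
      finally show ?thesis by (simp add: field_simps)
    qed
    have "summable (\<lambda>k. W (r (Suc k)) x - W (r k) x)"
    proof (rule summable_comparison_test')
      show "summable (\<lambda>k. S powr (1 / p) * (1 / 2) ^ k)" by (intro summable_mult summable_geometric) simp
      show "norm (W (r (Suc k)) x - W (r k) x) \<le> S powr (1 / p) * (1 / 2) ^ k" if "0 \<le> k" for k
        using dle[of k] by (simp add: d_def)
    qed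
    then have "convergent (\<lambda>n. \<Sum>k<n. W (r (Suc k)) x - W (r k) x)"
      by (simp add: summable_iff_convergent)
    then have "convergent (\<lambda>n. W (r n) x - W (r 0) x)"
      using sum_lessThan_telescope[of "\<lambda>k. W (r k) x"] by simp
    then show ?case by (simp add: convergent_diff_const_right_iff)
  qed
  define w where "w x = lim (\<lambda>k. W (r k) x)" for x
  have [measurable]: "w \<in> borel_measurable ?M" unfolding w_def by measurable
  have wlim: "AE x in ?M. (\<lambda>k. W (r k) x) \<longlonglongrightarrow> w x"
    using conv by eventually_elim (simp add: w_def convergent_LIMSEQ_iff)
  \<comment> \<open>Only the second index runs to infinity, so the Cauchy estimate becomes an
    estimate of the distance to the limit.\<close>
  have fatou: "(\<lambda>x. W m x - w x) \<in> Lp p \<Omega>" "Lp_integral p \<Omega> (\<lambda>x. W m x - w x) \<le> e"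
    if "\<And>k. k \<ge> K \<Longrightarrow> Lp_integral p \<Omega> (\<lambda>x. W m x - W (r k) x) \<le> e" for m K e
  proof -
    have "AE x in ?M. (\<lambda>k. W m x - W (r k) x) \<longlonglongrightarrow> W m x - w x"
      using wlim by eventually_elim (intro tendsto_intros)
    note * = Lp_Fatou[OF p Lp_diff[OF less_imp_le[OF p] W W] _ this that]
    show "(\<lambda>x. W m x - w x) \<in> Lp p \<Omega>" "Lp_integral p \<Omega> (\<lambda>x. W m x - w x) \<le> e"
      by (rule *; simp)+
  qed
  have main: "\<exists>K. \<forall>m\<ge>K. (\<lambda>x. W m x - w x) \<in> Lp p \<Omega> \<and> Lp_integral p \<Omega> (\<lambda>x. W m x - w x) \<le> e"
    if e: "0 < e" for e
  proof -
    obtain K where K: "\<And>j k. j \<ge> K \<Longrightarrow> k \<ge> K \<Longrightarrow> Lp_integral p \<Omega> (\<lambda>x. W j x - W k x) \<le> e"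
      using Cauchy[OF e] by blast
    have "r k \<ge> K" if "k \<ge> K" for k using that seq_suble[OF r(1), of k] by linarith
    then show ?thesis using fatou[of K _ e] K by blast
  qed
  \<comment> \<open>One difference in \<open>Lp\<close> already places the limit in
    \<open>Lp\<close>, as \<open>W m\<close> minus that difference.\<close>
  obtain m where m: "(\<lambda>x. W m x - w x) \<in> Lp p \<Omega>" using main[of 1] by auto
  have "w \<in> Lp p \<Omega>" using Lp_diff[OF less_imp_le[OF p] W[of m] m] by simp
  moreover have "(\<lambda>k. Lp_integral p \<Omega> (\<lambda>x. W k x - w x)) \<longlonglongrightarrow> 0"
  proof (rule LIMSEQ_I)
    fix e :: real assume "0 < e"
    then obtain K where "\<forall>m\<ge>K. Lp_integral p \<Omega> (\<lambda>x. W m x - w x) \<le> e / 2" using main[of "e / 2"] by auto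
    then show "\<exists>K. \<forall>m\<ge>K. norm (Lp_integral p \<Omega> (\<lambda>x. W m x - w x) - 0) < e"
      using \<open>0 < e\<close> Lp_integral_nonneg by (intro exI[of _ K]) fastforce
  qed
  ultimately show thesis using that by blast
qed

section \<open>Closure of the test functions in the Sobolev norm\<close>

text \<open>Young's inequality for c|a| and |b|/c, where c^q = \<delta>; the denominators p and q
  exceed 1 and are dropped.\<close>

lemma Young_eps:
  fixes p q \<delta> :: real
  assumes "1 < p" "1 < q" "1 / p + 1 / q = 1" "0 < \<delta>"
  obtains C where "0 \<le> C" "\<And>a b. \<bar>a * b\<bar> \<le> \<delta> * \<bar>a\<bar> powr q + C * \<bar>b\<bar> powr p"
proof -
  define c where "c = \<delta> powr (1 / q)"
  have c: "0 < c" "c powr q = \<delta>" using assms by (auto simp: c_def powr_powr)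
  have "\<bar>a * b\<bar> \<le> \<delta> * \<bar>a\<bar> powr q + (1 / c) powr p * \<bar>b\<bar> powr p" for a b
  proof -
    have "\<bar>a * b\<bar> = (c * \<bar>a\<bar>) * (\<bar>b\<bar> / c)" using c by (simp add: abs_mult)
    also have "\<dots> \<le> (c * \<bar>a\<bar>) powr q / q + (\<bar>b\<bar> / c) powr p / p"
      using assms c by (intro Youngs_inequality) (auto simp: add.commute)
    also have "\<dots> \<le> (c * \<bar>a\<bar>) powr q + (\<bar>b\<bar> / c) powr p"
      using assms by (intro add_mono) (auto simp: divide_le_eq mult_le_cancel_left1)
    also have "\<dots> = \<delta> * \<bar>a\<bar> powr q + (1 / c) powr p * \<bar>b\<bar> powr p"
      using c by (simp add: powr_mult powr_divide)
    finally show ?thesis .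
  qed
  then show thesis using that[of "(1 / c) powr p"] by auto
qed

lemma test_function_add:
  assumes "test_function \<Omega> \<phi>" "test_function \<Omega> \<psi>"
  shows "test_function \<Omega> (\<lambda>x. \<phi> x + \<psi> x)"
proof -
  obtain K L where K: "compact K" "K \<subseteq> \<Omega>" "\<And>x. x \<notin> K \<Longrightarrow> \<phi> x = 0"
    and L: "compact L" "L \<subseteq> \<Omega>" "\<And>x. x \<notin> L \<Longrightarrow> \<psi> x = 0"
    using test_function_support[OF assms(1)] test_function_support[OF assms(2)] by metis
  show ?thesis
    by (rule test_function_supported[of _ "K \<union> L"])
      (use K L assms in \<open>auto intro!: Ck_add test_functionD(1)[OF assms(1)] test_functionD(1)[OF assms(2)] compact_Un\<close>)
qed

lemma test_function_compose:
  assumes "test_function \<Omega> \<phi>" "\<And>k. Ck k (\<lambda>x. \<eta> (\<phi> x))" "\<eta> 0 = 0"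
  shows "test_function \<Omega> (\<lambda>x. \<eta> (\<phi> x))"
proof -
  obtain K where "compact K" "K \<subseteq> \<Omega>" "\<And>x. x \<notin> K \<Longrightarrow> \<phi> x = 0"
    using test_function_support[OF assms(1)] by metis
  then show ?thesis using assms by (intro test_function_supported[of _ K]) auto
qed

lemma test_function_cmult:
  assumes "test_function \<Omega> \<phi>"
  shows "test_function \<Omega> (\<lambda>x. c * \<phi> x)"
  using test_functionD(1)[OF assms]
  by (intro test_function_compose[OF assms, of "\<lambda>t. c * t"]) (auto intro!: Ck_mult Ck_const)

text \<open>With value and gradient combined into one vector valued function, every result on
  \<open>Lp\<close> applies to the Sobolev norm directly.\<close>

definition jet :: "('a::euclidean_space \<Rightarrow> real) \<Rightarrow> 'a \<Rightarrow> real \<times> 'a" where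
  "jet \<phi> x = (\<phi> x, grad \<phi> x)"

lemma jet_add:
  assumes "test_function \<Omega> \<phi>" "test_function \<Omega> \<psi>"
  shows "jet (\<lambda>x. \<phi> x + \<psi> x) x = jet \<phi> x + jet \<psi> x"
proof -
  have "grad (\<lambda>x. \<phi> x + \<psi> x) x = grad \<phi> x + grad \<psi> x"
    using has_derivative_add[OF test_functionD(5)[OF assms(1)] test_functionD(5)[OF assms(2)], of x]
    by (intro grad_eqI) (simp add: inner_add_left)
  then show ?thesis by (simp add: jet_def)
qed

lemma jet_cmult:
  assumes "test_function \<Omega> \<phi>"
  shows "jet (\<lambda>x. c * \<phi> x) x = c *\<^sub>R jet \<phi> x"
proof -
  have "grad (\<lambda>x. c * \<phi> x) x = c *\<^sub>R grad \<phi> x"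
    using has_derivative_mult_right[OF test_functionD(5)[OF assms], of c x]
    by (intro grad_eqI) simp
  then show ?thesis by (simp add: jet_def)
qed

text \<open>Elements are pairs \<open>(u, \<nabla>u)\<close>, so that no choice of a weak gradient is involved.\<close>

definition Sob :: "real \<Rightarrow> 'a::euclidean_space set \<Rightarrow> ('a \<Rightarrow> real \<times> 'a) set" where
  "Sob p \<Omega> = {w \<in> Lp p \<Omega>. \<exists>\<phi>. (\<forall>k::nat. test_function \<Omega> (\<phi> k)) \<and>
     (\<lambda>k. Lp_integral p \<Omega> (\<lambda>x. jet (\<phi> k) x - w x)) \<longlonglongrightarrow> 0}"

lemma norm_prod_powr_le:
  assumes "0 \<le> p"
  shows "norm w powr p \<le> 2 powr p * (norm (fst w) powr p + norm (snd w) powr p)"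
  using norm_add_powr_le[OF assms, of "(fst w, 0)" "(0, snd w)"] by simp

lemma norm_fst_le_norm: "norm (fst z) \<le> norm z" and norm_snd_le_norm: "norm (snd z) \<le> norm z"
  by (cases z, simp add: norm_fst_le norm_snd_le)+

lemma borel_measurable_fst_snd:
  fixes w :: "'a \<Rightarrow> 'b::euclidean_space \<times> 'c::euclidean_space"
  assumes "w \<in> borel_measurable M"
  shows "(\<lambda>x. fst (w x)) \<in> borel_measurable M" "(\<lambda>x. snd (w x)) \<in> borel_measurable M"
  using borel_measurable_continuous_on[OF continuous_on_fst[OF continuous_on_id] assms]
    borel_measurable_continuous_on[OF continuous_on_snd[OF continuous_on_id] assms] by simp_all

lemma Lp_fst_snd:
  fixes w :: "'a::euclidean_space \<Rightarrow> 'b::euclidean_space \<times> 'c::euclidean_space"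
  assumes "0 \<le> p" "w \<in> Lp p \<Omega>"
  shows "(\<lambda>x. fst (w x)) \<in> Lp p \<Omega>" "(\<lambda>x. snd (w x)) \<in> Lp p \<Omega>"
  using assms borel_measurable_fst_snd[OF Lp_measurable[OF assms(2)]]
  by (auto intro!: Lp_bound[of _ _ w p 1] simp: norm_fst_le_norm norm_snd_le_norm)

lemma Lp_Pair:
  fixes u :: "'a::euclidean_space \<Rightarrow> 'b::euclidean_space" and g :: "'a \<Rightarrow> 'c::euclidean_space"
  assumes "0 \<le> p" "u \<in> Lp p \<Omega>" "g \<in> Lp p \<Omega>"
  shows "(\<lambda>x. (u x, g x)) \<in> Lp p \<Omega>"
proof (rule Lp_dominated)
  show "(\<lambda>x. (u x, g x)) \<in> borel_measurable (lebesgue_on \<Omega>)"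
    by (intro borel_measurable_Pair Lp_measurable[OF assms(2)] Lp_measurable[OF assms(3)])
  show "integrable (lebesgue_on \<Omega>) (\<lambda>x. 2 powr p * (norm (u x) powr p + norm (g x) powr p))"
    by (intro integrable_mult_right Bochner_Integration.integrable_add Lp_integrable[OF assms(2)] Lp_integrable[OF assms(3)])
qed (use norm_prod_powr_le[OF assms(1), of "(u _, g _)"] in auto)

lemma Lp_integral_mono:
  fixes w :: "'a::euclidean_space \<Rightarrow> 'b::euclidean_space" and v :: "'a \<Rightarrow> 'c::euclidean_space"
  assumes "w \<in> Lp p \<Omega>" "v \<in> Lp p \<Omega>" "0 \<le> p" "\<And>x. norm (w x) \<le> norm (v x)"
  shows "Lp_integral p \<Omega> w \<le> Lp_integral p \<Omega> v"
  using assms by (intro integral_mono Lp_integrable powr_mono2) auto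

text \<open>The product norm dominates each component and is dominated by their sum. This is the
  dictionary between \<open>W1p_norm\<close>, which adds two integrals, and the single integral of a
  pair.\<close>

lemma Lp_integral_fst_snd:
  fixes w :: "'a::euclidean_space \<Rightarrow> 'b::euclidean_space \<times> 'c::euclidean_space"
  assumes "0 \<le> p" "w \<in> Lp p \<Omega>"
  shows "Lp_integral p \<Omega> (\<lambda>x. fst (w x)) \<le> Lp_integral p \<Omega> w"
    "Lp_integral p \<Omega> (\<lambda>x. snd (w x)) \<le> Lp_integral p \<Omega> w"
    "Lp_integral p \<Omega> w \<le> 2 powr p * (Lp_integral p \<Omega> (\<lambda>x. fst (w x)) + Lp_integral p \<Omega> (\<lambda>x. snd (w x)))"
proof -
  note L = Lp_fst_snd[OF assms]
  show "Lp_integral p \<Omega> (\<lambda>x. fst (w x)) \<le> Lp_integral p \<Omega> w"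
    "Lp_integral p \<Omega> (\<lambda>x. snd (w x)) \<le> Lp_integral p \<Omega> w"
    by (rule Lp_integral_mono[OF L(1) assms(2,1) norm_fst_le_norm], rule Lp_integral_mono[OF L(2) assms(2,1) norm_snd_le_norm])
  have "Lp_integral p \<Omega> w \<le> (LINT x|lebesgue_on \<Omega>. 2 powr p * (norm (fst (w x)) powr p + norm (snd (w x)) powr p))"
    by (intro integral_mono integrable_mult_right Bochner_Integration.integrable_add Lp_integrable L assms
        norm_prod_powr_le)
  also have "\<dots> = 2 powr p * (Lp_integral p \<Omega> (\<lambda>x. fst (w x)) + Lp_integral p \<Omega> (\<lambda>x. snd (w x)))"
    using Lp_integrable[OF L(1)] Lp_integrable[OF L(2)] by simp
  finally show "Lp_integral p \<Omega> w \<le> 2 powr p * (Lp_integral p \<Omega> (\<lambda>x. fst (w x)) + Lp_integral p \<Omega> (\<lambda>x. snd (w x)))" .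
qed

section \<open>The standing setting and the closed space of Sobolev pairs\<close>

locale sobolev =
  fixes p q :: real and \<Omega> :: "'a::euclidean_space set"
  assumes p: "1 < p" and pq: "1 / p + 1 / q = 1"
    and open_\<Omega>: "open \<Omega>" and bounded_\<Omega>: "bounded \<Omega>"
begin

abbreviation M where "M \<equiv> lebesgue_on \<Omega>"

lemma p0: "0 \<le> p" "0 < p" using p by auto

lemma q: "1 < q"
proof -
  have "1 / q = 1 - 1 / p" using pq by linarith
  moreover have "0 < 1 / p" "1 / p < 1" using p by auto
  ultimately have "0 < 1 / q" "1 / q < 1" by linarith+
  then show ?thesis using p by (simp add: divide_less_eq_1 split: if_splits)
qed

lemma finite_measure_M: "finite_measure M"
proof -
  have "\<Omega> \<in> lmeasurable"
    using bounded_\<Omega> open_\<Omega> by (intro bounded_set_imp_lmeasurable) auto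
  then show ?thesis by (intro finite_measure_lebesgue_on)
qed

lemma borel_measurable_M_continuous: "continuous_on UNIV f \<Longrightarrow> f \<in> borel_measurable M"
  using borel_measurable_lebesgue_continuous measurable_restrict_space1 by blast

lemma Lp_of_bounded:
  fixes w :: "'a \<Rightarrow> 'b::euclidean_space"
  assumes "w \<in> borel_measurable M" "\<And>x. norm (w x) \<le> B" "0 \<le> r"
  shows "w \<in> Lp r \<Omega>"
proof (rule Lp_dominated)
  show "integrable M (\<lambda>_. B powr r)"
    using finite_measure_M by (simp add: finite_measure.integrable_const)
  show "AE x in M. norm (w x) powr r \<le> B powr r"
    using assms by (intro AE_I2 powr_mono2) auto
qed fact

lemma Lp_const: "0 \<le> r \<Longrightarrow> (\<lambda>_. c :: 'b::euclidean_space) \<in> Lp r \<Omega>"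
  by (rule Lp_of_bounded[of _ "norm c"]) auto

lemma test_function_bounded:
  assumes "test_function \<Omega> \<phi>"
  obtains B where "\<And>x. norm (jet \<phi> x) \<le> B"
proof -
  obtain K where K: "compact K" "\<And>x. x \<notin> K \<Longrightarrow> \<phi> x = 0" "\<And>x. x \<notin> K \<Longrightarrow> grad \<phi> x = 0"
    using test_function_support[OF assms] by metis
  have "continuous_on UNIV (jet \<phi>)"
    unfolding jet_def[abs_def] by (intro continuous_intros test_functionD[OF assms])
  then have "bounded (jet \<phi> ` K)"
    using K(1) by (meson compact_continuous_image compact_imp_bounded continuous_on_subset subset_UNIV)
  then obtain B where B: "\<forall>x\<in>K. norm (jet \<phi> x) \<le> B" by (auto simp: bounded_iff)
  have "norm (jet \<phi> x) \<le> max 0 B" for x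
    using B K(2,3)[of x] by (cases "x \<in> K") (auto simp: jet_def zero_prod_def[symmetric] le_max_iff_disj)
  then show thesis by (rule that)
qed

lemma jet_measurable: "test_function \<Omega> \<phi> \<Longrightarrow> jet \<phi> \<in> borel_measurable M"
  unfolding jet_def[abs_def] by (intro borel_measurable_M_continuous continuous_intros test_functionD)

lemma jet_Lp: "test_function \<Omega> \<phi> \<Longrightarrow> 0 \<le> r \<Longrightarrow> jet \<phi> \<in> Lp r \<Omega>"
  using test_function_bounded[of \<phi>] Lp_of_bounded[OF jet_measurable] by metis

lemma test_Lp:
  assumes "test_function \<Omega> \<phi>" "0 \<le> r"
  shows "\<phi> \<in> Lp r \<Omega>" "grad \<phi> \<in> Lp r \<Omega>"
  using Lp_fst_snd[OF assms(2) jet_Lp[OF assms]] by (simp_all add: jet_def)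

lemma Sob_Lp: "w \<in> Sob p \<Omega> \<Longrightarrow> w \<in> Lp p \<Omega>"
  by (simp add: Sob_def)

lemma Sob_jet:
  assumes "test_function \<Omega> \<phi>"
  shows "jet \<phi> \<in> Sob p \<Omega>"
proof -
  have "\<exists>\<psi>. (\<forall>k::nat. test_function \<Omega> (\<psi> k)) \<and> (\<lambda>k. Lp_integral p \<Omega> (\<lambda>x. jet (\<psi> k) x - jet \<phi> x)) \<longlonglongrightarrow> 0"
    by (rule exI[of _ "\<lambda>_. \<phi>"]) (use assms in simp)
  then show ?thesis using jet_Lp[OF assms p0(1)] by (simp add: Sob_def)
qed

text \<open>One approximant per tolerance suffices; in this form closure under limits and sums
  reduces to choosing tolerances.\<close>

lemma Sob_approx_iff:
  "w \<in> Sob p \<Omega> \<longleftrightarrow> w \<in> Lp p \<Omega> \<and>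
    (\<forall>e>0. \<exists>\<phi>. test_function \<Omega> \<phi> \<and> Lp_integral p \<Omega> (\<lambda>x. jet \<phi> x - w x) < e)" (is "_ = (_ \<and> ?R)")
proof (intro iffI conjI)
  assume w: "w \<in> Sob p \<Omega>"
  then show "w \<in> Lp p \<Omega>" by (rule Sob_Lp)
  obtain \<phi> where \<phi>: "\<And>k::nat. test_function \<Omega> (\<phi> k)"
    "(\<lambda>k. Lp_integral p \<Omega> (\<lambda>x. jet (\<phi> k) x - w x)) \<longlonglongrightarrow> 0"
    using w by (auto simp: Sob_def)
  show ?R
  proof (intro allI impI)
    fix e :: real assume "0 < e"
    then have "\<forall>\<^sub>F k in sequentially. Lp_integral p \<Omega> (\<lambda>x. jet (\<phi> k) x - w x) < e"
      by (rule order_tendstoD(2)[OF \<phi>(2)])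
    then obtain k where "Lp_integral p \<Omega> (\<lambda>x. jet (\<phi> k) x - w x) < e"
      using eventually_happens'[OF sequentially_bot] by blast
    then show "\<exists>\<phi>. test_function \<Omega> \<phi> \<and> Lp_integral p \<Omega> (\<lambda>x. jet \<phi> x - w x) < e"
      using \<phi>(1) by blast
  qed
next
  assume w: "w \<in> Lp p \<Omega> \<and> ?R"
  then have "\<exists>\<phi>. test_function \<Omega> \<phi> \<and> Lp_integral p \<Omega> (\<lambda>x. jet \<phi> x - w x) < inverse (real (Suc k))" for k
    by simp
  then obtain \<phi> where \<phi>: "\<And>k. test_function \<Omega> (\<phi> k)"
    "\<And>k. Lp_integral p \<Omega> (\<lambda>x. jet (\<phi> k) x - w x) < inverse (real (Suc k))" by metis
  have "(\<lambda>k. Lp_integral p \<Omega> (\<lambda>x. jet (\<phi> k) x - w x)) \<longlonglongrightarrow> 0"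
  proof (rule tendsto_sandwich[OF _ _ tendsto_const LIMSEQ_inverse_real_of_nat])
    show "\<forall>\<^sub>F k in sequentially. 0 \<le> Lp_integral p \<Omega> (\<lambda>x. jet (\<phi> k) x - w x)" by simp
    show "\<forall>\<^sub>F k in sequentially. Lp_integral p \<Omega> (\<lambda>x. jet (\<phi> k) x - w x) \<le> inverse (real (Suc k))"
      using \<phi>(2) less_imp_le by (intro always_eventually allI) blast
  qed
  then show "w \<in> Sob p \<Omega>" using w \<phi>(1) by (auto simp: Sob_def)
qed

lemma Sob_closed:
  assumes W: "\<And>k. W k \<in> Sob p \<Omega>" and w: "w \<in> Lp p \<Omega>"
    and lim: "(\<lambda>k::nat. Lp_integral p \<Omega> (\<lambda>x. W k x - w x)) \<longlonglongrightarrow> 0"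
  shows "w \<in> Sob p \<Omega>"
  unfolding Sob_approx_iff
proof (intro conjI w allI impI)
  fix e :: real assume e: "0 < e"
  \<comment> \<open>The triangle inequality for p-th powers costs the factor \<open>2 powr p\<close>
    and adds two errors, so each may be this large.\<close>
  define e' where "e' = e / (2 * 2 powr p)"
  have e': "0 < e'" using e by (simp add: e'_def)
  have "\<forall>\<^sub>F k in sequentially. Lp_integral p \<Omega> (\<lambda>x. W k x - w x) < e'"
    by (rule order_tendstoD(2)[OF lim e'])
  then obtain k where k: "Lp_integral p \<Omega> (\<lambda>x. W k x - w x) < e'"
    using eventually_happens'[OF sequentially_bot] by blast
  obtain \<phi> where \<phi>: "test_function \<Omega> \<phi>" "Lp_integral p \<Omega> (\<lambda>x. jet \<phi> x - W k x) < e'"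
    using W[of k] e' unfolding Sob_approx_iff by blast
  have "Lp_integral p \<Omega> (\<lambda>x. (jet \<phi> x - W k x) + (W k x - w x))
    \<le> 2 powr p * (Lp_integral p \<Omega> (\<lambda>x. jet \<phi> x - W k x) + Lp_integral p \<Omega> (\<lambda>x. W k x - w x))"
    using Lp_integral_add_le[OF p0(1) Lp_diff[OF p0(1) jet_Lp[OF \<phi>(1) p0(1)] Sob_Lp[OF W]] Lp_diff[OF p0(1) Sob_Lp[OF W] w]] .
  also have "\<dots> < 2 powr p * (e' + e')"
    using k \<phi>(2) by (intro mult_strict_left_mono add_strict_mono) auto
  also have "\<dots> = e" by (simp add: e'_def)
  finally show "\<exists>\<phi>. test_function \<Omega> \<phi> \<and> Lp_integral p \<Omega> (\<lambda>x. jet \<phi> x - w x) < e"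
    using \<phi>(1) by (auto simp: algebra_simps)
qed

lemma Sob_add:
  assumes "w \<in> Sob p \<Omega>" "v \<in> Sob p \<Omega>"
  shows "(\<lambda>x. w x + v x) \<in> Sob p \<Omega>"
  unfolding Sob_approx_iff
proof (intro conjI allI impI)
  show "(\<lambda>x. w x + v x) \<in> Lp p \<Omega>" using assms p0 by (intro Lp_add Sob_Lp)
  fix e :: real assume e: "0 < e"
  define e' where "e' = e / (2 * 2 powr p)"
  have e': "0 < e'" using e by (simp add: e'_def)
  obtain \<phi> where \<phi>: "test_function \<Omega> \<phi>" "Lp_integral p \<Omega> (\<lambda>x. jet \<phi> x - w x) < e'"
    using assms(1) e' unfolding Sob_approx_iff by blast
  obtain \<psi> where \<psi>: "test_function \<Omega> \<psi>" "Lp_integral p \<Omega> (\<lambda>x. jet \<psi> x - v x) < e'"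
    using assms(2) e' unfolding Sob_approx_iff by blast
  have "Lp_integral p \<Omega> (\<lambda>x. (jet \<phi> x - w x) + (jet \<psi> x - v x))
    \<le> 2 powr p * (Lp_integral p \<Omega> (\<lambda>x. jet \<phi> x - w x) + Lp_integral p \<Omega> (\<lambda>x. jet \<psi> x - v x))"
    using p0 assms \<phi>(1) \<psi>(1) by (intro Lp_integral_add_le Lp_diff jet_Lp Sob_Lp)
  also have "\<dots> < 2 powr p * (e' + e')"
    using \<psi>(2) \<phi>(2) by (intro mult_strict_left_mono add_strict_mono) auto
  also have "\<dots> = e" by (simp add: e'_def)
  finally have "Lp_integral p \<Omega> (\<lambda>x. jet (\<lambda>x. \<phi> x + \<psi> x) x - (w x + v x)) < e"
    by (simp add: jet_add[OF \<phi>(1) \<psi>(1)] algebra_simps)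
  then show "\<exists>\<phi>. test_function \<Omega> \<phi> \<and> Lp_integral p \<Omega> (\<lambda>x. jet \<phi> x - (w x + v x)) < e"
    using test_function_add[OF \<phi>(1) \<psi>(1)] by blast
qed

lemma Sob_scaleR:
  assumes "w \<in> Sob p \<Omega>"
  shows "(\<lambda>x. c *\<^sub>R w x) \<in> Sob p \<Omega>"
  unfolding Sob_approx_iff
proof (intro conjI allI impI)
  show "(\<lambda>x. c *\<^sub>R w x) \<in> Lp p \<Omega>" using assms p0 by (intro Lp_scaleR Sob_Lp)
  fix e :: real assume e: "0 < e"
  define C where "C = \<bar>c\<bar> powr p"
  have C: "0 \<le> C" by (simp add: C_def)
  \<comment> \<open>Dividing by C + 1 also covers c = 0.\<close>
  obtain \<phi> where \<phi>: "test_function \<Omega> \<phi>" "Lp_integral p \<Omega> (\<lambda>x. jet \<phi> x - w x) < e / (C + 1)"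
    using assms e C unfolding Sob_approx_iff by (metis add_nonneg_pos divide_pos_pos zero_less_one)
  have "Lp_integral p \<Omega> (\<lambda>x. jet (\<lambda>x. c * \<phi> x) x - c *\<^sub>R w x) = C * Lp_integral p \<Omega> (\<lambda>x. jet \<phi> x - w x)"
    using Lp_integral_scaleR[where c=c and w="\<lambda>x. jet \<phi> x - w x"]
    by (simp add: jet_cmult[OF \<phi>(1)] C_def flip: scaleR_diff_right)
  also have "\<dots> \<le> C * (e / (C + 1))" using \<phi>(2) C by (intro mult_left_mono) auto
  also have "\<dots> < e" using e C by (simp add: field_simps)
  finally show "\<exists>\<phi>. test_function \<Omega> \<phi> \<and> Lp_integral p \<Omega> (\<lambda>x. jet \<phi> x - c *\<^sub>R w x) < e"
    using test_function_cmult[OF \<phi>(1)] by blast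
qed

lemma Sob_diff: "w \<in> Sob p \<Omega> \<Longrightarrow> v \<in> Sob p \<Omega> \<Longrightarrow> (\<lambda>x. w x - v x) \<in> Sob p \<Omega>"
  using Sob_add[OF _ Sob_scaleR, of w v "-1"] by simp

lemma Lp_pairing_integrable:
  fixes f u :: "'a \<Rightarrow> real"
  assumes "f \<in> Lp q \<Omega>" "u \<in> Lp p \<Omega>"
  shows "integrable M (\<lambda>x. f x * u x)"
proof -
  obtain C where C: "\<And>a b. \<bar>a * b\<bar> \<le> 1 * \<bar>a\<bar> powr q + C * \<bar>b\<bar> powr p"
    by (rule Young_eps[OF p q pq zero_less_one]) blast
  have "integrable M (\<lambda>x. 1 * norm (f x) powr q + C * norm (u x) powr p)"
    by (intro Bochner_Integration.integrable_add integrable_mult_right Lp_integrable assms)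
  then show ?thesis
  proof (rule Bochner_Integration.integrable_bound)
    show "(\<lambda>x. f x * u x) \<in> borel_measurable M"
      by (intro borel_measurable_times Lp_measurable[OF assms(1)] Lp_measurable[OF assms(2)])
    show "AE x in M. norm (f x * u x) \<le> norm (1 * norm (f x) powr q + C * norm (u x) powr p)"
    proof (rule AE_I2)
      fix x
      show "norm (f x * u x) \<le> norm (1 * norm (f x) powr q + C * norm (u x) powr p)"
        using C[of "f x" "u x"] unfolding real_norm_def by linarith
    qed
  qed
qed

lemma Lp_pairing_le:
  fixes f u :: "'a \<Rightarrow> real"
  assumes f: "f \<in> Lp q \<Omega>" and u: "u \<in> Lp p \<Omega>"
    and AB: "\<And>a b. \<bar>a * b\<bar> \<le> A * \<bar>a\<bar> powr q + B * \<bar>b\<bar> powr p"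
  shows "\<bar>LINT x|M. f x * u x\<bar> \<le> A * Lp_integral q \<Omega> f + B * Lp_integral p \<Omega> u"
proof -
  have "\<bar>LINT x|M. f x * u x\<bar> \<le> (LINT x|M. \<bar>f x * u x\<bar>)" by (rule integral_abs_bound)
  also have "\<dots> \<le> (LINT x|M. A * norm (f x) powr q + B * norm (u x) powr p)"
    unfolding real_norm_def
    by (intro integral_mono integrable_abs Lp_pairing_integrable f u Bochner_Integration.integrable_add
        integrable_mult_right Lp_integrable[OF f, unfolded real_norm_def] Lp_integrable[OF u, unfolded real_norm_def] AB)
  also have "\<dots> = A * Lp_integral q \<Omega> f + B * Lp_integral p \<Omega> u"
    using Lp_integrable[OF f] Lp_integrable[OF u] by simp
  finally show ?thesis .
qed

text \<open>Young's inequality with a small weight on the fixed factor \<open>f\<close> plays the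
  part of Hoelder's inequality: the share of \<open>f\<close> is below e, and the share of the
  difference tends to 0.\<close>

lemma Lp_pairing_tendsto:
  fixes f u :: "'a \<Rightarrow> real"
  assumes f: "f \<in> Lp q \<Omega>" and u: "\<And>k. U k \<in> Lp p \<Omega>" "u \<in> Lp p \<Omega>"
    and lim: "(\<lambda>k::nat. Lp_integral p \<Omega> (\<lambda>x. U k x - u x)) \<longlonglongrightarrow> 0"
  shows "(\<lambda>k. LINT x|M. f x * U k x) \<longlonglongrightarrow> (LINT x|M. f x * u x)"
proof (rule LIMSEQ_I)
  fix e :: real assume e: "0 < e"
  define F where "F = Lp_integral q \<Omega> f"
  define \<delta> where "\<delta> = e / (2 * (F + 1))"
  have F: "0 \<le> F" unfolding F_def by (rule Lp_integral_nonneg)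
  have \<delta>: "0 < \<delta>" using e F by (simp add: \<delta>_def)
  have "\<delta> * F \<le> \<delta> * (F + 1)" using \<delta> by (intro mult_left_mono) auto
  also have "\<dots> = e / 2"
  proof -
    have "e / (2 * c) * c = e / 2" if "0 < c" for c using that by simp
    then show ?thesis using add_nonneg_pos[OF F zero_less_one] unfolding \<delta>_def .
  qed
  finally have \<delta>F: "\<delta> * F < e" using e by simp
  obtain C where C: "\<And>a b. \<bar>a * b\<bar> \<le> \<delta> * \<bar>a\<bar> powr q + C * \<bar>b\<bar> powr p"
    by (rule Young_eps[OF p q pq \<delta>]) blast
  have diff: "\<bar>(LINT x|M. f x * U k x) - (LINT x|M. f x * u x)\<bar>
      \<le> \<delta> * F + C * Lp_integral p \<Omega> (\<lambda>x. U k x - u x)" for k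
  proof -
    have "(LINT x|M. f x * U k x) - (LINT x|M. f x * u x) = (LINT x|M. f x * (U k x - u x))"
      using Lp_pairing_integrable[OF f u(1)] Lp_pairing_integrable[OF f u(2)]
      by (simp add: right_diff_distrib)
    then show ?thesis using Lp_pairing_le[OF f Lp_diff[OF p0(1) u] C] by (simp add: F_def)
  qed
  have "(\<lambda>k. \<delta> * F + C * Lp_integral p \<Omega> (\<lambda>x. U k x - u x)) \<longlonglongrightarrow> \<delta> * F + C * 0"
    by (intro tendsto_intros lim)
  then have "\<forall>\<^sub>F k in sequentially. \<delta> * F + C * Lp_integral p \<Omega> (\<lambda>x. U k x - u x) < e"
    by (rule order_tendstoD(2)) (use \<delta>F in simp)
  then have "\<forall>\<^sub>F k in sequentially. \<bar>(LINT x|M. f x * U k x) - (LINT x|M. f x * u x)\<bar> < e"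
    by (rule eventually_mono) (rule le_less_trans[OF diff])
  then show "\<exists>no. \<forall>k\<ge>no. norm ((LINT x|M. f x * U k x) - (LINT x|M. f x * u x)) < e"
    unfolding eventually_sequentially real_norm_def .
qed

end

lemma continuous_on_norm_powr:
  "0 < p \<Longrightarrow> continuous_on UNIV (\<lambda>x::'b::real_normed_vector. norm x powr p)"
  by (rule continuous_on_powr') (auto intro!: continuous_intros)

section \<open>Weak gradients of pairs and the translation of \<open>W1p0\<close>\<close>

context sobolev begin

text \<open>For t at least 0 one has t <= 1 + t^p, and constants are integrable because the domain
  is bounded.\<close>

lemma Lp_integrable_1:
  fixes w :: "'a \<Rightarrow> 'b::euclidean_space"
  assumes "w \<in> Lp p \<Omega>"
  shows "integrable M w"
proof (rule Bochner_Integration.integrable_bound)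
  show "integrable M (\<lambda>x. 1 + norm (w x) powr p)"
    using Lp_integrable[OF assms] finite_measure_M
    by (intro Bochner_Integration.integrable_add) (auto simp: finite_measure.integrable_const)
  show "AE x in M. norm (w x) \<le> norm (1 + norm (w x) powr p)"
  proof (rule AE_I2)
    fix x
    have "norm (w x) \<le> 1 + norm (w x) powr p"
    proof (cases "norm (w x) \<le> 1")
      case False
      then have "norm (w x) powr 1 \<le> norm (w x) powr p" using p by (intro powr_mono) auto
      then show ?thesis using False by simp
    qed (simp add: add_increasing2)
    then show "norm (w x) \<le> norm (1 + norm (w x) powr p)" by simp
  qed
qed (rule Lp_measurable[OF assms])

lemma Lp_absolutely_integrable:
  fixes w :: "'a \<Rightarrow> 'b::euclidean_space"
  assumes "w \<in> Lp p \<Omega>" "compact K" "K \<subseteq> \<Omega>"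
  shows "w absolutely_integrable_on K"
proof -
  have "integrable lebesgue (\<lambda>x. indicator \<Omega> x *\<^sub>R w x)"
    using Lp_integrable_1[OF assms(1)] open_\<Omega> by (subst (asm) integrable_restrict_space) auto
  then have "w absolutely_integrable_on \<Omega>" by (simp add: set_integrable_def)
  then show ?thesis
    by (rule set_integrable_subset) (use assms in \<open>auto intro: fmeasurableD lmeasurable_compact\<close>)
qed

text \<open>These are the elements of \<open>W1p\<close> together with a gradient. The larger class
  is needed because the difference of a test function and a function of \<open>W1p0\<close> must be
  handled before membership in \<open>Sob\<close> is known.\<close>

definition weak_pair :: "('a \<Rightarrow> real \<times> 'a) \<Rightarrow> bool" where
  "weak_pair w \<longleftrightarrow> w \<in> Lp p \<Omega> \<and> has_weak_gradient \<Omega> (\<lambda>x. fst (w x)) (\<lambda>x. snd (w x))"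

text \<open>The local integrability demanded by \<open>has_weak_gradient\<close> follows from
  membership in \<open>Lp\<close> on a bounded domain; what remains are the integral identities,
  which pass to limits and differences.\<close>

lemma weak_pair_iff:
  "weak_pair w \<longleftrightarrow> w \<in> Lp p \<Omega> \<and> (\<forall>\<psi> b. test_function \<Omega> \<psi> \<longrightarrow> b \<in> Basis \<longrightarrow>
     (LINT x|M. (grad \<psi> x \<bullet> b) * fst (w x)) = - (LINT x|M. \<psi> x * (snd (w x) \<bullet> b)))"
proof (cases "w \<in> Lp p \<Omega>")
  case True
  then show ?thesis
    using Lp_absolutely_integrable[OF Lp_fst_snd(1)[OF p0(1) True]]
      Lp_absolutely_integrable[OF Lp_fst_snd(2)[OF p0(1) True]]
    unfolding weak_pair_def has_weak_gradient_def
    by (simp add: grad_inner mult.commute) blast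
qed (simp add: weak_pair_def)

lemma inner_Lp:
  assumes "w \<in> Lp r \<Omega>" "b \<in> Basis" "0 \<le> r"
  shows "(\<lambda>x. w x \<bullet> b) \<in> Lp r \<Omega>"
proof (rule Lp_bound[of _ _ w r 1])
  show "(\<lambda>x. w x \<bullet> b) \<in> borel_measurable M"
    by (intro borel_measurable_inner Lp_measurable[OF assms(1)] borel_measurable_const)
qed (use assms Basis_le_norm in auto)

lemma Lp_integral_tendsto_mono:
  fixes W :: "nat \<Rightarrow> 'a \<Rightarrow> 'b::euclidean_space" and U :: "nat \<Rightarrow> 'a \<Rightarrow> 'c::euclidean_space"
  assumes lim: "(\<lambda>k. Lp_integral p \<Omega> (\<lambda>x. W k x - w x)) \<longlonglongrightarrow> 0"
    and W: "\<And>k. W k \<in> Lp p \<Omega>" "w \<in> Lp p \<Omega>" and U: "\<And>k. U k \<in> Lp p \<Omega>" "u \<in> Lp p \<Omega>"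
    and le: "\<And>k x. norm (U k x - u x) \<le> norm (W k x - w x)"
  shows "(\<lambda>k. Lp_integral p \<Omega> (\<lambda>x. U k x - u x)) \<longlonglongrightarrow> 0"
proof (rule tendsto_sandwich[OF _ _ tendsto_const lim])
  show "\<forall>\<^sub>F k in sequentially. Lp_integral p \<Omega> (\<lambda>x. U k x - u x) \<le> Lp_integral p \<Omega> (\<lambda>x. W k x - w x)"
    by (intro always_eventually allI Lp_integral_mono Lp_diff p0 W U le)
qed simp

text \<open>Both sides of integration by parts are pairings of an approximating sequence with a
  fixed function in \<open>Lp q\<close>, so they converge along the approximating test
  functions.\<close>

lemma Sob_weak_pair:
  assumes w: "w \<in> Sob p \<Omega>"
  shows "weak_pair w"
  unfolding weak_pair_iff
proof (intro conjI allI impI)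
  show wL: "w \<in> Lp p \<Omega>" using w by (rule Sob_Lp)
  fix \<psi> and b :: 'a assume \<psi>: "test_function \<Omega> \<psi>" and b: "b \<in> Basis"
  obtain \<phi> where \<phi>: "\<And>k::nat. test_function \<Omega> (\<phi> k)"
    and lim: "(\<lambda>k. Lp_integral p \<Omega> (\<lambda>x. jet (\<phi> k) x - w x)) \<longlonglongrightarrow> 0"
    using w by (auto simp: Sob_def)
  have jL: "jet (\<phi> k) \<in> Lp p \<Omega>" for k using \<phi> p0(1) by (rule jet_Lp)
  have q0: "0 \<le> q" using q by simp
  have lim1: "(\<lambda>k. Lp_integral p \<Omega> (\<lambda>x. \<phi> k x - fst (w x))) \<longlonglongrightarrow> 0"
  proof (rule Lp_integral_tendsto_mono[OF lim jL wL])
    show "norm (\<phi> k x - fst (w x)) \<le> norm (jet (\<phi> k) x - w x)" for k x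
      using norm_fst_le_norm[of "jet (\<phi> k) x - w x"] by (simp add: jet_def)
  qed (use test_Lp(1)[OF \<phi> p0(1)] Lp_fst_snd(1)[OF p0(1) wL] in auto)
  have lim2: "(\<lambda>k. Lp_integral p \<Omega> (\<lambda>x. grad (\<phi> k) x \<bullet> b - snd (w x) \<bullet> b)) \<longlonglongrightarrow> 0"
  proof (rule Lp_integral_tendsto_mono[OF lim jL wL])
    show "norm (grad (\<phi> k) x \<bullet> b - snd (w x) \<bullet> b) \<le> norm (jet (\<phi> k) x - w x)" for k x
      using norm_snd_le_norm[of "jet (\<phi> k) x - w x"] Basis_le_norm[OF b, of "grad (\<phi> k) x - snd (w x)"]
      by (simp add: jet_def inner_diff_left)
  qed (use inner_Lp[OF test_Lp(2)[OF \<phi> p0(1)] b p0(1)] inner_Lp[OF Lp_fst_snd(2)[OF p0(1) wL] b p0(1)] in auto)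
  have "(\<lambda>k. LINT x|M. (grad \<psi> x \<bullet> b) * \<phi> k x) \<longlonglongrightarrow> (LINT x|M. (grad \<psi> x \<bullet> b) * fst (w x))"
    by (rule Lp_pairing_tendsto[OF inner_Lp[OF test_Lp(2)[OF \<psi> q0] b q0] test_Lp(1)[OF \<phi> p0(1)]
        Lp_fst_snd(1)[OF p0(1) wL] lim1])
  moreover have "(LINT x|M. (grad \<psi> x \<bullet> b) * \<phi> k x) = - (LINT x|M. \<psi> x * (grad (\<phi> k) x \<bullet> b))" for k
    using test_function_integral_by_parts[OF open_\<Omega> \<phi> \<psi> b, of k]
    by (simp add: grad_inner[OF b] mult.commute)
  moreover have "(\<lambda>k. - (LINT x|M. \<psi> x * (grad (\<phi> k) x \<bullet> b))) \<longlonglongrightarrow> - (LINT x|M. \<psi> x * (snd (w x) \<bullet> b))"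
    by (intro tendsto_minus Lp_pairing_tendsto[OF test_Lp(1)[OF \<psi> q0] inner_Lp[OF test_Lp(2)[OF \<phi> p0(1)] b p0(1)]
        inner_Lp[OF Lp_fst_snd(2)[OF p0(1) wL] b p0(1)] lim2])
  ultimately show "(LINT x|M. (grad \<psi> x \<bullet> b) * fst (w x)) = - (LINT x|M. \<psi> x * (snd (w x) \<bullet> b))"
    using LIMSEQ_unique by simp
qed

lemma weak_pair_diff:
  assumes w: "weak_pair w" and v: "weak_pair v"
  shows "weak_pair (\<lambda>x. w x - v x)"
  unfolding weak_pair_iff
proof (intro conjI allI impI)
  have L: "w \<in> Lp p \<Omega>" "v \<in> Lp p \<Omega>" using w v by (auto simp: weak_pair_def)
  then show "(\<lambda>x. w x - v x) \<in> Lp p \<Omega>" using p0 by (intro Lp_diff)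
  fix \<psi> and b :: 'a assume \<psi>: "test_function \<Omega> \<psi>" and b: "b \<in> Basis"
  have q0: "0 \<le> q" using q by simp
  have int: "integrable M (\<lambda>x. (grad \<psi> x \<bullet> b) * fst (z x))" "integrable M (\<lambda>x. \<psi> x * (snd (z x) \<bullet> b))"
    if "z \<in> Lp p \<Omega>" for z :: "'a \<Rightarrow> real \<times> 'a"
    by (intro Lp_pairing_integrable inner_Lp test_Lp \<psi> b q0 p0 Lp_fst_snd that)+
  have e: "(LINT x|M. (grad \<psi> x \<bullet> b) * fst (z x)) = - (LINT x|M. \<psi> x * (snd (z x) \<bullet> b))" if "weak_pair z" for z
    using that \<psi> b unfolding weak_pair_iff by blast
  show "(LINT x|M. (grad \<psi> x \<bullet> b) * fst (w x - v x)) = - (LINT x|M. \<psi> x * (snd (w x - v x) \<bullet> b))"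
    using int[OF L(1)] int[OF L(2)] e[OF w] e[OF v]
    by (simp add: right_diff_distrib inner_diff_left)
qed

text \<open>Completeness of Lebesgue measure. It makes the chosen weak gradient measurable, although
  that gradient is known only up to a null set.\<close>

lemma borel_measurable_M_AE:
  fixes f g :: "'a \<Rightarrow> 'b::euclidean_space"
  assumes f: "f \<in> borel_measurable M" and ae: "AE x in M. f x = g x"
  shows "g \<in> borel_measurable M"
proof -
  have \<Omega>: "\<Omega> \<in> sets lebesgue" using open_\<Omega> by auto
  have "(\<lambda>x. if x \<in> \<Omega> then f x else 0) \<in> borel_measurable lebesgue"
    using f by (simp add: borel_measurable_if[OF \<Omega>])
  moreover have "AE x in lebesgue. (if x \<in> \<Omega> then f x else 0) = (if x \<in> \<Omega> then g x else 0)"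
    using ae \<Omega> by (subst (asm) AE_restrict_space_iff) (auto elim!: eventually_mono)
  ultimately have "(\<lambda>x. if x \<in> \<Omega> then g x else 0) \<in> borel_measurable lebesgue"
    by (rule borel_measurable_AE)
  then show ?thesis by (simp add: borel_measurable_if[OF \<Omega>])
qed

lemma weak_pair_gradient:
  assumes "weak_pair w"
  shows "AE x in M. weak_gradient \<Omega> (\<lambda>x. fst (w x)) x = snd (w x)"
    "weak_gradient \<Omega> (\<lambda>x. fst (w x)) \<in> borel_measurable M"
proof -
  have g: "has_weak_gradient \<Omega> (\<lambda>x. fst (w x)) (\<lambda>x. snd (w x))" "w \<in> Lp p \<Omega>"
    using assms by (auto simp: weak_pair_def)
  have "has_weak_gradient \<Omega> (\<lambda>x. fst (w x)) (weak_gradient \<Omega> (\<lambda>x. fst (w x)))"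
    unfolding weak_gradient_def by (rule someI[where P="has_weak_gradient \<Omega> (\<lambda>x. fst (w x))", OF g(1)])
  from weak_gradient_unique[OF open_\<Omega> this g(1)]
  show ae: "AE x in M. weak_gradient \<Omega> (\<lambda>x. fst (w x)) x = snd (w x)" .
  show "weak_gradient \<Omega> (\<lambda>x. fst (w x)) \<in> borel_measurable M"
    by (rule borel_measurable_M_AE[OF borel_measurable_fst_snd(2)[OF Lp_measurable[OF g(2)]]])
      (use ae in \<open>auto elim!: eventually_mono\<close>)
qed

text \<open>This removes the chosen gradient from the norm and from both energies in favour of the
  second component of the pair.\<close>

lemma integral_weak_gradient:
  assumes "weak_pair w" "continuous_on UNIV F"
  shows "(LINT x|M. F (weak_gradient \<Omega> (\<lambda>x. fst (w x)) x)) = (LINT x|M. F (snd (w x)) :: real)"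
proof (rule integral_cong_AE)
  have m: "(\<lambda>x. snd (w x)) \<in> borel_measurable M"
    using assms(1) by (intro borel_measurable_fst_snd Lp_measurable) (auto simp: weak_pair_def)
  show "(\<lambda>x. F (weak_gradient \<Omega> (\<lambda>x. fst (w x)) x)) \<in> borel_measurable M"
    "(\<lambda>x. F (snd (w x))) \<in> borel_measurable M"
    using borel_measurable_continuous_on[OF assms(2)] m weak_pair_gradient(2)[OF assms(1)] by auto
  show "AE x in M. F (weak_gradient \<Omega> (\<lambda>x. fst (w x)) x) = F (snd (w x))"
    using weak_pair_gradient(1)[OF assms(1)] by eventually_elim simp
qed

lemma W1p_norm_weak_pair:
  assumes "weak_pair w"
  shows "W1p_norm p \<Omega> (\<lambda>x. fst (w x)) =
    (Lp_integral p \<Omega> (\<lambda>x. fst (w x)) + Lp_integral p \<Omega> (\<lambda>x. snd (w x))) powr (1 / p)"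
proof -
  have "(LINT x|M. norm (weak_gradient \<Omega> (\<lambda>x. fst (w x)) x) powr p) = Lp_integral p \<Omega> (\<lambda>x. snd (w x))"
    by (rule integral_weak_gradient[OF assms continuous_on_norm_powr[OF p0(2)]])
  then show ?thesis by (simp add: W1p_norm_def)
qed

text \<open>The sum of the two component integrals and the integral of the pair are comparable up to
  constants, and the powers p and 1/p preserve convergence to 0.\<close>

lemma W1p_norm_tendsto_iff:
  fixes F :: "'i filter"
  assumes "\<And>k. weak_pair (W k)"
  shows "((\<lambda>k. W1p_norm p \<Omega> (\<lambda>x. fst (W k x))) \<longlongrightarrow> 0) F \<longleftrightarrow>
    ((\<lambda>k. Lp_integral p \<Omega> (W k)) \<longlongrightarrow> 0) F"
proof -
  define S where "S k = Lp_integral p \<Omega> (\<lambda>x. fst (W k x)) + Lp_integral p \<Omega> (\<lambda>x. snd (W k x))" for k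
  have L: "W k \<in> Lp p \<Omega>" for k using assms by (auto simp: weak_pair_def)
  have S: "0 \<le> S k" "S k \<le> 2 * Lp_integral p \<Omega> (W k)" "Lp_integral p \<Omega> (W k) \<le> 2 powr p * S k" for k
  proof -
    show "0 \<le> S k" unfolding S_def by (intro add_nonneg_nonneg Lp_integral_nonneg)
    show "S k \<le> 2 * Lp_integral p \<Omega> (W k)" "Lp_integral p \<Omega> (W k) \<le> 2 powr p * S k"
      using Lp_integral_fst_snd[OF p0(1) L[of k]] unfolding S_def by linarith+
  qed
  have norm_eq: "W1p_norm p \<Omega> (\<lambda>x. fst (W k x)) = S k powr (1 / p)" for k
    unfolding S_def by (rule W1p_norm_weak_pair[OF assms])
  show ?thesis unfolding norm_eq
  proof
    assume "((\<lambda>k. S k powr (1 / p)) \<longlongrightarrow> 0) F"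
    then have "((\<lambda>k. (S k powr (1 / p)) powr p) \<longlongrightarrow> 0) F"
      by (rule tendsto_zero_powrI[OF _ tendsto_const]) (use p0 in auto)
    then have "((\<lambda>k. S k) \<longlongrightarrow> 0) F" using p0 S(1) by (simp add: powr_powr)
    then have "((\<lambda>k. 2 powr p * S k) \<longlongrightarrow> 0) F" using tendsto_mult_right_zero by blast
    from tendsto_sandwich[OF _ _ tendsto_const this]
    show "((\<lambda>k. Lp_integral p \<Omega> (W k)) \<longlongrightarrow> 0) F"
      using S(3) by simp
  next
    assume "((\<lambda>k. Lp_integral p \<Omega> (W k)) \<longlongrightarrow> 0) F"
    then have "((\<lambda>k. 2 * Lp_integral p \<Omega> (W k)) \<longlongrightarrow> 0) F" using tendsto_mult_right_zero by blast
    from tendsto_sandwich[OF _ _ tendsto_const this]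
    have "(S \<longlongrightarrow> 0) F" using S(1,2) by simp
    then show "((\<lambda>k. S k powr (1 / p)) \<longlongrightarrow> 0) F"
      by (rule tendsto_zero_powrI[OF _ tendsto_const]) (use p0 S in auto)
  qed
qed

text \<open>In both directions the differences between test functions and the given function are
  weak pairs, so their Sobolev norm, which involves chosen gradients, may be measured on the pairs
  instead.\<close>

proposition W1p0_iff: "u \<in> W1p0 p \<Omega> \<longleftrightarrow> (\<exists>w\<in>Sob p \<Omega>. u = (\<lambda>x. fst (w x)))"
proof
  assume u: "u \<in> W1p0 p \<Omega>"
  then obtain g where g: "u \<in> Lp p \<Omega>" "g \<in> Lp p \<Omega>" "has_weak_gradient \<Omega> u g"
    by (auto simp: W1p0_def W1p_def)
  obtain \<phi> where \<phi>: "\<And>k::nat. test_function \<Omega> (\<phi> k)" 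
    and lim: "(\<lambda>k. W1p_norm p \<Omega> (\<lambda>x. \<phi> k x - u x)) \<longlonglongrightarrow> 0"
    using u by (auto simp: W1p0_def)
  define w where "w x = (u x, g x)" for x
  have w: "weak_pair w" using Lp_Pair[OF p0(1) g(1,2)] g(3) by (simp add: weak_pair_def w_def[abs_def])
  have d: "weak_pair (\<lambda>x. jet (\<phi> k) x - w x)" for k
    by (rule weak_pair_diff[OF Sob_weak_pair[OF Sob_jet[OF \<phi>]] w])
  have "(\<lambda>k. Lp_integral p \<Omega> (\<lambda>x. jet (\<phi> k) x - w x)) \<longlonglongrightarrow> 0"
    using lim by (subst W1p_norm_tendsto_iff[OF d, symmetric]) (simp add: jet_def w_def)
  then have "w \<in> Sob p \<Omega>" using w \<phi> by (auto simp: Sob_def weak_pair_def)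
  moreover have "u = (\<lambda>x. fst (w x))" by (simp add: w_def)
  ultimately show "\<exists>w\<in>Sob p \<Omega>. u = (\<lambda>x. fst (w x))" by blast
next
  assume "\<exists>w\<in>Sob p \<Omega>. u = (\<lambda>x. fst (w x))"
  then obtain w where w: "w \<in> Sob p \<Omega>" and u: "u = (\<lambda>x. fst (w x))" by blast
  obtain \<phi> where \<phi>: "\<And>k::nat. test_function \<Omega> (\<phi> k)" 
    and lim: "(\<lambda>k. Lp_integral p \<Omega> (\<lambda>x. jet (\<phi> k) x - w x)) \<longlonglongrightarrow> 0"
    using w by (auto simp: Sob_def)
  have d: "weak_pair (\<lambda>x. jet (\<phi> k) x - w x)" for k
    by (rule weak_pair_diff[OF Sob_weak_pair[OF Sob_jet[OF \<phi>]] Sob_weak_pair[OF w]])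
  have "(\<lambda>k. W1p_norm p \<Omega> (\<lambda>x. fst (jet (\<phi> k) x - w x))) \<longlonglongrightarrow> 0"
    using lim by (subst W1p_norm_tendsto_iff[OF d])
  then have "(\<lambda>k. W1p_norm p \<Omega> (\<lambda>x. \<phi> k x - u x)) \<longlonglongrightarrow> 0" by (simp add: jet_def u)
  moreover have "u \<in> W1p p \<Omega>"
    using Sob_weak_pair[OF w] Lp_fst_snd[OF p0(1) Sob_Lp[OF w]] by (auto simp: W1p_def weak_pair_def u)
  ultimately show "u \<in> W1p0 p \<Omega>" using \<phi> by (auto simp: W1p0_def)
qed

end

section \<open>The Poincare inequality\<close>

lemma has_real_derivative_abs_powr:
  assumes "1 < p"
  shows "((\<lambda>t. \<bar>t\<bar> powr p) has_real_derivative p * (\<bar>t\<bar> powr (p - 1) * sgn t)) (at t)"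
proof -
  consider "t > 0" | "t < 0" | "t = 0" by linarith
  then show ?thesis
  proof cases
    case 1
    have "((\<lambda>t. t powr p) has_real_derivative p * (\<bar>t\<bar> powr (p - 1) * sgn t)) (at t)"
      using 1 by (auto intro!: derivative_eq_intros)
    then show ?thesis
      by (rule has_field_derivative_transform_within_open[of _ _ _ "{0<..}"]) (use 1 in auto)
  next
    case 2
    have "((\<lambda>t. (- t) powr p) has_real_derivative p * (\<bar>t\<bar> powr (p - 1) * sgn t)) (at t)"
      using 2 by (auto intro!: derivative_eq_intros)
    then show ?thesis
      by (rule has_field_derivative_transform_within_open[of _ _ _ "{..<0}"]) (use 2 in auto)
  next
    case 3
    \<comment> \<open>Here p > 1 enters: the difference quotient at 0 is bounded by |h|^(p -
      1).\<close>
    have "((\<lambda>h. \<bar>h\<bar> powr (p - 1)) \<longlongrightarrow> 0) (at (0::real))"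
      by (rule tendsto_zero_powrI[OF _ tendsto_const])
        (use assms in \<open>auto intro!: tendsto_rabs_zero tendsto_ident_at\<close>)
    then have "((\<lambda>h. \<bar>h\<bar> powr p / h) \<longlongrightarrow> 0) (at (0::real))"
    proof (rule Lim_null_comparison[rotated])
      have "norm (\<bar>h\<bar> powr p / h) \<le> \<bar>h\<bar> powr (p - 1)" if "h \<noteq> 0" for h :: real
      proof -
        have "\<bar>h\<bar> powr p = \<bar>h\<bar> powr (p - 1) * \<bar>h\<bar>" 
          using that powr_add[of "\<bar>h\<bar>" "p - 1" 1] by simp
        then show ?thesis using that by (simp add: abs_mult)
      qed
      then show "\<forall>\<^sub>F h in at (0::real). norm (\<bar>h\<bar> powr p / h) \<le> \<bar>h\<bar> powr (p - 1)"
        by (auto simp: eventually_at_filter)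
    qed
    then show ?thesis using 3 by (simp add: DERIV_def)
  qed
qed

text \<open>The jump of \<open>sgn\<close> at 0 is killed by the positive power. With r = p - 1 this
  is the derivative of |t|^p up to the factor p, also when p - 1 is below 1.\<close>

lemma continuous_on_abs_powr_sgn:
  assumes "0 < r"
  shows "continuous_on UNIV (\<lambda>t::real. \<bar>t\<bar> powr r * sgn t)"
proof -
  have "isCont (\<lambda>t::real. \<bar>t\<bar> powr r * sgn t) t" for t
  proof (cases "t = 0")
    case False
    then show ?thesis by (intro continuous_intros) auto
  next
    case True
    have *: "((\<lambda>h. \<bar>h\<bar> powr r) \<longlongrightarrow> 0) (at (0::real))"
      by (rule tendsto_zero_powrI[OF _ tendsto_const])
        (use assms in \<open>auto intro!: tendsto_rabs_zero tendsto_ident_at\<close>)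
    have "((\<lambda>h. \<bar>h\<bar> powr r * sgn h) \<longlongrightarrow> 0) (at (0::real))"
      by (rule Lim_null_comparison[OF _ *]) (auto simp: abs_mult sgn_if)
    then show ?thesis using True by (simp add: isCont_def)
  qed
  then show ?thesis by (simp add: continuous_at_imp_continuous_on)
qed

context sobolev begin

text \<open>Integrate the divergence of \<open>\<bar>\<phi>\<bar>\<^sup>p (x \<bullet> b) b\<close>.\<close>

lemma Poincare_test:
  obtains C where "0 \<le> C"
    "\<And>\<phi>. test_function \<Omega> \<phi> \<Longrightarrow> Lp_integral p \<Omega> \<phi> \<le> C * Lp_integral p \<Omega> (grad \<phi>)"
proof -
  obtain b :: 'a where b: "b \<in> Basis" using nonempty_Basis by blast
  obtain R where R: "R > 0" "\<And>x. x \<in> \<Omega> \<Longrightarrow> norm x \<le> R"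
    using bounded_\<Omega> by (auto simp: bounded_pos)
  \<comment> \<open>Chosen so that p R \<delta> = 1/2: half of the integral of |\<phi>|^p remains on
    the left after absorption.\<close>
  define \<delta> where "\<delta> = 1 / (2 * p * R)"
  have \<delta>: "0 < \<delta>" using p R by (simp add: \<delta>_def)
  obtain C where C: "0 \<le> C" "\<And>a b. \<bar>a * b\<bar> \<le> \<delta> * \<bar>a\<bar> powr q + C * \<bar>b\<bar> powr p"
    by (rule Young_eps[OF p q pq \<delta>]) blast
  have main: "Lp_integral p \<Omega> \<phi> \<le> (2 * p * R * C) * Lp_integral p \<Omega> (grad \<phi>)"
    if \<phi>: "test_function \<Omega> \<phi>" for \<phi>
  proof -
    obtain K where K: "compact K" "K \<subseteq> \<Omega>" "\<And>x. x \<notin> K \<Longrightarrow> \<phi> x = 0" "\<And>x. x \<notin> K \<Longrightarrow> grad \<phi> x = 0"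
      using test_function_support[OF \<phi>] by metis
    \<comment> \<open>\<open>s\<close> is the derivative of |t|^p at t = \<phi> x, and
      \<open>G\<close> below is the gradient of (x . b) |\<phi>|^p.\<close>
    define s where "s x = p * (\<bar>\<phi> x\<bar> powr (p - 1) * sgn (\<phi> x))" for x
    define G where "G x = \<bar>\<phi> x\<bar> powr p *\<^sub>R b + ((x \<bullet> b) * s x) *\<^sub>R grad \<phi> x" for x
    have cs: "continuous_on UNIV s"
      unfolding s_def using p
      by (intro continuous_intros continuous_on_compose2[OF continuous_on_abs_powr_sgn test_functionD(3)[OF \<phi>]]) auto
    have cG: "continuous_on UNIV G"
      unfolding G_def using p0
      by (intro continuous_intros continuous_on_powr' cs test_functionD[OF \<phi>]) auto
    have zero: "(LINT x|lborel. G x \<bullet> b) = 0"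
    proof (rule integral_partial_derivative_eq_0[where h="\<lambda>x. (x \<bullet> b) * \<bar>\<phi> x\<bar> powr p" and K=K])
      fix x
      have "((\<lambda>x. \<bar>\<phi> x\<bar> powr p) has_derivative (\<lambda>y. (grad \<phi> x \<bullet> y) * s x)) (at x)"
        unfolding s_def by (rule DERIV_compose_FDERIV[OF has_real_derivative_abs_powr[OF p] test_functionD(5)[OF \<phi>]])
      moreover have "((\<lambda>x. x \<bullet> b) has_derivative (\<lambda>y. y \<bullet> b)) (at x)"
        by (auto intro!: derivative_eq_intros)
      ultimately have "((\<lambda>x. (x \<bullet> b) * \<bar>\<phi> x\<bar> powr p) has_derivative
          (\<lambda>y. (x \<bullet> b) * ((grad \<phi> x \<bullet> y) * s x) + (y \<bullet> b) * \<bar>\<phi> x\<bar> powr p)) (at x)"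
        by (intro has_derivative_mult)
      then show "((\<lambda>x. (x \<bullet> b) * \<bar>\<phi> x\<bar> powr p) has_derivative (\<lambda>y. G x \<bullet> y)) (at x)"
        by (rule has_derivative_eq_rhs) (auto simp: G_def inner_add_left inner_commute[of b] algebra_simps)
    qed (use cG K compact_imp_bounded in auto)
    have Gb: "G x \<bullet> b = \<bar>\<phi> x\<bar> powr p + ((x \<bullet> b) * s x) * (grad \<phi> x \<bullet> b)" for x
      using b by (simp add: G_def inner_add_left)
    have G0: "G x \<bullet> b = 0" if "x \<notin> K" for x using K(3)[OF that] by (simp add: Gb s_def)
    have "(\<lambda>x. G x \<bullet> b) \<in> borel_measurable borel"
      by (intro borel_measurable_continuous_onI continuous_intros cG)
    then have "(LINT x|M. G x \<bullet> b) = 0"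
      using integral_lebesgue_on_eq_lborel[OF open_\<Omega>, of "\<lambda>x. G x \<bullet> b"] zero G0 K(2) by auto
    moreover have intG: "integrable M (\<lambda>x. G x \<bullet> b)"
    proof -
      have "integrable lborel (\<lambda>x. G x \<bullet> b)"
        using K by (intro integrable_lborel_compact_support[of _ K] continuous_intros cG) (auto simp: Gb s_def)
      then have "integrable lebesgue (\<lambda>x. G x \<bullet> b)"
        by (rule integrable_completion[THEN iffD2, rotated]) (intro borel_measurable_continuous_onI continuous_intros cG | simp)+
      then have "integrable lebesgue (\<lambda>x. indicator \<Omega> x *\<^sub>R (G x \<bullet> b))"
        using open_\<Omega> by (intro integrable_mult_indicator) auto
      then show ?thesis using open_\<Omega> by (subst integrable_restrict_space) auto
    qed
    moreover have "(LINT x|M. (1/2) * norm (\<phi> x) powr p - p * R * C * norm (grad \<phi> x) powr p) \<le> (LINT x|M. G x \<bullet> b)"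
    proof (rule integral_mono)
      show "integrable M (\<lambda>x. (1/2) * norm (\<phi> x) powr p - p * R * C * norm (grad \<phi> x) powr p)"
        by (intro Bochner_Integration.integrable_diff integrable_mult_right Lp_integrable test_Lp \<phi> p0)
      fix x assume "x \<in> space M"
      then have x: "x \<in> \<Omega>" by simp
      define a where "a = \<bar>\<phi> x\<bar> powr (p - 1)"
      \<comment> \<open>Conjugacy of the exponents in the form (p - 1) q = p turns the Young term
        back into |\<phi>|^p, which can be absorbed.\<close>
      have aq: "a powr q = \<bar>\<phi> x\<bar> powr p"
      proof -
        have "(p - 1) * q = p" using pq p q by (simp add: field_simps)
        then show ?thesis by (simp add: a_def powr_powr)
      qed
      have "\<bar>((x \<bullet> b) * s x) * (grad \<phi> x \<bullet> b)\<bar> \<le> (R * (p * a)) * norm (grad \<phi> x)"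
        unfolding abs_mult
      proof (intro mult_mono)
        show "\<bar>x \<bullet> b\<bar> \<le> R" using Basis_le_norm[OF b, of x] R(2)[OF x] by linarith
        show "\<bar>s x\<bar> \<le> p * a" using p by (simp add: s_def a_def abs_mult sgn_if)
        show "\<bar>grad \<phi> x \<bullet> b\<bar> \<le> norm (grad \<phi> x)" by (rule Basis_le_norm[OF b])
      qed (use R p in \<open>auto simp: a_def\<close>)
      also have "\<dots> = (p * R) * \<bar>a * norm (grad \<phi> x)\<bar>" by (simp add: a_def abs_mult)
      also have "\<dots> \<le> (p * R) * (\<delta> * \<bar>a\<bar> powr q + C * \<bar>norm (grad \<phi> x)\<bar> powr p)"
        using p R by (intro mult_left_mono C) auto
      also have "\<dots> = (1/2) * norm (\<phi> x) powr p + p * R * C * norm (grad \<phi> x) powr p"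
        using p R aq by (simp add: \<delta>_def a_def field_simps)
      finally show "(1/2) * norm (\<phi> x) powr p - p * R * C * norm (grad \<phi> x) powr p \<le> G x \<bullet> b"
        unfolding Gb real_norm_def by linarith
    qed (rule intG)
    ultimately have "(LINT x|M. (1/2) * norm (\<phi> x) powr p - p * R * C * norm (grad \<phi> x) powr p) \<le> 0"
      by linarith
    also have "(LINT x|M. (1/2) * norm (\<phi> x) powr p - p * R * C * norm (grad \<phi> x) powr p)
      = (1/2) * Lp_integral p \<Omega> \<phi> - p * R * C * Lp_integral p \<Omega> (grad \<phi>)"
      using Lp_integrable[OF test_Lp(1)[OF \<phi> p0(1)]] Lp_integrable[OF test_Lp(2)[OF \<phi> p0(1)]] by simp
    finally show ?thesis by simp
  qed
  have "0 \<le> 2 * p * R * C" using p R C by simp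
  then show thesis using that main by blast
qed

text \<open>Both sides are continuous along the approximating test functions. The left side carries
  the whole pair, hence the factor \<open>2 powr p\<close> and C + 1 in place of C.\<close>

proposition Poincare:
  obtains C where "0 \<le> C"
    "\<And>w. w \<in> Sob p \<Omega> \<Longrightarrow> Lp_integral p \<Omega> w \<le> C * Lp_integral p \<Omega> (\<lambda>x. snd (w x))"
proof -
  obtain C where C: "0 \<le> C" "\<And>\<phi>. test_function \<Omega> \<phi> \<Longrightarrow> Lp_integral p \<Omega> \<phi> \<le> C * Lp_integral p \<Omega> (grad \<phi>)"
    by (rule Poincare_test) blast
  have "Lp_integral p \<Omega> w \<le> (2 powr p * (C + 1)) * Lp_integral p \<Omega> (\<lambda>x. snd (w x))"
    if w: "w \<in> Sob p \<Omega>" for w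
  proof -
    obtain \<phi> where \<phi>: "\<And>k::nat. test_function \<Omega> (\<phi> k)" 
      and lim: "(\<lambda>k. Lp_integral p \<Omega> (\<lambda>x. jet (\<phi> k) x - w x)) \<longlonglongrightarrow> 0"
      using w by (auto simp: Sob_def)
    have wL: "w \<in> Lp p \<Omega>" using w by (rule Sob_Lp)
    have jL: "jet (\<phi> k) \<in> Lp p \<Omega>" for k using \<phi> p0(1) by (rule jet_Lp)
    have gL: "(\<lambda>x. grad (\<phi> k) x) \<in> Lp p \<Omega>" for k by (rule test_Lp[OF \<phi> p0(1)])
    have "(\<lambda>k. Lp_integral p \<Omega> (\<lambda>x. grad (\<phi> k) x - snd (w x))) \<longlonglongrightarrow> 0"
    proof (rule Lp_integral_tendsto_mono[OF lim jL wL gL Lp_fst_snd(2)[OF p0(1) wL]])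
      show "norm (grad (\<phi> k) x - snd (w x)) \<le> norm (jet (\<phi> k) x - w x)" for k x
        using norm_snd_le_norm[of "jet (\<phi> k) x - w x"] by (simp add: jet_def)
    qed
    then have "(\<lambda>k. Lp_integral p \<Omega> (grad (\<phi> k))) \<longlonglongrightarrow> Lp_integral p \<Omega> (\<lambda>x. snd (w x))"
      by (rule Lp_integral_tendsto[OF p0(2) gL Lp_fst_snd(2)[OF p0(1) wL]])
    then have "(\<lambda>k. (2 powr p * (C + 1)) * Lp_integral p \<Omega> (grad (\<phi> k)))
        \<longlonglongrightarrow> (2 powr p * (C + 1)) * Lp_integral p \<Omega> (\<lambda>x. snd (w x))"
      by (rule tendsto_mult_left)
    moreover have "(\<lambda>k. Lp_integral p \<Omega> (jet (\<phi> k))) \<longlonglongrightarrow> Lp_integral p \<Omega> w"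
      by (rule Lp_integral_tendsto[OF p0(2) jL wL lim])
    moreover have "Lp_integral p \<Omega> (jet (\<phi> k)) \<le> (2 powr p * (C + 1)) * Lp_integral p \<Omega> (grad (\<phi> k))" for k
    proof -
      have "Lp_integral p \<Omega> (jet (\<phi> k)) \<le> 2 powr p * (Lp_integral p \<Omega> (\<phi> k) + Lp_integral p \<Omega> (grad (\<phi> k)))"
        using Lp_integral_fst_snd(3)[OF p0(1) jL[of k]] by (simp add: jet_def)
      also have "\<dots> \<le> 2 powr p * (C * Lp_integral p \<Omega> (grad (\<phi> k)) + Lp_integral p \<Omega> (grad (\<phi> k)))"
        by (intro mult_left_mono add_right_mono C(2) \<phi>) simp
      finally show ?thesis by (simp add: distrib_right mult.assoc)
    qed
    ultimately show ?thesis using LIMSEQ_le by blast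
  qed
  then show thesis using that[of "2 powr p * (C + 1)"] C(1) by simp
qed

end

section \<open>Strict convexity and lattice operations\<close>

text \<open>The mean value theorem on the two halves compares slopes at points y < z, and the
  derivative of t^p increases strictly. Working with |t|^p keeps the function differentiable at the
  endpoint 0.\<close>

lemma powr_midpoint_less:
  fixes a b p :: real
  assumes "1 < p" "0 \<le> a" "a < b"
  shows "((a + b) / 2) powr p < (a powr p + b powr p) / 2"
proof -
  define m where "m = (a + b) / 2"
  have m: "a < m" "m < b" using assms by (auto simp: m_def)
  note der = has_real_derivative_abs_powr[OF assms(1)]
  obtain y where y: "a < y" "y < m" "\<bar>m\<bar> powr p - \<bar>a\<bar> powr p = (m - a) * (p * (\<bar>y\<bar> powr (p - 1) * sgn y))"
    using MVT2[OF m(1), of "\<lambda>t. \<bar>t\<bar> powr p", OF der] by auto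
  obtain z where z: "m < z" "z < b" "\<bar>b\<bar> powr p - \<bar>m\<bar> powr p = (b - m) * (p * (\<bar>z\<bar> powr (p - 1) * sgn z))"
    using MVT2[OF m(2), of "\<lambda>t. \<bar>t\<bar> powr p", OF der] by auto
  have "y powr (p - 1) < z powr (p - 1)" using y z assms by (intro powr_less_mono2) auto
  then have "(m - a) * (p * y powr (p - 1)) < (m - a) * (p * z powr (p - 1))"
    using assms m by (intro mult_strict_left_mono) auto
  also have "m - a = b - m" by (simp add: m_def field_simps)
  finally have "(m - a) * (p * y powr (p - 1)) < (b - m) * (p * z powr (p - 1))"
    by (simp add: m_def field_simps)
  then have "m powr p - a powr p < b powr p - m powr p"
    using y z assms m by simp
  then show ?thesis by (simp add: m_def)
qed

definition midpoint_deficit :: "real \<Rightarrow> 'b::euclidean_space \<Rightarrow> 'b \<Rightarrow> real" where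
  "midpoint_deficit p a b = (norm a powr p + norm b powr p) / 2 - norm ((1/2) *\<^sub>R (a + b)) powr p"

text \<open>Two inequalities are chained, the triangle inequality and convexity of t^p. A zero
  deficit makes both equalities: the second gives equal norms, the first gives vectors of the same
  direction.\<close>

lemma midpoint_deficit_nonneg:
  assumes "1 < p"
  shows "0 \<le> midpoint_deficit p a b"
    and "midpoint_deficit p a b = 0 \<Longrightarrow> a = b"
proof -
  have 1: "((norm a + norm b) / 2) powr p \<le> (norm a powr p + norm b powr p) / 2"
    using powr_midpoint_less[OF assms, of "norm a" "norm b"] powr_midpoint_less[OF assms, of "norm b" "norm a"]
    by (cases "norm a" "norm b" rule: linorder_cases) (auto simp: add.commute)
  have 2: "norm ((1/2) *\<^sub>R (a + b)) powr p \<le> ((norm a + norm b) / 2) powr p"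
    using norm_triangle_ineq[of a b] assms by (intro powr_mono2) auto
  show "0 \<le> midpoint_deficit p a b" using 1 2 by (simp add: midpoint_deficit_def)
  assume "midpoint_deficit p a b = 0"
  then have eq: "norm ((1/2) *\<^sub>R (a + b)) powr p = ((norm a + norm b) / 2) powr p"
     "((norm a + norm b) / 2) powr p = (norm a powr p + norm b powr p) / 2"
    using 1 2 by (auto simp: midpoint_deficit_def)
  have nab: "norm a = norm b"
    using powr_midpoint_less[OF assms, of "norm a" "norm b"] powr_midpoint_less[OF assms, of "norm b" "norm a"] eq(2)
    by (cases "norm a" "norm b" rule: linorder_cases) (auto simp: add.commute)
  have "norm ((1/2) *\<^sub>R (a + b)) = (norm a + norm b) / 2"
  proof -
    have "(norm ((1/2) *\<^sub>R (a + b)) powr p) powr (1 / p) = (((norm a + norm b) / 2) powr p) powr (1 / p)"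
      using eq(1) by simp
    then show ?thesis using assms by (simp add: powr_powr)
  qed
  then have "norm (a + b) = norm a + norm b" by simp
  \<comment> \<open>Equality in the triangle inequality characterizes parallel vectors because the
    norm comes from an inner product.\<close>
  then have "norm a *\<^sub>R b = norm b *\<^sub>R a" by (simp add: norm_triangle_eq)
  then show "a = b" using nab by (cases "norm b = 0") auto
qed

text \<open>The deficit is homogeneous of degree p in the pair and vanishes only on the diagonal,
  where the left side vanishes too.\<close>

lemma midpoint_deficit_bound:
  assumes "1 < p" "0 < \<delta>"
  obtains C where "0 \<le> C" "\<And>a b :: 'b::euclidean_space.
    norm (a - b) powr p \<le> \<delta> * (norm a powr p + norm b powr p) + C * midpoint_deficit p a b"
proof -
  \<comment> \<open>Compensates for the factor \<open>2 powr p\<close> between the power of the norm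
    of a pair and the sum of the powers.\<close>
  define \<delta>' where "\<delta>' = \<delta> / 2 powr p"
  have \<delta>': "0 < \<delta>'" "\<delta>' * 2 powr p = \<delta>" using assms by (auto simp: \<delta>'_def)
  have p0: "0 < p" using assms by simp
  obtain C where C: "0 \<le> C" "\<And>z :: 'b \<times> 'b. norm (fst z - snd z) powr p
     \<le> \<delta>' * norm z powr p + C * midpoint_deficit p (fst z) (snd z)"
  proof (rule homogeneous_bound[of "\<lambda>z :: 'b \<times> 'b. norm (fst z - snd z) powr p"
        "\<lambda>z :: 'b \<times> 'b. midpoint_deficit p (fst z) (snd z)" p \<delta>'])
    show "continuous_on UNIV (\<lambda>z :: 'b \<times> 'b. norm (fst z - snd z) powr p)"
      by (rule continuous_on_compose2[OF continuous_on_norm_powr[OF p0]]) (auto intro!: continuous_intros)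
    show "continuous_on UNIV (\<lambda>z :: 'b \<times> 'b. midpoint_deficit p (fst z) (snd z))"
      unfolding midpoint_deficit_def
      by (intro continuous_on_diff continuous_on_divide continuous_on_add continuous_on_const
         continuous_on_compose2[OF continuous_on_norm_powr[OF p0]]) (auto intro!: continuous_intros)
    show "norm (fst (c *\<^sub>R z) - snd (c *\<^sub>R z)) powr p = c powr p * norm (fst z - snd z) powr p"
      if "0 < c" for c :: real and z :: "'b \<times> 'b"
      using that by (simp add: powr_mult flip: scaleR_diff_right)
    show "midpoint_deficit p (fst (c *\<^sub>R z)) (snd (c *\<^sub>R z)) = c powr p * midpoint_deficit p (fst z) (snd z)"
      if "0 < c" for c :: real and z :: "'b \<times> 'b"
    proof -
      have "norm ((1/2) *\<^sub>R (c *\<^sub>R fst z + c *\<^sub>R snd z)) = c * norm ((1/2) *\<^sub>R (fst z + snd z))"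
        using that by (simp flip: scaleR_add_right)
      then show ?thesis using that
        by (simp add: midpoint_deficit_def powr_mult right_diff_distrib distrib_left del: norm_scaleR)
          (simp add: powr_mult)
    qed
  qed (use midpoint_deficit_nonneg[OF assms(1)] \<delta>' p0 in auto)
  have "norm (a - b) powr p \<le> \<delta> * (norm a powr p + norm b powr p) + C * midpoint_deficit p a b" for a b :: 'b
  proof -
    have "\<delta>' * norm (a, b) powr p \<le> \<delta>' * (2 powr p * (norm a powr p + norm b powr p))"
      using norm_prod_powr_le[of p "(a, b)"] \<delta>' p0 by (intro mult_left_mono) auto
    also have "\<dots> = \<delta> * (norm a powr p + norm b powr p)" using \<delta>'(2) by (simp flip: mult.assoc)
    finally show ?thesis using C(2)[of "(a, b)"] by simp
  qed
  then show thesis using that C(1) by blast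
qed

section \<open>A smooth approximation of the absolute value\<close>

lemma one_minus_tanh_square_le:
  fixes x :: real
  shows "1 - (tanh x)\<^sup>2 \<le> 4 / (1 + 2 * \<bar>x\<bar> + 2 * x\<^sup>2)"
proof -
  have c: "0 < cosh x" by (rule cosh_real_pos)
  have "1 - (tanh x)\<^sup>2 = 1 / (cosh x)\<^sup>2"
  proof -
    have "1 - (tanh x)\<^sup>2 = ((cosh x)\<^sup>2 - (sinh x)\<^sup>2) / (cosh x)\<^sup>2"
      using c by (simp add: tanh_def power_divide diff_divide_distrib)
    then show ?thesis by (simp add: cosh_square_eq)
  qed
  \<comment> \<open>Squaring this and expanding exp(2|x|) to second order produces the quadratic
    denominator.\<close>
  moreover have "exp \<bar>x\<bar> / 2 \<le> cosh x"
    by (cases "x \<ge> 0") (auto simp: cosh_field_def)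
  then have "(exp \<bar>x\<bar> / 2)\<^sup>2 \<le> (cosh x)\<^sup>2" by (intro power_mono) auto
  then have "exp (2 * \<bar>x\<bar>) / 4 \<le> (cosh x)\<^sup>2"
    by (simp add: power_divide exp_double)
  moreover have "1 + 2 * \<bar>x\<bar> + (2 * \<bar>x\<bar>)\<^sup>2 / 2 \<le> exp (2 * \<bar>x\<bar>)"
    by (rule exp_lower_Taylor_quadratic) simp
  ultimately have "(1 + 2 * \<bar>x\<bar> + 2 * x\<^sup>2) / 4 \<le> (cosh x)\<^sup>2" by (simp add: power_mult_distrib)
  moreover have "0 < 1 + 2 * \<bar>x\<bar> + 2 * x\<^sup>2" by (intro add_pos_nonneg) auto
  ultimately show ?thesis
    unfolding \<open>1 - (tanh x)\<^sup>2 = 1 / (cosh x)\<^sup>2\<close> using c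
    by (simp add: divide_le_eq le_divide_eq field_simps)
qed

text \<open>The constant bound keeps the derivatives of \<open>soft_abs c\<close> bounded uniformly
  in c; the decay bound yields their pointwise limit away from 0.\<close>

lemma abs_times_one_minus_tanh_square:
  fixes x :: real
  shows "\<bar>x * (1 - (tanh x)\<^sup>2)\<bar> \<le> 2" "x \<noteq> 0 \<Longrightarrow> \<bar>x * (1 - (tanh x)\<^sup>2)\<bar> \<le> 2 / \<bar>x\<bar>"
proof -
  define d where "d = 1 + 2 * \<bar>x\<bar> + 2 * x\<^sup>2"
  have d: "0 < d" unfolding d_def by (intro add_pos_nonneg) auto
  have t: "0 \<le> 1 - (tanh x)\<^sup>2"
    using tanh_real_bounds[of x] by (auto simp: abs_square_le_1 abs_le_iff)
  have le: "\<bar>x * (1 - (tanh x)\<^sup>2)\<bar> \<le> \<bar>x\<bar> * (4 / d)"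
    using one_minus_tanh_square_le[of x] t unfolding abs_mult d_def by (intro mult_left_mono) auto
  have "\<bar>x\<bar> * (4 / d) \<le> 2" using d by (simp add: field_simps) (simp add: d_def)
  then show "\<bar>x * (1 - (tanh x)\<^sup>2)\<bar> \<le> 2" using le by linarith
  assume x: "x \<noteq> 0"
  have "\<bar>x\<bar> * \<bar>x\<bar> * 4 \<le> 2 * d" by (simp add: d_def power2_eq_square flip: abs_mult)
  then have "\<bar>x\<bar> * (4 / d) \<le> 2 / \<bar>x\<bar>" using d x by (simp add: field_simps)
  then show "\<bar>x * (1 - (tanh x)\<^sup>2)\<bar> \<le> 2 / \<bar>x\<bar>" using le by linarith
qed

text \<open>This smoothing of |t| vanishes at 0, so composition preserves compact support, and its
  smoothness comes from the simple derivatives of tanh.\<close>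

definition soft_abs :: "real \<Rightarrow> real \<Rightarrow> real" where
  "soft_abs c t = t * tanh (c * t)"

definition soft_sgn :: "real \<Rightarrow> real \<Rightarrow> real" where
  "soft_sgn c t = tanh (c * t) + c * t * (1 - (tanh (c * t))\<^sup>2)"

lemma soft_abs_has_derivative: "(soft_abs c has_real_derivative soft_sgn c t) (at t)"
  unfolding soft_abs_def[abs_def] soft_sgn_def
  by (auto intro!: derivative_eq_intros simp: algebra_simps)

lemma continuous_soft_sgn: "continuous_on UNIV (soft_sgn c)"
  unfolding soft_sgn_def[abs_def] by (intro continuous_intros) auto

lemma soft_bounds: "\<bar>soft_abs c t\<bar> \<le> \<bar>t\<bar>" "\<bar>soft_sgn c t\<bar> \<le> 3"
proof -
  have t: "\<bar>tanh (c * t)\<bar> \<le> 1"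
    using tanh_real_bounds[of "c * t"] by (auto simp: abs_le_iff)
  then show "\<bar>soft_abs c t\<bar> \<le> \<bar>t\<bar>" by (simp add: soft_abs_def abs_mult mult_left_le)
  show "\<bar>soft_sgn c t\<bar> \<le> 3"
    using t abs_times_one_minus_tanh_square(1)[of "c * t"] unfolding soft_sgn_def by linarith
qed

lemma soft_tendsto:
  shows "(\<lambda>n. soft_sgn (real n) t) \<longlonglongrightarrow> sgn t" "(\<lambda>n. soft_abs (real n) t) \<longlonglongrightarrow> \<bar>t\<bar>"
proof -
  have tanh: "(\<lambda>n. tanh (real n * t)) \<longlonglongrightarrow> sgn t"
  proof -
    have pos: "(\<lambda>n. tanh (real n * s)) \<longlonglongrightarrow> 1" if "0 < s" for s :: real
      by (rule filterlim_compose[OF tanh_real_at_top])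
        (use that in \<open>auto intro!: filterlim_at_top_mult_tendsto_pos[OF tendsto_const] filterlim_real_sequentially\<close>)
    consider "t > 0" | "t < 0" | "t = 0" by linarith
    then show ?thesis
    proof cases
      case 2
      then have "(\<lambda>n. - tanh (real n * - t)) \<longlonglongrightarrow> - 1" by (intro tendsto_minus pos) auto
      then show ?thesis using 2 by simp
    qed (use pos in auto)
  qed
  have "(\<lambda>n. real n * t * (1 - (tanh (real n * t))\<^sup>2)) \<longlonglongrightarrow> 0"
  proof (cases "t = 0")
    case False
    have "(\<lambda>n. (2 / \<bar>t\<bar>) * inverse (real n)) \<longlonglongrightarrow> (2 / \<bar>t\<bar>) * 0"
      by (intro tendsto_mult_left lim_inverse_n)
    then have lim: "(\<lambda>n. (2 / \<bar>t\<bar>) * inverse (real n)) \<longlonglongrightarrow> 0" by simp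
    show ?thesis
    proof (rule Lim_null_comparison[OF _ lim])
      show "\<forall>\<^sub>F n in sequentially. norm (real n * t * (1 - (tanh (real n * t))\<^sup>2)) \<le> (2 / \<bar>t\<bar>) * inverse (real n)"
        using eventually_gt_at_top[of 0]
      proof eventually_elim
        case (elim n)
        then show ?case
          using abs_times_one_minus_tanh_square(2)[of "real n * t"] False
          by (simp add: abs_mult divide_inverse mult.assoc mult.left_commute mult.commute)
      qed
    qed
  qed simp
  from tendsto_add[OF tanh this] show "(\<lambda>n. soft_sgn (real n) t) \<longlonglongrightarrow> sgn t"
    by (simp add: soft_sgn_def)
  have "(\<lambda>n. t * tanh (real n * t)) \<longlonglongrightarrow> t * sgn t" by (intro tendsto_intros tanh)
  then show "(\<lambda>n. soft_abs (real n) t) \<longlonglongrightarrow> \<bar>t\<bar>"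
    by (simp add: soft_abs_def mult_sgn_abs abs_sgn mult.commute)
qed

text \<open>The n-th derivative of tanh is this polynomial evaluated at tanh, since tanh' = 1 -
  tanh^2.\<close>

fun tanh_poly :: "nat \<Rightarrow> real poly" where
  "tanh_poly 0 = [:0, 1:]"
| "tanh_poly (Suc n) = pderiv (tanh_poly n) * [:1, 0, -1:]"

lemma Ck_tanh:
  assumes "Ck k \<phi>"
  shows "Ck k (\<lambda>x. tanh (\<phi> x) :: real)"
proof -
  have "((\<lambda>t. poly (tanh_poly n) (tanh t)) has_real_derivative poly (tanh_poly (Suc n)) (tanh t)) (at t)" for n and t :: real
    by (auto intro!: derivative_eq_intros DERIV_chain2[OF poly_DERIV] simp: power2_eq_square algebra_simps)
  from Ck_compose[where D="\<lambda>n t. poly (tanh_poly n) (tanh t)" and n=0, OF this assms]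
  show ?thesis by simp
qed

lemma Ck_soft_abs: "Ck k \<phi> \<Longrightarrow> Ck k (\<lambda>x. soft_abs c (\<phi> x))"
  unfolding soft_abs_def by (intro Ck_mult Ck_tanh Ck_const)

section \<open>Chain rule and lattice operations for Sobolev pairs\<close>

context sobolev begin

text \<open>The compositions of \<eta> with approximating test functions are test functions
  vanishing where those do. Their jets converge because a bounded derivative controls the change of
  the jet, while continuity of the derivative controls the change of the coefficient.\<close>

lemma Sob_compose:
  assumes w: "w \<in> Sob p \<Omega>"
    and smooth: "\<And>k \<phi>. Ck k \<phi> \<Longrightarrow> Ck k (\<lambda>x::'a. \<eta> (\<phi> x))" and \<eta>0: "\<eta> 0 = 0"
    and der: "\<And>t. (\<eta> has_real_derivative \<eta>' t) (at t)" and cont: "continuous_on UNIV \<eta>'"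
    and bnd: "\<And>t. \<bar>\<eta>' t\<bar> \<le> L"
  shows "(\<lambda>x. (\<eta> (fst (w x)), \<eta>' (fst (w x)) *\<^sub>R snd (w x))) \<in> Sob p \<Omega>" (is "?v \<in> _")
proof -
  have wL: "w \<in> Lp p \<Omega>" using w by (rule Sob_Lp)
  have L: "0 \<le> L" using bnd[of 0] by linarith
  have lip: "\<bar>\<eta> s - \<eta> t\<bar> \<le> L * \<bar>s - t\<bar>" for s t
    using field_differentiable_bound[of UNIV \<eta> \<eta>' L t s] der bnd
    by (auto simp: has_field_derivative_at_within abs_minus_commute)
  have c\<eta>: "continuous_on UNIV \<eta>"
    using der DERIV_isCont by (blast intro: continuous_at_imp_continuous_on)
  have meas_u: "(\<lambda>x. fst (w x)) \<in> borel_measurable M" and meas_g: "(\<lambda>x. snd (w x)) \<in> borel_measurable M"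
    using borel_measurable_fst_snd[OF Lp_measurable[OF wL]] by auto
  have vL: "?v \<in> Lp p \<Omega>"
  proof (rule Lp_bound[OF _ wL p0(1)])
    show "?v \<in> borel_measurable M"
      by (intro borel_measurable_Pair borel_measurable_scaleR meas_g
          borel_measurable_continuous_on[OF c\<eta> meas_u] borel_measurable_continuous_on[OF cont meas_u])
    show "norm (?v x) \<le> (2 * L) * norm (w x)" for x
    proof -
      have "norm (?v x) \<le> \<bar>\<eta> (fst (w x))\<bar> + \<bar>\<eta>' (fst (w x))\<bar> * norm (snd (w x))"
        using norm_Pair_le[of "\<eta> (fst (w x))" "\<eta>' (fst (w x)) *\<^sub>R snd (w x)"] by simp
      also have "\<dots> \<le> L * \<bar>fst (w x)\<bar> + L * norm (snd (w x))"
        using lip[of "fst (w x)" 0] \<eta>0 by (intro add_mono mult_right_mono bnd) auto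
      also have "\<dots> \<le> L * norm (w x) + L * norm (w x)"
        using norm_fst_le_norm[of "w x"] norm_snd_le_norm[of "w x"] L by (intro add_mono mult_left_mono) auto
      finally show ?thesis by simp
    qed
  qed (use L in simp)
  obtain \<phi>0 where \<phi>0: "\<And>k::nat. test_function \<Omega> (\<phi>0 k)" 
    and lim0: "(\<lambda>k. Lp_integral p \<Omega> (\<lambda>x. jet (\<phi>0 k) x - w x)) \<longlonglongrightarrow> 0"
    using w by (auto simp: Sob_def)
  \<comment> \<open>Convergence almost everywhere is needed for the coefficients, where \<eta>' is
    continuous but need not be Lipschitz.\<close>
  obtain r where r: "strict_mono r" "AE x in M. (\<lambda>k. jet (\<phi>0 (r k)) x) \<longlonglongrightarrow> w x"
    using Lp_AE_subseq[OF p0(2) jet_Lp[OF \<phi>0 p0(1)] wL lim0] by blast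
  define \<phi> where "\<phi> k = \<phi>0 (r k)" for k
  have \<phi>: "test_function \<Omega> (\<phi> k)" for k using \<phi>0 by (simp add: \<phi>_def)
  have lim: "(\<lambda>k. Lp_integral p \<Omega> (\<lambda>x. jet (\<phi> k) x - w x)) \<longlonglongrightarrow> 0"
    using LIMSEQ_subseq_LIMSEQ[OF lim0 r(1)] by (simp add: \<phi>_def o_def)
  have ae: "AE x in M. (\<lambda>k. \<phi> k x) \<longlonglongrightarrow> fst (w x)"
    using r(2)
  proof eventually_elim
    case (elim x)
    from tendsto_fst[OF elim] show ?case by (simp add: \<phi>_def jet_def)
  qed
  define \<psi> where "\<psi> k x = \<eta> (\<phi> k x)" for k x
  have \<psi>: "test_function \<Omega> (\<psi> k)" for k
    unfolding \<psi>_def[abs_def] by (rule test_function_compose[OF \<phi> smooth[OF test_functionD(1)[OF \<phi>]] \<eta>0])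
  have jet\<psi>: "jet (\<psi> k) x = (\<eta> (\<phi> k x), \<eta>' (\<phi> k x) *\<^sub>R grad (\<phi> k) x)" for k x
  proof -
    have "(\<psi> k has_derivative (\<lambda>y. (grad (\<phi> k) x \<bullet> y) * \<eta>' (\<phi> k x))) (at x)"
      unfolding \<psi>_def[abs_def] by (rule DERIV_compose_FDERIV[OF der test_functionD(5)[OF \<phi>]])
    then have "grad (\<psi> k) x = \<eta>' (\<phi> k x) *\<^sub>R grad (\<phi> k) x"
      by (intro grad_eqI) (simp add: mult.commute)
    then show ?thesis by (simp add: jet_def \<psi>_def)
  qed
  \<comment> \<open>\<open>A\<close> is controlled by the Lipschitz bound in terms of the
    approximation error. \<open>B\<close> contains the change of the coefficient in front of the
    fixed gradient and tends to 0 by dominated convergence.\<close>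
  define A where "A k x = (\<eta> (\<phi> k x) - \<eta> (fst (w x)), \<eta>' (\<phi> k x) *\<^sub>R (grad (\<phi> k) x - snd (w x)))" for k x
  define B where "B k x = (0::real, (\<eta>' (\<phi> k x) - \<eta>' (fst (w x))) *\<^sub>R snd (w x))" for k x
  have split: "jet (\<psi> k) x - ?v x = A k x + B k x" for k x
    by (simp add: jet\<psi> A_def B_def scaleR_diff_left scaleR_diff_right)
  have m\<phi>: "\<phi> k \<in> borel_measurable M" "grad (\<phi> k) \<in> borel_measurable M" for k
    by (rule Lp_measurable[OF test_Lp(1)[OF \<phi> p0(1)]], rule Lp_measurable[OF test_Lp(2)[OF \<phi> p0(1)]])
  have mB: "B k \<in> borel_measurable M" for k
    unfolding B_def[abs_def]
    by (intro borel_measurable_Pair borel_measurable_const borel_measurable_scaleR borel_measurable_diff meas_g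
        borel_measurable_continuous_on[OF cont] meas_u m\<phi>)
  have mA: "A k \<in> borel_measurable M" for k
    unfolding A_def[abs_def]
    by (intro borel_measurable_Pair borel_measurable_scaleR borel_measurable_diff meas_g
        borel_measurable_continuous_on[OF cont] borel_measurable_continuous_on[OF c\<eta>] meas_u m\<phi>)
  have A_le: "norm (A k x) \<le> (2 * L) * norm (jet (\<phi> k) x - w x)" for k x
  proof -
    have "norm (A k x) \<le> \<bar>\<eta> (\<phi> k x) - \<eta> (fst (w x))\<bar> + \<bar>\<eta>' (\<phi> k x)\<bar> * norm (grad (\<phi> k) x - snd (w x))"
      using norm_Pair_le[of "\<eta> (\<phi> k x) - \<eta> (fst (w x))" "\<eta>' (\<phi> k x) *\<^sub>R (grad (\<phi> k) x - snd (w x))"]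
      by (simp add: A_def)
    also have "\<dots> \<le> L * \<bar>\<phi> k x - fst (w x)\<bar> + L * norm (grad (\<phi> k) x - snd (w x))"
      by (intro add_mono lip mult_right_mono bnd) auto
    also have "\<dots> \<le> L * norm (jet (\<phi> k) x - w x) + L * norm (jet (\<phi> k) x - w x)"
      using norm_fst_le_norm[of "jet (\<phi> k) x - w x"] norm_snd_le_norm[of "jet (\<phi> k) x - w x"] L
      by (intro add_mono mult_left_mono) (auto simp: jet_def)
    finally show ?thesis by simp
  qed
  have dL: "(\<lambda>x. jet (\<phi> k) x - w x) \<in> Lp p \<Omega>" for k using jet_Lp[OF \<phi> p0(1)] wL by (rule Lp_diff[OF p0(1)])
  have AL: "A k \<in> Lp p \<Omega>" for k
    by (rule Lp_bound[OF mA dL p0(1) _ A_le]) (use L in simp)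
  have B_le: "norm (B k x) \<le> (2 * L) * norm (w x)" for k x
  proof -
    have "\<bar>\<eta>' (\<phi> k x) - \<eta>' (fst (w x))\<bar> \<le> 2 * L" using bnd[of "\<phi> k x"] bnd[of "fst (w x)"] by linarith
    then show ?thesis
      using norm_snd_le_norm[of "w x"] L by (simp add: B_def) (intro mult_mono; simp)
  qed
  have BL: "B k \<in> Lp p \<Omega>" for k
    by (rule Lp_bound[OF mB wL p0(1) _ B_le]) (use L in simp)
  have limA: "(\<lambda>k. Lp_integral p \<Omega> (A k)) \<longlonglongrightarrow> 0"
  proof (rule tendsto_sandwich[OF _ _ tendsto_const])
    show "(\<lambda>k. (2 * L) powr p * Lp_integral p \<Omega> (\<lambda>x. jet (\<phi> k) x - w x)) \<longlonglongrightarrow> 0"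
      using tendsto_mult_right_zero[OF lim] .
    have "Lp_integral p \<Omega> (A k) \<le> Lp_integral p \<Omega> (\<lambda>x. (2 * L) *\<^sub>R (jet (\<phi> k) x - w x))" for k
      using A_le L by (intro Lp_integral_mono AL Lp_scaleR dL p0) auto
    then show "\<forall>\<^sub>F k in sequentially. Lp_integral p \<Omega> (A k) \<le> (2 * L) powr p * Lp_integral p \<Omega> (\<lambda>x. jet (\<phi> k) x - w x)"
      using L by (simp add: Lp_integral_scaleR del: norm_scaleR)
  qed simp
  have limB: "(\<lambda>k. Lp_integral p \<Omega> (B k)) \<longlonglongrightarrow> 0"
  proof -
    have "(\<lambda>k. Lp_integral p \<Omega> (\<lambda>x. B k x - 0)) \<longlonglongrightarrow> 0"
    proof (rule Lp_dominated_convergence[OF p0(2) mB])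
      show "integrable M (\<lambda>x. (2 * L) powr p * norm (w x) powr p)"
        by (intro integrable_mult_right Lp_integrable wL)
      show "AE x in M. norm (B k x - 0) powr p \<le> (2 * L) powr p * norm (w x) powr p" for k
      proof (rule AE_I2)
        fix x show "norm (B k x - 0) powr p \<le> (2 * L) powr p * norm (w x) powr p"
          using powr_mono2[OF p0(1) norm_ge_zero B_le[of k x]] L by (simp add: powr_mult)
      qed
      show "AE x in M. (\<lambda>k. B k x) \<longlonglongrightarrow> 0"
        using ae
      proof eventually_elim
        case (elim x)
        have "isCont \<eta>' (fst (w x))" using cont by (simp add: continuous_on_eq_continuous_at)
        from isCont_tendsto_compose[OF this elim]
        have "(\<lambda>k. \<eta>' (\<phi> k x) - \<eta>' (fst (w x))) \<longlonglongrightarrow> 0" by (simp add: LIM_zero)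
        from tendsto_scaleR[OF this tendsto_const, of "snd (w x)"]
        have "(\<lambda>k. (\<eta>' (\<phi> k x) - \<eta>' (fst (w x))) *\<^sub>R snd (w x)) \<longlonglongrightarrow> 0" by simp
        from tendsto_Pair[OF tendsto_const this, of "0::real"] show ?case
          by (simp add: B_def zero_prod_def)
      qed
    qed simp
    then show ?thesis by simp
  qed
  have lim\<psi>: "(\<lambda>k. Lp_integral p \<Omega> (\<lambda>x. jet (\<psi> k) x - ?v x)) \<longlonglongrightarrow> 0"
  proof (rule tendsto_sandwich[OF _ _ tendsto_const])
    show "(\<lambda>k. 2 powr p * (Lp_integral p \<Omega> (A k) + Lp_integral p \<Omega> (B k))) \<longlonglongrightarrow> 0"
      using tendsto_mult_right_zero[OF tendsto_add[OF limA limB, simplified add_0]] by simp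
    show "\<forall>\<^sub>F k in sequentially. Lp_integral p \<Omega> (\<lambda>x. jet (\<psi> k) x - ?v x)
        \<le> 2 powr p * (Lp_integral p \<Omega> (A k) + Lp_integral p \<Omega> (B k))"
      unfolding split by (intro always_eventually allI Lp_integral_add_le p0 AL BL)
  qed simp
  show ?thesis by (rule Sob_closed[OF Sob_jet[OF \<psi>] vL lim\<psi>])
qed

text \<open>The compositions with \<open>soft_abs n\<close> converge pointwise everywhere together
  with their gradients; where the function is 0 the coefficient is 0 for every n, which agrees with
  \<open>sgn 0 = 0\<close>. A fixed multiple of the norm of \<open>w\<close> dominates.\<close>

lemma Sob_abs:
  assumes w: "w \<in> Sob p \<Omega>"
  shows "(\<lambda>x. (\<bar>fst (w x)\<bar>, sgn (fst (w x)) *\<^sub>R snd (w x))) \<in> Sob p \<Omega>" (is "?v \<in> _")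
proof -
  have wL: "w \<in> Lp p \<Omega>" using w by (rule Sob_Lp)
  have mw: "(\<lambda>x. fst (w x)) \<in> borel_measurable M" "(\<lambda>x. snd (w x)) \<in> borel_measurable M"
    using borel_measurable_fst_snd[OF Lp_measurable[OF wL]] by auto
  define V where "V n x = (soft_abs (real n) (fst (w x)), soft_sgn (real n) (fst (w x)) *\<^sub>R snd (w x))" for n x
  have V: "V n \<in> Sob p \<Omega>" for n
    unfolding V_def[abs_def]
    by (rule Sob_compose[OF w Ck_soft_abs _ soft_abs_has_derivative continuous_soft_sgn soft_bounds(2)])
      (simp_all add: soft_abs_def)
  have V_le: "norm (V n x) \<le> 4 * norm (w x)" for n x
  proof -
    have "norm (V n x) \<le> \<bar>soft_abs n (fst (w x))\<bar> + \<bar>soft_sgn n (fst (w x))\<bar> * norm (snd (w x))"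
      using norm_Pair_le[of "soft_abs n (fst (w x))" "soft_sgn n (fst (w x)) *\<^sub>R snd (w x)"] by (simp add: V_def)
    also have "\<dots> \<le> \<bar>fst (w x)\<bar> + 3 * norm (snd (w x))"
      by (intro add_mono mult_right_mono soft_bounds) auto
    finally show ?thesis using norm_fst_le_norm[of "w x"] norm_snd_le_norm[of "w x"] by simp
  qed
  have v_le: "norm (?v x) \<le> 4 * norm (w x)" for x
  proof -
    have "norm (?v x) \<le> \<bar>fst (w x)\<bar> + \<bar>sgn (fst (w x))\<bar> * norm (snd (w x))"
      using norm_Pair_le[of "\<bar>fst (w x)\<bar>" "sgn (fst (w x)) *\<^sub>R snd (w x)"] by simp
    also have "\<dots> \<le> \<bar>fst (w x)\<bar> + 1 * norm (snd (w x))"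
      by (intro add_mono mult_right_mono) (auto simp: sgn_if)
    finally show ?thesis using norm_fst_le_norm[of "w x"] norm_snd_le_norm[of "w x"] norm_ge_zero[of "w x"] by simp
  qed
  have lim: "(\<lambda>n. V n x) \<longlonglongrightarrow> ?v x" for x
    unfolding V_def by (intro tendsto_Pair tendsto_scaleR soft_tendsto tendsto_const)
  have mV: "V n \<in> borel_measurable M" for n using V Sob_Lp Lp_measurable by blast
  have mv: "?v \<in> borel_measurable M"
    by (rule borel_measurable_LIMSEQ_metric[OF mV lim])
  have vL: "?v \<in> Lp p \<Omega>" by (rule Lp_bound[OF mv wL p0(1) _ v_le]) simp
  have "(\<lambda>n. Lp_integral p \<Omega> (\<lambda>x. V n x - ?v x)) \<longlonglongrightarrow> 0"
  proof (rule Lp_dominated_convergence[OF p0(2) mV mv])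
    show "integrable M (\<lambda>x. 8 powr p * norm (w x) powr p)"
      by (intro integrable_mult_right Lp_integrable wL)
    show "AE x in M. norm (V n x - ?v x) powr p \<le> 8 powr p * norm (w x) powr p" for n
    proof (rule AE_I2)
      fix x
      have "norm (V n x - ?v x) \<le> 8 * norm (w x)"
        using norm_triangle_ineq4[of "V n x" "?v x"] V_le[of n x] v_le[of x] by linarith
      from powr_mono2[OF p0(1) norm_ge_zero this]
      show "norm (V n x - ?v x) powr p \<le> 8 powr p * norm (w x) powr p" by (simp add: powr_mult)
    qed
    show "AE x in M. (\<lambda>n. V n x) \<longlonglongrightarrow> ?v x" using lim by (intro AE_I2)
  qed
  from Sob_closed[OF V vL this] show ?thesis .
qed

text \<open>Uses max(a, b) = (a + b + |a - b|)/2. The resulting gradient is that of the larger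
  function, and the average of both where the functions agree.\<close>

lemma Sob_max:
  assumes w: "w \<in> Sob p \<Omega>" and v: "v \<in> Sob p \<Omega>"
  obtains m where "m \<in> Sob p \<Omega>" "\<And>x. fst (m x) = max (fst (w x)) (fst (v x))"
    "\<And>x. norm (snd (m x)) \<le> max (norm (snd (w x))) (norm (snd (v x)))"
proof -
  define a where "a x = (\<bar>fst (w x - v x)\<bar>, sgn (fst (w x - v x)) *\<^sub>R snd (w x - v x))" for x
  define m where "m x = (1/2) *\<^sub>R (w x + v x + a x)" for x
  have "a \<in> Sob p \<Omega>" unfolding a_def[abs_def] by (rule Sob_abs[OF Sob_diff[OF w v]])
  then have "m \<in> Sob p \<Omega>" unfolding m_def[abs_def] by (intro Sob_scaleR Sob_add w v)
  moreover have "fst (m x) = max (fst (w x)) (fst (v x))" for x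
    by (auto simp: m_def a_def max_def abs_if)
  moreover have "norm (snd (m x)) \<le> max (norm (snd (w x))) (norm (snd (v x)))" for x
  proof (cases "fst (w x)" "fst (v x)" rule: linorder_cases)
    case less
    then have "snd (m x) = snd (v x)" by (simp add: m_def a_def flip: scaleR_2)
    then show ?thesis by simp
  next
    case greater
    then have "snd (m x) = snd (w x)" by (simp add: m_def a_def flip: scaleR_2)
    then show ?thesis by simp
  next
    case equal
    then have "snd (m x) = (1/2) *\<^sub>R (snd (w x) + snd (v x))" by (simp add: m_def a_def)
    then show ?thesis using norm_triangle_ineq[of "snd (w x)" "snd (v x)"] by simp
  qed
  ultimately show thesis using that by blast
qed

end

section \<open>Minimizers\<close>

lemma norm_Pair_powr:
  "norm (z::'b::euclidean_space, t::real) powr p = ((norm z)\<^sup>2 + t\<^sup>2) powr (p / 2)"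
  by (simp add: norm_Pair powr_powr flip: powr_half_sqrt)

context sobolev begin

text \<open>For two pairs with the same s the last coordinate cancels, so the distance of the
  shifted gradients is the distance of the gradients.\<close>

definition shifted :: "real \<Rightarrow> ('a \<Rightarrow> real \<times> 'a) \<Rightarrow> 'a \<Rightarrow> 'a \<times> real" where
  "shifted s w x = (snd (w x), s)"

definition J :: "('a \<Rightarrow> real) \<Rightarrow> real \<Rightarrow> ('a \<Rightarrow> real \<times> 'a) \<Rightarrow> real" where
  "J f s w = 1 / p * Lp_integral p \<Omega> (shifted s w) - (LINT x|M. f x * fst (w x))"

definition minimizes :: "('a \<Rightarrow> real) \<Rightarrow> real \<Rightarrow> ('a \<Rightarrow> real \<times> 'a) \<Rightarrow> bool" where
  "minimizes f s w \<longleftrightarrow> w \<in> Sob p \<Omega> \<and> (\<forall>v\<in>Sob p \<Omega>. J f s w \<le> J f s v)"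

lemma shifted_Lp: "w \<in> Sob p \<Omega> \<Longrightarrow> shifted s w \<in> Lp p \<Omega>"
  unfolding shifted_def[abs_def]
  by (intro Lp_Pair p0 Lp_const Lp_fst_snd(2) Sob_Lp)

lemma fst_Lp: "w \<in> Sob p \<Omega> \<Longrightarrow> (\<lambda>x. fst (w x)) \<in> Lp p \<Omega>"
  and snd_Lp: "w \<in> Sob p \<Omega> \<Longrightarrow> (\<lambda>x. snd (w x)) \<in> Lp p \<Omega>"
  using Lp_fst_snd p0 Sob_Lp by blast+

lemma energy_eps_eq_J:
  assumes "w \<in> Sob p \<Omega>"
  shows "energy_eps p \<Omega> f \<epsilon> (\<lambda>x. fst (w x)) = J f (chi p * \<epsilon>) w"
proof -
  \<comment> \<open>\<open>chi p\<close> is 0 or 1, hence equal to its square.\<close>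
  have "(chi p * \<epsilon>)\<^sup>2 = chi p * \<epsilon>\<^sup>2" by (simp add: chi_def)
  then have eq: "((norm z)\<^sup>2 + chi p * \<epsilon>\<^sup>2) powr (p / 2) = norm (z, chi p * \<epsilon>) powr p" for z :: 'a
    by (simp add: norm_Pair_powr)
  have "continuous_on UNIV (\<lambda>z::'a. norm (z, chi p * \<epsilon>) powr p)"
    by (rule continuous_on_compose2[OF continuous_on_norm_powr[OF p0(2)]]) (auto intro!: continuous_intros)
  from integral_weak_gradient[OF Sob_weak_pair[OF assms] this]
  show ?thesis by (simp add: energy_eps_def J_def eq shifted_def)
qed

lemma energy_eq_J:
  assumes "w \<in> Sob p \<Omega>"
  shows "energy p \<Omega> f (\<lambda>x. fst (w x)) = J f 0 w"
  using integral_weak_gradient[OF Sob_weak_pair[OF assms] continuous_on_norm_powr[OF p0(2)]]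
  by (simp add: energy_def J_def shifted_def)

text \<open>\<open>E\<close> is arbitrary so that both energies, each an instance of
  \<open>J\<close>, are translated at once.\<close>

lemma minimizer_over_iff:
  assumes "\<And>w. w \<in> Sob p \<Omega> \<Longrightarrow> E (\<lambda>x. fst (w x)) = J f s w"
  shows "minimizer_over (W1p0 p \<Omega>) E u \<longleftrightarrow> (\<exists>w. minimizes f s w \<and> u = (\<lambda>x. fst (w x)))"
proof
  assume "minimizer_over (W1p0 p \<Omega>) E u"
  then have u: "u \<in> W1p0 p \<Omega>" "\<And>v. v \<in> W1p0 p \<Omega> \<Longrightarrow> E u \<le> E v"
    by (auto simp: minimizer_over_def is_arg_min_linorder)
  then obtain w where w: "w \<in> Sob p \<Omega>" "u = (\<lambda>x. fst (w x))" by (auto simp: W1p0_iff)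
  have "J f s w \<le> J f s v" if "v \<in> Sob p \<Omega>" for v
    using u(2)[of "\<lambda>x. fst (v x)"] that w assms by (auto simp: W1p0_iff)
  then show "\<exists>w. minimizes f s w \<and> u = (\<lambda>x. fst (w x))" using w by (auto simp: minimizes_def)
next
  assume "\<exists>w. minimizes f s w \<and> u = (\<lambda>x. fst (w x))"
  then obtain w where w: "minimizes f s w" "u = (\<lambda>x. fst (w x))" by blast
  then show "minimizer_over (W1p0 p \<Omega>) E u"
    using assms by (auto simp: minimizes_def minimizer_over_def is_arg_min_linorder W1p0_iff)
qed

text \<open>Young's inequality with a small weight and the Poincare inequality bound the linear term
  by half of the gradient term plus a constant that depends neither on \<open>w\<close> nor on
  s.\<close>

lemma J_coercive:
  assumes f: "f \<in> Lp q \<Omega>"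
  obtains K where "\<And>w s. w \<in> Sob p \<Omega> \<Longrightarrow> Lp_integral p \<Omega> (shifted s w) \<le> 2 * p * J f s w + K"
proof -
  obtain CP where CP: "0 \<le> CP"
    "\<And>w. w \<in> Sob p \<Omega> \<Longrightarrow> Lp_integral p \<Omega> w \<le> CP * Lp_integral p \<Omega> (\<lambda>x. snd (w x))"
    by (rule Poincare) blast
  \<comment> \<open>Makes \<delta> (CP + 1) equal to 1/(2p), half of the coefficient 1/p of the
    gradient term.\<close>
  define \<delta> where "\<delta> = 1 / (2 * p * (CP + 1))"
  have \<delta>: "0 < \<delta>" using p CP by (simp add: \<delta>_def)
  \<comment> \<open>The roles of p and q are exchanged, since here the small weight belongs to the
    function in \<open>Lp p\<close> and not to \<open>f\<close>.\<close>
  have pq': "1 / q + 1 / p = 1" using pq by simp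
  obtain C where C: "0 \<le> C" "\<And>a b. \<bar>a * b\<bar> \<le> \<delta> * \<bar>a\<bar> powr p + C * \<bar>b\<bar> powr q"
    by (rule Young_eps[OF q p pq' \<delta>]) blast
  have Young: "\<bar>a * b\<bar> \<le> C * \<bar>a\<bar> powr q + \<delta> * \<bar>b\<bar> powr p" for a b
    using C(2)[of b a] by (simp add: mult.commute add.commute)
  have "Lp_integral p \<Omega> (shifted s w) \<le> 2 * p * J f s w + 2 * p * (C * Lp_integral q \<Omega> f)"
    if w: "w \<in> Sob p \<Omega>" for w s
  proof -
    define G where "G = Lp_integral p \<Omega> (shifted s w)"
    have "Lp_integral p \<Omega> (\<lambda>x. snd (w x)) \<le> G"
      unfolding G_def by (rule Lp_integral_mono[OF snd_Lp[OF w] shifted_Lp[OF w] p0(1)])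
        (simp add: shifted_def norm_fst_le)
    then have "CP * Lp_integral p \<Omega> (\<lambda>x. snd (w x)) \<le> (CP + 1) * G"
      using CP(1) Lp_integral_nonneg by (intro mult_mono) auto
    moreover have "Lp_integral p \<Omega> (\<lambda>x. fst (w x)) \<le> Lp_integral p \<Omega> w"
      by (rule Lp_integral_fst_snd(1)[OF p0(1) Sob_Lp[OF w]])
    ultimately have "Lp_integral p \<Omega> (\<lambda>x. fst (w x)) \<le> (CP + 1) * G"
      using CP(2)[OF w] by linarith
    then have "\<delta> * Lp_integral p \<Omega> (\<lambda>x. fst (w x)) \<le> \<delta> * ((CP + 1) * G)"
      using \<delta> by (intro mult_left_mono) auto
    also have "\<dots> = G / (2 * p)" using CP(1) by (simp add: \<delta>_def)
    finally have "\<bar>LINT x|M. f x * fst (w x)\<bar> \<le> C * Lp_integral q \<Omega> f + G / (2 * p)"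
      using Lp_pairing_le[OF f fst_Lp[OF w] Young] by linarith
    then have "G / p - (C * Lp_integral q \<Omega> f + G / (2 * p)) \<le> J f s w"
      unfolding J_def G_def by simp
    then have "2 * p * (G / p - (C * Lp_integral q \<Omega> f + G / (2 * p))) \<le> 2 * p * J f s w"
      using p0 by (intro mult_left_mono) auto
    moreover have "2 * p * (G / p - (C * Lp_integral q \<Omega> f + G / (2 * p))) = G - 2 * p * (C * Lp_integral q \<Omega> f)"
      using p0 by (simp add: field_simps)
    ultimately show ?thesis unfolding G_def by linarith
  qed
  then show thesis by (rule that)
qed

text \<open>The linear term is exact at midpoints, so only the convexity deficit of the gradient
  term survives.\<close>

lemma J_midpoint:
  assumes f: "f \<in> Lp q \<Omega>" and w: "w \<in> Sob p \<Omega>" and v: "v \<in> Sob p \<Omega>"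
  shows "integrable M (\<lambda>x. midpoint_deficit p (shifted s w x) (shifted s v x))"
    "J f s (\<lambda>x. (1/2) *\<^sub>R (w x + v x)) = (J f s w + J f s v) / 2
      - 1 / p * (LINT x|M. midpoint_deficit p (shifted s w x) (shifted s v x))"
proof -
  let ?m = "\<lambda>x. (1/2) *\<^sub>R (w x + v x)"
  have m: "?m \<in> Sob p \<Omega>" by (intro Sob_scaleR Sob_add w v)
  have sm: "(1/2) *\<^sub>R (shifted s w x + shifted s v x) = shifted s ?m x" for x
    by (simp add: shifted_def)
  note int = Lp_integrable[OF shifted_Lp[OF w, of s]] Lp_integrable[OF shifted_Lp[OF v, of s]]
    Lp_integrable[OF shifted_Lp[OF m, of s]]
  show "integrable M (\<lambda>x. midpoint_deficit p (shifted s w x) (shifted s v x))"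
    unfolding midpoint_deficit_def sm
    by (intro Bochner_Integration.integrable_diff Bochner_Integration.integrable_divide
        Bochner_Integration.integrable_add int)
  have "(LINT x|M. midpoint_deficit p (shifted s w x) (shifted s v x))
    = (Lp_integral p \<Omega> (shifted s w) + Lp_integral p \<Omega> (shifted s v)) / 2 - Lp_integral p \<Omega> (shifted s ?m)"
    unfolding midpoint_deficit_def sm using int by simp
  then have "Lp_integral p \<Omega> (shifted s ?m) = (Lp_integral p \<Omega> (shifted s w) + Lp_integral p \<Omega> (shifted s v)) / 2
     - (LINT x|M. midpoint_deficit p (shifted s w x) (shifted s v x))"
    by linarith
  moreover have "(LINT x|M. f x * fst (?m x)) = ((LINT x|M. f x * fst (w x)) + (LINT x|M. f x * fst (v x))) / 2"
    using Lp_pairing_integrable[OF f fst_Lp[OF w]] Lp_pairing_integrable[OF f fst_Lp[OF v]]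
    by (simp add: distrib_left)
  ultimately show "J f s ?m = (J f s w + J f s v) / 2
      - 1 / p * (LINT x|M. midpoint_deficit p (shifted s w x) (shifted s v x))"
    unfolding J_def
  proof (elim ssubst)
    fix a b d y z
    show "1 / p * ((a + b) / 2 - d) - (y + z) / 2 = (1 / p * a - y + (1 / p * b - z)) / 2 - 1 / p * d"
      by (simp add: algebra_simps add_divide_distrib diff_divide_distrib)
  qed
qed

text \<open>The midpoint of two almost minimizers cannot beat the infimum, so their midpoint deficit is small.\<close>

lemma almost_minimizers_close:
  assumes f: "f \<in> Lp q \<Omega>" and m: "\<And>v. v \<in> Sob p \<Omega> \<Longrightarrow> m \<le> J f s v" and e: "0 < e"
  obtains \<tau> where "0 < \<tau>" "\<And>w v. w \<in> Sob p \<Omega> \<Longrightarrow> v \<in> Sob p \<Omega> \<Longrightarrow> J f s w \<le> m + \<tau> \<Longrightarrow> J f s v \<le> m + \<tau> \<Longrightarrow>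
    Lp_integral p \<Omega> (\<lambda>x. w x - v x) \<le> e"
proof -
  obtain CP where CP: "0 \<le> CP"
    "\<And>w. w \<in> Sob p \<Omega> \<Longrightarrow> Lp_integral p \<Omega> w \<le> CP * Lp_integral p \<Omega> (\<lambda>x. snd (w x))"
    by (rule Poincare) blast
  obtain K where K: "\<And>w. w \<in> Sob p \<Omega> \<Longrightarrow> Lp_integral p \<Omega> (shifted s w) \<le> 2 * p * J f s w + K"
    by (rule J_coercive[OF f]) blast
  \<comment> \<open>By coercivity, everything within 1 of the lower bound \<open>m\<close> has
    gradient integral at most B; the maximum with 0 keeps B nonnegative.\<close>
  define B where "B = max 0 (2 * p * (m + 1) + K)"
  have B0: "0 \<le> B" by (simp add: B_def)
  have B: "Lp_integral p \<Omega> (shifted s w) \<le> B" if "w \<in> Sob p \<Omega>" "J f s w \<le> m + 1" for w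
  proof -
    have "2 * p * J f s w \<le> 2 * p * (m + 1)" using that p0 by (intro mult_left_mono) auto
    then show ?thesis using K[OF that(1)] unfolding B_def by linarith
  qed
  \<comment> \<open>The constants are fixed in the order e', \<delta>, C, \<tau>. Closeness e' of
    the gradients gives closeness e of the pairs by Poincare; \<delta> makes the error term at most
    e'/2; C depends on \<delta>.\<close>
  define e' where "e' = e / (CP + 1)"
  have e': "0 < e'" using e CP by (simp add: e'_def)
  define \<delta> where "\<delta> = e' / (4 * (B + 1))"
  have \<delta>: "0 < \<delta>" using e' B0 by (simp add: \<delta>_def)
  obtain C where C: "0 \<le> C" "\<And>a b :: 'a \<times> real.
    norm (a - b) powr p \<le> \<delta> * (norm a powr p + norm b powr p) + C * midpoint_deficit p a b"
    by (rule midpoint_deficit_bound[OF p \<delta>]) blast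
  \<comment> \<open>The deficit integral is at most p \<tau>, so this leaves at most e'/2 for the
    second term; the cap 1 makes the energy bound B applicable.\<close>
  define \<tau> where "\<tau> = min 1 (e' / (2 * p * (C + 1)))"
  have \<tau>: "0 < \<tau>" "\<tau> \<le> 1" "C * (p * \<tau>) \<le> e' / 2"
  proof -
    show "0 < \<tau>" "\<tau> \<le> 1" using e' p0 C(1) by (simp_all add: \<tau>_def)
    have "C * (p * \<tau>) \<le> (C + 1) * (p * (e' / (2 * p * (C + 1))))"
      using C(1) p0 e' by (intro mult_mono) (auto simp: \<tau>_def)
    also have "\<dots> = e' / 2"
    proof -
      have "c * (p * (e' / (2 * p * c))) = e' / 2" if "0 < c" for c using that p0 by simp
      then show ?thesis using add_nonneg_pos[OF C(1) zero_less_one] .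
    qed
    finally show "C * (p * \<tau>) \<le> e' / 2" .
  qed
  have "Lp_integral p \<Omega> (\<lambda>x. w x - v x) \<le> e"
    if w: "w \<in> Sob p \<Omega>" "J f s w \<le> m + \<tau>" and v: "v \<in> Sob p \<Omega>" "J f s v \<le> m + \<tau>" for w v
  proof -
    let ?D = "LINT x|M. midpoint_deficit p (shifted s w x) (shifted s v x)"
    have "m \<le> J f s (\<lambda>x. (1/2) *\<^sub>R (w x + v x))" by (intro m Sob_scaleR Sob_add w v)
    then have "1 / p * ?D \<le> \<tau>"
      using w(2) v(2) unfolding J_midpoint(2)[OF f w(1) v(1)] by argo
    then have D: "?D \<le> p * \<tau>" using p0 by (simp add: field_simps)
    have "Lp_integral p \<Omega> (\<lambda>x. snd (w x - v x)) = (LINT x|M. norm (shifted s w x - shifted s v x) powr p)"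
      by (simp add: shifted_def)
    also have "\<dots> \<le> (LINT x|M. \<delta> * (norm (shifted s w x) powr p + norm (shifted s v x) powr p)
          + C * midpoint_deficit p (shifted s w x) (shifted s v x))"
      by (intro integral_mono C Bochner_Integration.integrable_add integrable_mult_right J_midpoint(1)[OF f]
        Lp_integrable Lp_diff shifted_Lp w v p0)
    also have "\<dots> = \<delta> * (Lp_integral p \<Omega> (shifted s w) + Lp_integral p \<Omega> (shifted s v)) + C * ?D"
      using Lp_integrable[OF shifted_Lp[OF w(1), of s]] Lp_integrable[OF shifted_Lp[OF v(1), of s]]
        J_midpoint(1)[OF f w(1) v(1)] by simp
    also have "\<dots> \<le> \<delta> * (B + B) + C * (p * \<tau>)"
      using B w v \<tau>(2) \<delta> C(1) D by (intro add_mono mult_left_mono) auto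
    also have "\<delta> * (B + B) \<le> e' / 2"
    proof -
      have "\<delta> * (B + B) \<le> \<delta> * (2 * (B + 1))" using \<delta> by (intro mult_left_mono) auto
      also have "\<dots> = e' / 2"
      proof -
        have "e' / (4 * c) * (2 * c) = e' / 2" if "0 < c" for c using that by simp
        then show ?thesis unfolding \<delta>_def using add_nonneg_pos[OF B0 zero_less_one] .
      qed
      finally show ?thesis .
    qed
    finally have "Lp_integral p \<Omega> (\<lambda>x. snd (w x - v x)) \<le> e'" using \<tau>(3) by linarith
    then have "CP * Lp_integral p \<Omega> (\<lambda>x. snd (w x - v x)) \<le> (CP + 1) * e'"
      using CP(1) Lp_integral_nonneg by (intro mult_mono) auto
    also have "\<dots> = e" using CP(1) by (simp add: e'_def)
    finally show ?thesis using CP(2)[OF Sob_diff[OF w(1) v(1)]] by linarith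
  qed
  then show thesis using that \<tau>(1) by blast
qed

text \<open>Convergence of minimizing sequences is strong, so continuity of \<open>J\<close> is
  enough to show that the limit attains the infimum.\<close>

lemma J_tendsto:
  assumes f: "f \<in> Lp q \<Omega>" and W: "\<And>k. W k \<in> Sob p \<Omega>" and w: "w \<in> Sob p \<Omega>"
    and lim: "(\<lambda>k::nat. Lp_integral p \<Omega> (\<lambda>x. W k x - w x)) \<longlonglongrightarrow> 0"
  shows "(\<lambda>k. J f s (W k)) \<longlonglongrightarrow> J f s w"
  unfolding J_def
proof (intro tendsto_diff tendsto_mult_left)
  have "(\<lambda>k. Lp_integral p \<Omega> (\<lambda>x. shifted s (W k) x - shifted s w x)) \<longlonglongrightarrow> 0"
  proof (rule Lp_integral_tendsto_mono[OF lim])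
    show "norm (shifted s (W k) x - shifted s w x) \<le> norm (W k x - w x)" for k x
      using norm_snd_le_norm[of "W k x - w x"] by (simp add: shifted_def)
  qed (intro Sob_Lp shifted_Lp W w)+
  then show "(\<lambda>k. Lp_integral p \<Omega> (shifted s (W k))) \<longlonglongrightarrow> Lp_integral p \<Omega> (shifted s w)"
    by (rule Lp_integral_tendsto[OF p0(2) shifted_Lp[OF W] shifted_Lp[OF w]])
  have "(\<lambda>k. Lp_integral p \<Omega> (\<lambda>x. fst (W k x) - fst (w x))) \<longlonglongrightarrow> 0"
  proof (rule Lp_integral_tendsto_mono[OF lim])
    show "norm (fst (W k x) - fst (w x)) \<le> norm (W k x - w x)" for k x
      using norm_fst_le_norm[of "W k x - w x"] by simp
  qed (intro Sob_Lp fst_Lp W w)+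
  then show "(\<lambda>k. LINT x|M. f x * fst (W k x)) \<longlonglongrightarrow> (LINT x|M. f x * fst (w x))"
    by (rule Lp_pairing_tendsto[OF f fst_Lp[OF W] fst_Lp[OF w]])
qed

proposition minimizer_exists:
  assumes f: "f \<in> Lp q \<Omega>"
  obtains w where "minimizes f s w"
proof -
  obtain K where K: "\<And>w. w \<in> Sob p \<Omega> \<Longrightarrow> Lp_integral p \<Omega> (shifted s w) \<le> 2 * p * J f s w + K"
    by (rule J_coercive[OF f]) blast
  define m where "m = Inf (J f s ` Sob p \<Omega>)"
  have "test_function \<Omega> (\<lambda>_. 0)"
    by (rule test_function_supported[of _ "{}"]) (auto intro: Ck_const)
  then have ne: "Sob p \<Omega> \<noteq> {}" using Sob_jet by blast
  \<comment> \<open>The p-integral is nonnegative, so coercivity bounds \<open>J\<close> from below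
    and \<open>m\<close> is a genuine infimum.\<close>
  have bdd: "bdd_below (J f s ` Sob p \<Omega>)"
  proof (rule bdd_belowI2)
    fix w assume w: "w \<in> Sob p \<Omega>"
    have "0 \<le> 2 * p * J f s w + K" using K[OF w] Lp_integral_nonneg by (rule order_trans[rotated])
    then show "- K / (2 * p) \<le> J f s w" using p0 by (simp add: field_simps)
  qed
  have m: "m \<le> J f s v" if "v \<in> Sob p \<Omega>" for v
    unfolding m_def by (rule cINF_lower[OF bdd that])
  have "\<exists>w\<in>Sob p \<Omega>. J f s w < m + inverse (real (Suc k))" for k
    using cINF_less_iff[OF ne bdd, of "m + inverse (real (Suc k))"] unfolding m_def by simp
  then obtain W where W: "\<And>k. W k \<in> Sob p \<Omega>" "\<And>k. J f s (W k) < m + inverse (real (Suc k))" by metis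
  have Cauchy: "\<exists>N. \<forall>j\<ge>N. \<forall>k\<ge>N. Lp_integral p \<Omega> (\<lambda>x. W j x - W k x) \<le> e" if e: "0 < e" for e
  proof -
    obtain \<tau> where \<tau>: "0 < \<tau>" "\<And>w v. w \<in> Sob p \<Omega> \<Longrightarrow> v \<in> Sob p \<Omega> \<Longrightarrow> J f s w \<le> m + \<tau> \<Longrightarrow> J f s v \<le> m + \<tau> \<Longrightarrow>
        Lp_integral p \<Omega> (\<lambda>x. w x - v x) \<le> e"
      by (rule almost_minimizers_close[OF f m e]) blast+
    obtain N where N: "inverse (real (Suc N)) < \<tau>" using reals_Archimedean[OF \<tau>(1)] by blast
    have "J f s (W k) \<le> m + \<tau>" if "N \<le> k" for k
    proof -
      have "inverse (real (Suc k)) \<le> inverse (real (Suc N))" using that by (intro le_imp_inverse_le) auto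
      then show ?thesis using W(2)[of k] N by linarith
    qed
    then show ?thesis using \<tau>(2) W(1) by blast
  qed
  obtain w where w: "w \<in> Lp p \<Omega>" "(\<lambda>k. Lp_integral p \<Omega> (\<lambda>x. W k x - w x)) \<longlonglongrightarrow> 0"
    by (rule Lp_complete[where W=W, OF p0(2) Sob_Lp[OF W(1)] Cauchy])
  have wS: "w \<in> Sob p \<Omega>" by (rule Sob_closed[OF W(1) w])
  have "J f s w \<le> m"
  proof (rule LIMSEQ_le[OF J_tendsto[OF f W(1) wS w(2)]])
    show "(\<lambda>k. m + inverse (real (Suc k))) \<longlonglongrightarrow> m"
      using tendsto_add[OF tendsto_const LIMSEQ_inverse_real_of_nat, of m] by simp
    show "\<exists>N. \<forall>k\<ge>N. J f s (W k) \<le> m + inverse (real (Suc k))"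
      using W(2) less_imp_le by blast
  qed
  then have "minimizes f s w" using m wS by (force simp: minimizes_def intro: order_trans)
  then show thesis by (rule that)
qed

text \<open>With the minimum as the lower bound, two minimizers are almost minimizers for every
  tolerance, so the integral of their difference is at most every e > 0.\<close>

lemma minimizer_unique:
  assumes f: "f \<in> Lp q \<Omega>" and w: "minimizes f s w" and v: "minimizes f s v"
  shows "AE x in M. w x = v x"
proof -
  have S: "w \<in> Sob p \<Omega>" "v \<in> Sob p \<Omega>" and le: "J f s v \<le> J f s w"
    and m: "\<And>z. z \<in> Sob p \<Omega> \<Longrightarrow> J f s w \<le> J f s z"
    using w v by (auto simp: minimizes_def)
  have close: "Lp_integral p \<Omega> (\<lambda>x. w x - v x) \<le> e" if e: "0 < e" for e
  proof -
    obtain \<tau> where "0 < \<tau>" "\<And>w' v'. w' \<in> Sob p \<Omega> \<Longrightarrow> v' \<in> Sob p \<Omega> \<Longrightarrow> J f s w' \<le> J f s w + \<tau> \<Longrightarrow>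
        J f s v' \<le> J f s w + \<tau> \<Longrightarrow> Lp_integral p \<Omega> (\<lambda>x. w' x - v' x) \<le> e"
      by (rule almost_minimizers_close[OF f m e]) blast+
    then show ?thesis using S le by simp
  qed
  have "Lp_integral p \<Omega> (\<lambda>x. w x - v x) \<le> 0"
    by (rule field_le_epsilon) (unfold add_0, rule close)
  then have "Lp_integral p \<Omega> (\<lambda>x. w x - v x) = 0" using Lp_integral_nonneg by (rule antisym)
  then have "AE x in M. norm (w x - v x) powr p = 0"
    using Lp_integrable[OF Lp_diff[OF p0(1) Sob_Lp[OF S(1)] Sob_Lp[OF S(2)]]]
    by (subst (asm) integral_nonneg_eq_0_iff_AE) auto
  then show ?thesis by eventually_elim simp
qed

section \<open>The sign of minimizers\<close>

lemma J_uminus: "J (\<lambda>x. - f x) s (\<lambda>x. - w x) = J f s w"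
  by (simp add: J_def shifted_def norm_Pair)

text \<open>Changing the sign of both \<open>f\<close> and the pair leaves \<open>J\<close>
  unchanged, which reduces negative \<open>f\<close> to positive \<open>f\<close>.\<close>

lemma minimizes_uminus:
  assumes "minimizes f s w"
  shows "minimizes (\<lambda>x. - f x) s (\<lambda>x. - w x)"
proof -
  have neg: "(\<lambda>x. - v x) \<in> Sob p \<Omega>" if "v \<in> Sob p \<Omega>" for v
    using Sob_scaleR[OF that, of "-1"] by simp
  have "J f s w \<le> J (\<lambda>x. - f x) s v" if "v \<in> Sob p \<Omega>" for v
    using assms neg[OF that] J_uminus[of f s "\<lambda>x. - v x"] by (auto simp: minimizes_def)
  then show ?thesis using assms neg by (auto simp: minimizes_def J_uminus)
qed

lemma integral_nonneg_le_0_imp_AE: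
  fixes h :: "'a \<Rightarrow> real"
  assumes "integrable M h" "AE x in M. 0 \<le> h x" "(LINT x|M. h x) \<le> 0"
  shows "AE x in M. h x = 0"
proof -
  have "(LINT x|M. h x) = 0" using integral_nonneg_AE[OF assms(2)] assms(3) by linarith
  then show ?thesis using assms(1,2) by (simp add: integral_nonneg_eq_0_iff_AE)
qed

text \<open>Passing to |u| does not increase the gradient term and does not decrease the integral of
  f u. Minimality forces equality of the latter, and f > 0 then gives |u| = u almost
  everywhere.\<close>

lemma minimizer_nonneg:
  assumes f: "f \<in> Lp q \<Omega>" "AE x in M. 0 < f x" and w: "minimizes f s w"
  shows "AE x in M. 0 \<le> fst (w x)"
proof -
  have wS: "w \<in> Sob p \<Omega>" using w by (simp add: minimizes_def)
  define v where "v x = (\<bar>fst (w x)\<bar>, sgn (fst (w x)) *\<^sub>R snd (w x))" for x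
  have v: "v \<in> Sob p \<Omega>" unfolding v_def[abs_def] by (rule Sob_abs[OF wS])
  have "Lp_integral p \<Omega> (shifted s v) \<le> Lp_integral p \<Omega> (shifted s w)"
  proof (rule Lp_integral_mono[OF shifted_Lp[OF v] shifted_Lp[OF wS] p0(1)])
    show "norm (shifted s v x) \<le> norm (shifted s w x)" for x
      by (auto simp: shifted_def v_def norm_Pair sgn_if)
  qed
  then have "1 / p * Lp_integral p \<Omega> (shifted s v) \<le> 1 / p * Lp_integral p \<Omega> (shifted s w)"
    using p0 by (intro mult_left_mono) auto
  moreover have "J f s w \<le> J f s v" using w v by (simp add: minimizes_def)
  ultimately have "(LINT x|M. f x * fst (v x)) - (LINT x|M. f x * fst (w x)) \<le> 0"
    unfolding J_def by linarith
  moreover note int = Lp_pairing_integrable[OF f(1) fst_Lp[OF v]] Lp_pairing_integrable[OF f(1) fst_Lp[OF wS]]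
  ultimately have "(LINT x|M. f x * fst (v x) - f x * fst (w x)) \<le> 0" by simp
  moreover have "AE x in M. 0 \<le> f x * fst (v x) - f x * fst (w x)"
    using f(2)
  proof eventually_elim
    case (elim x)
    have "f x * fst (w x) \<le> f x * fst (v x)" using elim by (intro mult_left_mono) (auto simp: v_def)
    then show ?case by simp
  qed
  ultimately have "AE x in M. f x * fst (v x) - f x * fst (w x) = 0"
    using int by (intro integral_nonneg_le_0_imp_AE Bochner_Integration.integrable_diff)
  then show ?thesis using f(2)
  proof eventually_elim
    case (elim x)
    then have "fst (v x) = fst (w x)" by simp
    then show ?case by (simp add: v_def)
  qed
qed

text \<open>Comparing \<open>u\<close> with \<open>max u (t \<psi>)\<close> for a bump function \<open>\<psi>\<close> costs \<open>O(t\<^sup>p)\<close> of gradient energy but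
  gains \<open>t \<integral> f \<psi>\<close> over the set where \<open>u \<le> 0\<close>; since \<open>p > 1\<close> this set is null.\<close>

lemma minimizer_pos:
  assumes f: "f \<in> Lp q \<Omega>" "AE x in M. 0 < f x" and w: "minimizes f 0 w"
  shows "AE x in M. 0 < fst (w x)"
proof (rule AE_lebesgue_on_boxI[OF open_\<Omega>])
  fix a b assume ab: "cbox a b \<subseteq> \<Omega>" "box a b \<noteq> {}"
  define \<psi> where "\<psi> = box_bump a b"
  have \<psi>: "test_function \<Omega> \<psi>" unfolding \<psi>_def by (rule test_function_box_bump[OF ab])
  have \<psi>0: "0 \<le> \<psi> x" for x by (simp add: \<psi>_def box_bump_bounds)
  have wS: "w \<in> Sob p \<Omega>" using w by (simp add: minimizes_def)
  \<comment> \<open>Up to the factor t, a lower bound for the gain of the linear term: where u <= 0,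
    replacing u by max u (t \<psi>) raises it by at least t \<psi>, and elsewhere it does not lower
    it.\<close>
  define h where "h x = f x * (\<psi> x * indicator {x. fst (w x) \<le> 0} x)" for x
  define A where "A = Lp_integral p \<Omega> (\<lambda>x. snd (jet \<psi> x)) / p"
  have mu: "(\<lambda>x. fst (w x)) \<in> borel_measurable M" by (rule Lp_measurable[OF fst_Lp[OF wS]])
  have "(\<lambda>x. \<psi> x * indicator {x. fst (w x) \<le> 0} x) \<in> Lp p \<Omega>"
  proof (rule Lp_bound[OF _ test_Lp(1)[OF \<psi> p0(1)] p0(1)])
    have "(\<lambda>x. indicator {..0} (fst (w x)) :: real) \<in> borel_measurable M"
      by (rule measurable_compose[OF mu]) simp
    moreover have "(\<lambda>x. indicator {..0} (fst (w x)) :: real) = indicator {x. fst (w x) \<le> 0}"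
      by (auto simp: indicator_def)
    ultimately show "(\<lambda>x. \<psi> x * indicator {x. fst (w x) \<le> 0} x) \<in> borel_measurable M"
      using Lp_measurable[OF test_Lp(1)[OF \<psi> p0(1)]] by (intro borel_measurable_times) simp_all
    show "norm (\<psi> x * indicator {x. fst (w x) \<le> 0} x) \<le> 1 * norm (\<psi> x)" for x
      by (simp add: indicator_def)
  qed simp
  then have inth: "integrable M h" unfolding h_def[abs_def] by (rule Lp_pairing_integrable[OF f(1)])
  have h0: "AE x in M. 0 \<le> h x"
    using f(2) by eventually_elim (simp add: h_def \<psi>0)
  \<comment> \<open>Minimality gives t times the integral of \<open>h\<close> at most A t^p;
    dividing by t leaves the positive power p - 1 of t.\<close>
  have le: "(LINT x|M. h x) \<le> A * t powr (p - 1)" if t: "0 < t" for t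
  proof -
    obtain m where m: "m \<in> Sob p \<Omega>" "\<And>x. fst (m x) = max (fst (w x)) (fst (t *\<^sub>R jet \<psi> x))"
      "\<And>x. norm (snd (m x)) \<le> max (norm (snd (w x))) (norm (snd (t *\<^sub>R jet \<psi> x)))"
      using Sob_max[OF wS Sob_scaleR[OF Sob_jet[OF \<psi>]]] by metis
    have jL: "(\<lambda>x. snd (jet \<psi> x)) \<in> Lp p \<Omega>" by (rule snd_Lp[OF Sob_jet[OF \<psi>]])
    have "Lp_integral p \<Omega> (shifted 0 m) \<le> (LINT x|M. norm (shifted 0 w x) powr p + t powr p * norm (snd (jet \<psi> x)) powr p)"
    proof (rule integral_mono)
      show "integrable M (\<lambda>x. norm (shifted 0 m x) powr p)" by (rule Lp_integrable[OF shifted_Lp[OF m(1)]])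
      show "integrable M (\<lambda>x. norm (shifted 0 w x) powr p + t powr p * norm (snd (jet \<psi> x)) powr p)"
        by (intro Bochner_Integration.integrable_add integrable_mult_right Lp_integrable shifted_Lp wS jL)
      fix x
      \<comment> \<open>The gradient of the maximum is bounded by the larger of the two gradients,
        so the p-th power of its norm is at most the sum of both powers.\<close>
      have "norm (snd (m x)) powr p \<le> max (norm (snd (w x))) (t * norm (snd (jet \<psi> x))) powr p"
        using m(3)[of x] t p0 by (intro powr_mono2) auto
      also have "\<dots> \<le> norm (snd (w x)) powr p + (t * norm (snd (jet \<psi> x))) powr p"
        by (auto simp: max_def)
      finally show "norm (shifted 0 m x) powr p \<le> norm (shifted 0 w x) powr p + t powr p * norm (snd (jet \<psi> x)) powr p"
        using t by (simp add: shifted_def powr_mult)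
    qed
    also have "\<dots> = Lp_integral p \<Omega> (shifted 0 w) + t powr p * (p * A)"
      using Lp_integrable[OF shifted_Lp[OF wS, of 0]] Lp_integrable[OF jL] p0 by (simp add: A_def)
    finally have "1 / p * Lp_integral p \<Omega> (shifted 0 m) \<le> 1 / p * (Lp_integral p \<Omega> (shifted 0 w) + t powr p * (p * A))"
      using p0 by (intro mult_left_mono) auto
    also have "\<dots> = 1 / p * Lp_integral p \<Omega> (shifted 0 w) + t powr p * A"
      using p0 by (simp add: distrib_left)
    finally have "1 / p * Lp_integral p \<Omega> (shifted 0 m) \<le> 1 / p * Lp_integral p \<Omega> (shifted 0 w) + t powr p * A" .
    moreover have "J f 0 w \<le> J f 0 m" using w m(1) by (simp add: minimizes_def)
    ultimately have 1: "(LINT x|M. f x * fst (m x)) - (LINT x|M. f x * fst (w x)) \<le> t powr p * A"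
      unfolding J_def by linarith
    note int = Lp_pairing_integrable[OF f(1) fst_Lp[OF m(1)]] Lp_pairing_integrable[OF f(1) fst_Lp[OF wS]]
    have "t * (LINT x|M. h x) = (LINT x|M. t * h x)" by simp
    also have "\<dots> \<le> (LINT x|M. f x * fst (m x) - f x * fst (w x))"
    proof (rule integral_mono_AE)
      show "AE x in M. t * h x \<le> f x * fst (m x) - f x * fst (w x)"
        using f(2)
      proof eventually_elim
        case (elim x)
        have "t * (\<psi> x * indicator {x. fst (w x) \<le> 0} x) \<le> fst (m x) - fst (w x)"
          using t \<psi>0[of x] by (auto simp: m(2) jet_def indicator_def)
        from mult_left_mono[OF this, of "f x"] elim show ?case
          by (simp add: h_def right_diff_distrib mult.left_commute)
      qed
    qed (use int inth in auto)
    also have "\<dots> \<le> t powr p * A" using 1 int by simp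
    also have "\<dots> = t * (A * t powr (p - 1))"
      using t powr_add[of t 1 "p - 1"] by simp
    finally show ?thesis using t by simp
  qed
  have "(LINT x|M. h x) \<le> 0"
  proof (rule LIMSEQ_le_const)
    have "(\<lambda>n. inverse (real (Suc n)) powr (p - 1)) \<longlonglongrightarrow> 0"
      by (rule tendsto_zero_powrI[OF LIMSEQ_inverse_real_of_nat tendsto_const]) (use p in auto)
    from tendsto_mult_right_zero[OF this]
    show "(\<lambda>n. A * inverse (real (Suc n)) powr (p - 1)) \<longlonglongrightarrow> 0" .
    show "\<exists>N. \<forall>n\<ge>N. (LINT x|M. h x) \<le> A * inverse (real (Suc n)) powr (p - 1)"
      using le by (intro exI[of _ 0] allI impI) simp
  qed
  from integral_nonneg_le_0_imp_AE[OF inth h0 this] f(2)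
  show "AE x in M. x \<in> box a b \<longrightarrow> 0 < fst (w x)"
  proof eventually_elim
    case (elim x)
    show ?case
    proof
      assume "x \<in> box a b"
      then have "0 < \<psi> x" unfolding \<psi>_def by (rule box_bump_pos)
      then show "0 < fst (w x)" using elim by (auto simp: h_def indicator_def split: if_splits)
    qed
  qed
qed

text \<open>J_0(W_k) <= J_s(W_k) <= J_s(w) with s = s_k: the shift only increases the norm, and
  \<open>W k\<close> minimizes for its own shift. The right side tends to J_0(w), so the
  \<open>W k\<close> eventually are almost minimizers of the limit functional.\<close>

lemma minimizer_tendsto:
  assumes f: "f \<in> Lp q \<Omega>" and w: "minimizes f 0 w"
    and W: "\<And>k. minimizes f (s k) (W k)" and s: "s \<longlonglongrightarrow> 0"
  shows "(\<lambda>k. Lp_integral p \<Omega> (\<lambda>x. W k x - w x)) \<longlonglongrightarrow> 0"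
proof -
  have wS: "w \<in> Sob p \<Omega>" and WS: "W k \<in> Sob p \<Omega>" for k using w W by (auto simp: minimizes_def)
  have m: "J f 0 w \<le> J f 0 v" if "v \<in> Sob p \<Omega>" for v using w that by (simp add: minimizes_def)
  \<comment> \<open>The difference is the constant \<open>s k\<close> in the last coordinate, so the
    integral is |s_k|^p times the finite measure of the domain.\<close>
  have "(\<lambda>k. Lp_integral p \<Omega> (\<lambda>x. shifted (s k) w x - shifted 0 w x)) \<longlonglongrightarrow> 0"
  proof -
    have "(\<lambda>k. \<bar>s k\<bar> powr p) \<longlonglongrightarrow> 0"
      by (rule tendsto_zero_powrI[OF tendsto_rabs_zero[OF s] tendsto_const]) (use p0 in auto)
    from tendsto_mult_right_zero[OF this, of "measure M (space M)"]
    show ?thesis using finite_measure_M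
      by (simp add: shifted_def norm_Pair finite_measure.integrable_const mult.commute)
  qed
  then have "(\<lambda>k. Lp_integral p \<Omega> (shifted (s k) w)) \<longlonglongrightarrow> Lp_integral p \<Omega> (shifted 0 w)"
    by (rule Lp_integral_tendsto[OF p0(2) shifted_Lp[OF wS] shifted_Lp[OF wS]])
  then have lim: "(\<lambda>k. J f (s k) w) \<longlonglongrightarrow> J f 0 w"
    unfolding J_def by (intro tendsto_diff tendsto_mult_left tendsto_const)
  have J0: "J f 0 (W k) \<le> J f (s k) w" for k
  proof -
    have "Lp_integral p \<Omega> (shifted 0 (W k)) \<le> Lp_integral p \<Omega> (shifted (s k) (W k))"
      by (rule Lp_integral_mono[OF shifted_Lp[OF WS] shifted_Lp[OF WS] p0(1)])
        (simp add: shifted_def norm_fst_le)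
    then have "1 / p * Lp_integral p \<Omega> (shifted 0 (W k)) \<le> 1 / p * Lp_integral p \<Omega> (shifted (s k) (W k))"
      using p0 by (intro mult_left_mono) auto
    then have "J f 0 (W k) \<le> J f (s k) (W k)" unfolding J_def by linarith
    also have "\<dots> \<le> J f (s k) w" using W[of k] wS by (simp add: minimizes_def)
    finally show ?thesis .
  qed
  show ?thesis
  proof (rule LIMSEQ_I)
    fix e :: real assume e: "0 < e"
    then have e2: "0 < e / 2" by simp
    obtain \<tau> where \<tau>: "0 < \<tau>" "\<And>w' v'. w' \<in> Sob p \<Omega> \<Longrightarrow> v' \<in> Sob p \<Omega> \<Longrightarrow> J f 0 w' \<le> J f 0 w + \<tau> \<Longrightarrow>
        J f 0 v' \<le> J f 0 w + \<tau> \<Longrightarrow> Lp_integral p \<Omega> (\<lambda>x. w' x - v' x) \<le> e / 2"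
      by (rule almost_minimizers_close[OF f m e2]) blast+
    have "\<forall>\<^sub>F k in sequentially. J f (s k) w < J f 0 w + \<tau>"
      by (rule order_tendstoD(2)[OF lim]) (use \<tau>(1) in simp)
    then have "\<forall>\<^sub>F k in sequentially. norm (Lp_integral p \<Omega> (\<lambda>x. W k x - w x) - 0) < e"
    proof eventually_elim
      case (elim k)
      have "Lp_integral p \<Omega> (\<lambda>x. W k x - w x) \<le> e / 2"
        using \<tau>(1) elim J0[of k] by (intro \<tau>(2) WS wS) auto
      also have "\<dots> < e" using e by simp
      finally show ?case using Lp_integral_nonneg by simp
    qed
    then show "\<exists>N. \<forall>k\<ge>N. norm (Lp_integral p \<Omega> (\<lambda>x. W k x - w x) - 0) < e"
      unfolding eventually_sequentially .
  qed
qed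

end

theorem theorem1p1:
  fixes p pstar :: real and \<Omega> :: "(real ^ 'n) set" and f :: "real ^ 'n \<Rightarrow> real"
  assumes p: "p \<in> {1<..<2} \<union> {2<..}"
    and pstar: "1 / p + 1 / pstar = 1"
    and domain: "open \<Omega>" "connected \<Omega>" "\<Omega> \<noteq> {}" "bounded \<Omega>"
    and smooth: "Ck_boundary 1 \<Omega>"
    and f: "f \<in> Lp pstar \<Omega>"
    and sgn_f: "(AE x in lebesgue_on \<Omega>. f x > 0) \<or> (AE x in lebesgue_on \<Omega>. f x < 0)"
  shows "(\<forall>\<epsilon>>0. \<exists>u. minimizer_over (W1p0 p \<Omega>) (energy_eps p \<Omega> f \<epsilon>) u) \<and>
    (\<forall>\<epsilon>>0. \<forall>u. minimizer_over (W1p0 p \<Omega>) (energy_eps p \<Omega> f \<epsilon>) u \<longrightarrow>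
       ((AE x in lebesgue_on \<Omega>. f x > 0) \<longrightarrow> (AE x in lebesgue_on \<Omega>. u x \<ge> 0)) \<and>
       ((AE x in lebesgue_on \<Omega>. f x < 0) \<longrightarrow> (AE x in lebesgue_on \<Omega>. u x \<le> 0))) \<and>
    (\<exists>ubar. minimizer_over (W1p0 p \<Omega>) (energy p \<Omega> f) ubar \<and>
       (\<forall>v. minimizer_over (W1p0 p \<Omega>) (energy p \<Omega> f) v \<longrightarrow>
          (AE x in lebesgue_on \<Omega>. v x = ubar x)) \<and>
       ((AE x in lebesgue_on \<Omega>. f x > 0) \<longrightarrow> (AE x in lebesgue_on \<Omega>. ubar x > 0)) \<and>
       ((AE x in lebesgue_on \<Omega>. f x < 0) \<longrightarrow> (AE x in lebesgue_on \<Omega>. ubar x < 0)) \<and>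
       (\<forall>U. (\<forall>\<epsilon>>0. minimizer_over (W1p0 p \<Omega>) (energy_eps p \<Omega> f \<epsilon>) (U \<epsilon>)) \<longrightarrow>
          ((\<lambda>\<epsilon>. W1p_norm p \<Omega> (\<lambda>x. U \<epsilon> x - ubar x)) \<longlongrightarrow> 0) (at_right 0)))"
proof -
  interpret sobolev p pstar \<Omega>
    by unfold_locales (use p pstar domain in auto)
  have eps_iff: "minimizer_over (W1p0 p \<Omega>) (energy_eps p \<Omega> f \<epsilon>) u \<longleftrightarrow>
      (\<exists>w. minimizes f (chi p * \<epsilon>) w \<and> u = (\<lambda>x. fst (w x)))" for \<epsilon> u
    by (rule minimizer_over_iff) (rule energy_eps_eq_J)
  have iff: "minimizer_over (W1p0 p \<Omega>) (energy p \<Omega> f) u \<longleftrightarrow>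
      (\<exists>w. minimizes f 0 w \<and> u = (\<lambda>x. fst (w x)))" for u
    by (rule minimizer_over_iff) (rule energy_eq_J)
  have neg_f: "(\<lambda>x. - f x) \<in> Lp pstar \<Omega>"
    using Lp_scaleR[OF _ f, of "-1"] q by simp
  obtain w where w: "minimizes f 0 w" by (rule minimizer_exists[OF f])
  have wS: "w \<in> Sob p \<Omega>" using w by (simp add: minimizes_def)
  have sign: "AE x in M. u x \<ge> 0" 
    if u: "minimizer_over (W1p0 p \<Omega>) (energy_eps p \<Omega> f \<epsilon>) u" and f_sign: "AE x in M. f x > 0" for \<epsilon> u
  proof -
    obtain z where z: "minimizes f (chi p * \<epsilon>) z" "u = (\<lambda>x. fst (z x))"
      using u unfolding eps_iff by blast
    show ?thesis unfolding z(2) by (rule minimizer_nonneg[OF f f_sign z(1)])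
  qed
  have sign': "AE x in M. u x \<le> 0" 
    if u: "minimizer_over (W1p0 p \<Omega>) (energy_eps p \<Omega> f \<epsilon>) u" and f_sign: "AE x in M. f x < 0" for \<epsilon> u
  proof -
    obtain z where z: "minimizes f (chi p * \<epsilon>) z" "u = (\<lambda>x. fst (z x))"
      using u unfolding eps_iff by blast
    have "AE x in M. 0 \<le> fst (- z x)"
      using f_sign by (intro minimizer_nonneg[OF neg_f _ minimizes_uminus[OF z(1)]]) simp
    then show ?thesis unfolding z(2) by simp
  qed
  have unique: "AE x in M. v x = fst (w x)" if v: "minimizer_over (W1p0 p \<Omega>) (energy p \<Omega> f) v" for v
  proof -
    obtain z where z: "minimizes f 0 z" "v = (\<lambda>x. fst (z x))"
      using v unfolding iff by blast
    show ?thesis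
      using minimizer_unique[OF f z(1) w] unfolding z(2) by eventually_elim simp
  qed
  have neg: "AE x in M. fst (w x) < 0" if "AE x in M. f x < 0"
  proof -
    have "AE x in M. 0 < fst (- w x)"
      using that by (intro minimizer_pos[OF neg_f _ minimizes_uminus[OF w]]) simp
    then show ?thesis by simp
  qed
  have conv: "((\<lambda>\<epsilon>. W1p_norm p \<Omega> (\<lambda>x. U \<epsilon> x - fst (w x))) \<longlongrightarrow> 0) (at_right 0)"
    if U: "\<forall>\<epsilon>>0. minimizer_over (W1p0 p \<Omega>) (energy_eps p \<Omega> f \<epsilon>) (U \<epsilon>)" for U
    \<comment> \<open>Along an arbitrary sequence of parameters the minimizers can be lifted to
      pairs one by one, for whichever selection \<open>U\<close> is given.\<close>
    unfolding tendsto_at_iff_sequentially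
  proof (intro allI impI)
    fix X :: "nat \<Rightarrow> real" assume X: "\<forall>i. X i \<in> {0<..} - {0}" "X \<longlonglongrightarrow> 0"
    have "\<exists>z. minimizes f (chi p * X i) z \<and> U (X i) = (\<lambda>x. fst (z x))" for i
      using U X(1) unfolding eps_iff by simp
    then obtain W where W: "\<And>i. minimizes f (chi p * X i) (W i)" "\<And>i. U (X i) = (\<lambda>x. fst (W i x))" by metis
    have WS: "W i \<in> Sob p \<Omega>" for i using W(1) by (simp add: minimizes_def)
    \<comment> \<open>The shifts \<open>chi p * X i\<close> tend to 0 for either value of
      \<open>chi p\<close>, so both ranges of p are treated alike.\<close>
    have "(\<lambda>i. Lp_integral p \<Omega> (\<lambda>x. W i x - w x)) \<longlonglongrightarrow> 0"
      by (rule minimizer_tendsto[OF f w W(1) tendsto_mult_right_zero[OF X(2)]])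
    then have "(\<lambda>i. W1p_norm p \<Omega> (\<lambda>x. fst (W i x - w x))) \<longlonglongrightarrow> 0"
      by (subst W1p_norm_tendsto_iff[OF Sob_weak_pair[OF Sob_diff[OF WS wS]]])
    then show "((\<lambda>\<epsilon>. W1p_norm p \<Omega> (\<lambda>x. U \<epsilon> x - fst (w x))) \<circ> X) \<longlonglongrightarrow> 0"
      by (simp add: o_def W(2))
  qed
  have ex: "\<exists>u. minimizer_over (W1p0 p \<Omega>) (energy_eps p \<Omega> f \<epsilon>) u" for \<epsilon>
    unfolding eps_iff using minimizer_exists[OF f] by metis
  have "minimizer_over (W1p0 p \<Omega>) (energy p \<Omega> f) (\<lambda>x. fst (w x))"
    unfolding iff using w by blast
  then have "\<exists>ubar. minimizer_over (W1p0 p \<Omega>) (energy p \<Omega> f) ubar \<and>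
     (\<forall>v. minimizer_over (W1p0 p \<Omega>) (energy p \<Omega> f) v \<longrightarrow> (AE x in M. v x = ubar x)) \<and>
     ((AE x in M. f x > 0) \<longrightarrow> (AE x in M. ubar x > 0)) \<and>
     ((AE x in M. f x < 0) \<longrightarrow> (AE x in M. ubar x < 0)) \<and>
     (\<forall>U. (\<forall>\<epsilon>>0. minimizer_over (W1p0 p \<Omega>) (energy_eps p \<Omega> f \<epsilon>) (U \<epsilon>)) \<longrightarrow>
        ((\<lambda>\<epsilon>. W1p_norm p \<Omega> (\<lambda>x. U \<epsilon> x - ubar x)) \<longlongrightarrow> 0) (at_right 0))"
    using unique minimizer_pos[OF f _ w] neg conv
    by (intro exI[of _ "\<lambda>x. fst (w x)"]) simp
  then show ?thesis using ex sign sign' by simp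
qed

end
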